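(* Let $\zeta=(\mathbf p,\phi)\in\underline{\underline{\mathcal X}}_m$ be the solution to: $c_m(\zeta,(\mathbf q,\psi))=(S_f,\psi)_{0,\Omega}$ for all $(\mathbf q,\psi)\in\underline{\underline{\mathcal X}}_m$ (mixed Dirichlet, Robin and Neumann boundary conditions). Let $\zeta_h=(\mathbf p_h,\phi_h)\in\underline{\underline{\mathbf Q}}_{m,h}\times\underline{\underline{L}}_h$ be the solution to: $c_m(\zeta_h,(\mathbf q_h,\psi_h))=(S_f,\psi_h)_{0,\Omega}$ for all $(\mathbf q_h,\psi_h)\in\underline{\underline{\mathbf Q}}_{m,h}\times\underline{\underline{L}}_h$. Let $\tilde\zeta_h=(\mathbf p_h,\tilde\phi_h)\in\underline{\underline{\mathbf Q}}_{m,h}\times\underline{\underline{V}}_m$ be a reconstruction of $\zeta_h$. Then, for every $K\in\mathcal T_h$, $$|\zeta-\tilde\zeta_h|_{+,K}\le\Big(\eta_{r,K}^2+\sum_{K'\in N(K)}\eta_{f,K'}^2+\sum_{F\in\mathcal F_h^e\cap\overline{\Gamma_V}\cap\partial K}\eta_{bc,F}^2\Big)^{1/2}.$$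
   Context: Domain and notation. $\Omega\subset\mathbb R^d$, $d\in\{2,3\}$, is bounded, connected, open, with Lipschitz piecewise smooth boundary and unit outward normal $\mathbf n$. $\{\Omega_i\}_{1\le i\le R}$ is a partition of $\Omega$ into open connected disjoint parts with Lipschitz piecewise smooth boundaries, $\overline\Omega=\cup_i\overline{\Omega_i}$, and $\mathcal PW^{1,\infty}(\Omega)=\{D\in L^\infty(\Omega): D_{|\Omega_i}\in W^{1,\infty}(\Omega_i)\ \forall i\}$. The boundary is split into three disjoint open parts, $\partial\Omega=\overline{\Gamma_D}\cup\overline{\Gamma_V}\cup\overline{\Gamma_N}$, where $\Gamma_D,\Gamma_V,\Gamma_N$ are (possibly empty) Lipschitz submanifolds of $\partial\Omega$. $(\cdot,\cdot)_{0,\mathcal O}$ and $\|\cdot\|_{0,\mathcal O}$ are $L^2(\mathcal O)$ scalar products and norms (for scalar, vector, and multi-component fields). $G\ge2$ is an integer, $N$ is odd with $\hat N=(N+1)/2\ge2$. For a function space $W$, $\underline{\underline W}=W^{\hat N\times G}$; $\underline{\underline{\mathbb R}}=\mathbb R^{\hat N\times G}$. Matrices in $(\mathbb R^{\hat N\times\hat N})^{G\times G}$ act blockwise on the $\hat N\times G$ indices (not on spatial components); $\mathrm{div}$, $\mathbf{grad}$ and normal traces act componentwise. Coefficients. $\mathcal I_G=\{1,\dots,G\}$; $\mathcal I_e$, $\mathcal I_o$ are the even, resp. odd, integers of $\{0,\dots,N\}$. $\alpha_0=1$, $\alpha_{m+1}=\frac{4(m+1)^2-1}{(m+1)\alpha_m}$,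 $t_m=\alpha_m^2/(2m+1)$. Given functions $\Sigma_t^g$, $\Sigma_{s,m}^{g'\to g}$ on $\Omega$, set $\Sigma_{r,m}^g=\Sigma_t^g-\Sigma_{s,m}^{g\to g}$. Matrices: $(\mathbb H)_{g,g'}=\delta_{g,g'}\hat{\mathbb H}$ with $\hat{\mathbb H}_{i,j}=\delta_{i,j}+\delta_{i,j-1}$; for $*\in\{e,o\}$, $(\mathbb T_* )_{g,g}=\mathrm{diag}(t_m\Sigma_{r,m}^g)_{m\in\mathcal I_*}$ and $(\mathbb T_* )_{g,g'}=-\mathrm{diag}(t_m\Sigma_{s,m}^{g'\to g})_{m\in\mathcal I_*}$ for $g'\ne g$; $(\Gamma_e)_{g,g'}=\delta_{g,g'}\hat\Gamma_e$, with $(\hat\Gamma_e)_{i,j}=\alpha_{2(i-1)}\alpha_{2(j-1)}\int_0^1xP_{2(i-1)}(x)P_{2(j-1)}(x)\,dx$, $P_m$ the $m$-th Legendre polynomial ($\Gamma_e$ is symmetric positive definite); $\tilde\Gamma_e=\mathbb H\Gamma_e^{-1}\mathbb H^T$ (symmetric positive definite). Standing assumptions: (0) $\Sigma_{r,m}^g\in\mathcal PW^{1,\infty}(\Omega)$, $\Sigma_{s,m}^{g'\to g}\in L^\infty(\Omega)$; (i) for $*\in\{e,o\}$ there are constants $0<(\Sigma_{r,*})_*\le(\Sigma_{r,*})^*$ with $(\Sigma_{r,*})_*\le t_m\Sigma_{r,m}^g\le(\Sigma_{r,*})^*$ a.e. for all $g$ and $m\in\mathcal I_*$; (ii) there is $0<\varepsilon<\frac1{G-1}$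 with $|\Sigma_{s,m}^{g\to g'}|\le\varepsilon\Sigma_{r,m}^g$ a.e. for all $m$ and $g'\ne g$; (iii) there are positive constants $(\mathbb T_o^{-1})_*,(\mathbb T_o^{-1})^*,(\mathbb T_e)_*,(\mathbb T_e)^*$ such that for all $X\in\underline{\underline{\mathbb R}}$, a.e. in $\Omega$: $(\mathbb T_o^{-1})_*\|X\|^2\le X^T\mathbb T_o^{-1}X$, $\|\mathbb T_o^{-1}X\|\le(\mathbb T_o^{-1})^*\|X\|$, $(\mathbb T_e)_*\|X\|^2\le X^T\mathbb T_eX$, $\|\mathbb T_eX\|\le(\mathbb T_e)^*\|X\|$. The source is $S_f\in\underline{\underline{L^2}}(\Omega)$. Spaces and forms. $\mathbf Q_m(\Omega)=\{\mathbf q\in\mathbf H(\mathrm{div},\Omega):(\mathbf q\cdot\mathbf n)_{|\Gamma_V}\in L^2(\Gamma_V),\ (\mathbf q\cdot\mathbf n)_{|\Gamma_N}=0\}$, $V_m=\{\psi\in H^1(\Omega):\psi_{|\Gamma_D}=0\}$, $\underline{\underline{\mathcal X}}_m=\underline{\underline{\mathbf Q}}_m(\Omega)\times\underline{\underline{L^2}}(\Omega)$. For $(\mathbf p,\phi),(\mathbf q,\psi)\in\underline{\underline{\mathcal X}}_m$, $$c_m((\mathbf p,\phi),(\mathbf q,\psi))=-(\mathbb T_o\mathbf p,\mathbf q)_{0,\Omega}+(\phi,\mathbb H^T\mathrm{div}\,\mathbf q)_{0,\Omega}+(\psi,\mathbb H^T\mathrm{div}\,\mathbf p)_{0,\Omega}+(\mathbb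 T_e\phi,\psi)_{0,\Omega}-(\tilde\Gamma_e(\mathbf p\cdot\mathbf n),\mathbf q\cdot\mathbf n)_{0,\Gamma_V},$$ and $d((\mathbf p,\phi),(\mathbf q,\psi))=c_m((\mathbf p,\phi),(-\mathbf q,\psi))$. The continuous problem is the weak form of: $\mathbb T_o\mathbf p+\mathbb H\,\mathbf{grad}\,\phi=0$ and $\mathbb H^T\mathrm{div}\,\mathbf p+\mathbb T_e\phi=S_f$ in $\Omega$, $-\mathbb H^T\mathbf p\cdot\mathbf n+\Gamma_e\phi=0$ on $\Gamma_V$, $\phi=0$ on $\Gamma_D$, $\mathbf p\cdot\mathbf n=0$ on $\Gamma_N$; its solution has $\phi\in\underline{\underline V}_m$. Discretization. $\mathcal T_h$ is a mesh of $\Omega$ made of simplices, or of rectangles ($d=2$), resp. cuboids ($d=3$); $h_K$ is the diameter of $K\in\mathcal T_h$; $\mathcal F_h^e$ is the set of boundary facets, and $\mathcal F_h^e\cap\overline{\Gamma_V}$ denotes those contained in $\overline{\Gamma_V}$; for $F\in\mathcal F_h^e$, $K_F$ is the mesh element with $F\subset\partial K_F$ and $h_{\perp F}$ is the length of the altitude of $K_F$ associated to $F$. $\mathbf Q_h\subset\{\mathbf q\in\mathbf H(\mathrm{div},\Omega):(\mathbf q\cdot\mathbf n)_{|\partial\Omega}\in L^2(\partial\Omega)\}$ and $L_h\subset L^2(\Omega)$ are finite-dimensional, $L_h$ contains the piecewise constants on $\mathcal T_h$, $\mathrm{div}\,\mathbf Q_h\subset L_h$ (e.g. Raviart-Thomas-Nédélec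 spaces), and $\mathbf Q_{m,h}=\mathbf Q_h\cap\mathbf Q_m(\Omega)$. Norms. $\delta_e,\delta_o$ are the diagonal parts of $\mathbb T_e,\mathbb T_o$. $\delta^{max}_{o,K}$ is the maximum over the diagonal entries of $\mathbb T_o$ of their supremum on $K$. $$\|(\mathbf p,\phi)\|_S^2=(\delta_o\mathbf p,\mathbf p)_{0,\Omega}+(\delta_e\phi,\phi)_{0,\Omega}+\sum_{K\in\mathcal T_h}\delta^{max}_{o,K}h_K^2\|\mathrm{div}\,\mathbf p\|_{0,K}^2+\sum_{F\in\mathcal F_h^e\cap\overline{\Gamma_V}}\delta^{max}_{o,K_F}h_{\perp F}\|\tilde\Gamma_e^{1/2}(\mathbf p\cdot\mathbf n)\|_{0,F}^2.$$ $N(K)=\{K'\in\mathcal T_h:\dim_H(\partial K'\cap\partial K)=d-1\}$ ($\dim_H$ the Hausdorff dimension), $\underline{\underline{\mathcal X}}_{m,K}=\{(\mathbf q,\psi)\in\underline{\underline{\mathcal X}}_m:\mathrm{Supp}(\psi)\subset K,\ \mathrm{Supp}(\mathbf q)\subset N(K)\}$ (meaning the union of the elements of $N(K)$), and $|\zeta|_{+,K}=\sup_{\xi\in\underline{\underline{\mathcal X}}_{m,K},\ \|\xi\|_S\le1}d(\zeta,\xi)$. Estimators. $\eta_{r,K}=\|\delta_e^{-1/2}(S_f-\mathbb H^T\mathrm{div}\,\mathbf p_h-\mathbb T_e\tilde\phi_h)\|_{0,K}$, $\eta_{f,K}=\|\delta_o^{-1/2}(\mathbb T_o\mathbf p_h+\mathbb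 H\,\mathbf{grad}\,\tilde\phi_h)\|_{0,K}$, and for $F\in\mathcal F_h^e\cap\overline{\Gamma_V}$, $\eta_{bc,F}=(\delta^{max}_{o,K_F}h_{\perp F})^{-1/2}\|\tilde\Gamma_e^{-1/2}(\mathbb H\tilde\phi_h-\tilde\Gamma_e(\mathbf p_h\cdot\mathbf n))\|_{0,F}$.
   Formalization: The sum of η_bc,F² runs over facets in Γ_V on the boundary of any K' in N(K), not only on ∂K (the printed bound fails, e.g. for K one layer inside Γ_V); the boundary facets are assumed to cover ∂Ω, each lying in the closure of one of Γ_D, Γ_V, Γ_N. *)

theory Defs
  imports
    "HOL-Analysis.Analysis"
    "HOL-Probability.Essential_Supremum"
    "HOL-Computational_Algebra.Polynomial"
begin

section \<open>Hausdorff measure and dimension\<close>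

definition hausdorff_pre :: "real \<Rightarrow> real \<Rightarrow> 'a::euclidean_space set \<Rightarrow> ennreal" where
  "hausdorff_pre s \<delta> A =
     (INF C \<in> {C :: nat \<Rightarrow> 'a set. A \<subseteq> (\<Union>n. C n) \<and> (\<forall>n. bounded (C n) \<and> diameter (C n) \<le> \<delta>)}.
        \<Sum>n. ennreal (unit_ball_vol s * (diameter (C n) / 2) powr s))"

text \<open>Only used for \<open>s > 0\<close> (\<open>0 powr 0 = 0\<close> would spoil the counting measure). The factor
  \<^term>\<open>unit_ball_vol s\<close> is the usual normalization, for which the \<open>(d-1)\<close>-dimensional measure is
  the surface measure on Lipschitz hypersurfaces.\<close>

definition hausdorff_outer :: "real \<Rightarrow> 'a::euclidean_space set \<Rightarrow> ennreal" where
  "hausdorff_outer s A = (SUP \<delta>\<in>{0<..}. hausdorff_pre s \<delta> A)"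

definition hausdorff_measure :: "real \<Rightarrow> 'a::euclidean_space measure" where
  "hausdorff_measure s =
     measure_of UNIV (lambda_system UNIV UNIV (hausdorff_outer s)) (hausdorff_outer s)"

definition hausdorff_dim :: "'a::euclidean_space set \<Rightarrow> real" where
  "hausdorff_dim A = Inf {s. 0 < s \<and> hausdorff_outer s A = 0}"

definition surf :: "'a::euclidean_space set \<Rightarrow> 'a measure" where
  "surf \<Gamma> = restrict_space (hausdorff_measure (real DIM('a) - 1)) \<Gamma>"

section \<open>Lebesgue spaces\<close>

text \<open>Functions are total; only their values on the domain, up to null sets, matter.\<close>

definition L2 :: "'a measure \<Rightarrow> ('a \<Rightarrow> 'b::euclidean_space) set" where
  "L2 M = {f \<in> borel_measurable M. integrable M (\<lambda>x. (norm (f x))\<^sup>2)}"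

definition Linf :: "'a measure \<Rightarrow> ('a \<Rightarrow> 'b::euclidean_space) set" where
  "Linf M = {f \<in> borel_measurable M. \<exists>C. AE x in M. norm (f x) \<le> C}"

definition l2_inner :: "'a measure \<Rightarrow> ('a \<Rightarrow> 'b::euclidean_space) \<Rightarrow> ('a \<Rightarrow> 'b) \<Rightarrow> real" where
  "l2_inner M f g = (LINT x|M. f x \<bullet> g x)"

definition l2_norm :: "'a measure \<Rightarrow> ('a \<Rightarrow> 'b::euclidean_space) \<Rightarrow> real" where
  "l2_norm M f = sqrt (LINT x|M. (norm (f x))\<^sup>2)"

section \<open>Sobolev spaces and weak derivatives\<close>

definition C1_grad :: "('a::euclidean_space \<Rightarrow> real) \<Rightarrow> ('a \<Rightarrow> 'a) \<Rightarrow> bool" where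
  "C1_grad u u' \<longleftrightarrow> (\<forall>x. GDERIV u x :> u' x) \<and> continuous_on UNIV u'"

text \<open>First-order weak derivatives are tested with compactly supported \<open>C\<^sup>1\<close> functions; by
  mollification this is the same as testing with compactly supported smooth functions.\<close>

definition test_fun :: "'a::euclidean_space set \<Rightarrow> ('a \<Rightarrow> real) \<Rightarrow> ('a \<Rightarrow> 'a) \<Rightarrow> bool" where
  "test_fun \<Omega> \<theta> \<theta>' \<longleftrightarrow> C1_grad \<theta> \<theta>' \<and> (\<exists>S. compact S \<and> S \<subseteq> \<Omega> \<and> (\<forall>x. x \<notin> S \<longrightarrow> \<theta> x = 0))"

definition is_wgrad :: "'a::euclidean_space set \<Rightarrow> ('a \<Rightarrow> real) \<Rightarrow> ('a \<Rightarrow> 'a) \<Rightarrow> bool" where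
  "is_wgrad \<Omega> v g \<longleftrightarrow> (\<forall>\<theta> \<theta>'. test_fun \<Omega> \<theta> \<theta>' \<longrightarrow>
     (LINT x|lebesgue_on \<Omega>. v x *\<^sub>R \<theta>' x) = - (LINT x|lebesgue_on \<Omega>. \<theta> x *\<^sub>R g x))"

definition is_wdiv :: "'a::euclidean_space set \<Rightarrow> ('a \<Rightarrow> 'a) \<Rightarrow> ('a \<Rightarrow> real) \<Rightarrow> bool" where
  "is_wdiv \<Omega> q f \<longleftrightarrow> (\<forall>\<theta> \<theta>'. test_fun \<Omega> \<theta> \<theta>' \<longrightarrow>
     (LINT x|lebesgue_on \<Omega>. q x \<bullet> \<theta>' x) = - (LINT x|lebesgue_on \<Omega>. \<theta> x * f x))"

definition H1 :: "'a::euclidean_space set \<Rightarrow> ('a \<Rightarrow> real) set" where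
  "H1 \<Omega> = {v \<in> L2 (lebesgue_on \<Omega>). \<exists>g \<in> L2 (lebesgue_on \<Omega>). is_wgrad \<Omega> v g}"

definition Hdiv :: "'a::euclidean_space set \<Rightarrow> ('a \<Rightarrow> 'a) set" where
  "Hdiv \<Omega> = {q \<in> L2 (lebesgue_on \<Omega>). \<exists>f \<in> L2 (lebesgue_on \<Omega>). is_wdiv \<Omega> q f}"

definition W1inf :: "'a::euclidean_space set \<Rightarrow> ('a \<Rightarrow> real) set" where
  "W1inf \<Omega> = {v \<in> Linf (lebesgue_on \<Omega>). \<exists>g \<in> Linf (lebesgue_on \<Omega>). is_wgrad \<Omega> v g}"

text \<open>Weak derivatives are unique almost everywhere, so the choice of representative is immaterial.\<close>

definition wgrad :: "'a::euclidean_space set \<Rightarrow> ('a \<Rightarrow> real) \<Rightarrow> 'a \<Rightarrow> 'a" where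
  "wgrad \<Omega> v = (SOME g. g \<in> L2 (lebesgue_on \<Omega>) \<and> is_wgrad \<Omega> v g)"

definition wdiv :: "'a::euclidean_space set \<Rightarrow> ('a \<Rightarrow> 'a) \<Rightarrow> 'a \<Rightarrow> real" where
  "wdiv \<Omega> q = (SOME f. f \<in> L2 (lebesgue_on \<Omega>) \<and> is_wdiv \<Omega> q f)"

definition PW1inf :: "'a::euclidean_space set \<Rightarrow> 'a set set \<Rightarrow> ('a \<Rightarrow> real) set" where
  "PW1inf \<Omega> P = {D \<in> Linf (lebesgue_on \<Omega>). \<forall>S\<in>P. D \<in> W1inf S}"

section \<open>Traces\<close>

text \<open>\<open>w\<close> is the trace of \<open>v \<in> H\<^sup>1(\<Omega>)\<close>: the limit in \<open>L\<^sup>2(\<partial>\<Omega>)\<close> of the boundary values of functions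
  that are \<open>C\<^sup>1\<close> up to the boundary and converge to \<open>v\<close> in \<open>H\<^sup>1(\<Omega>)\<close>.\<close>

definition has_trace :: "'a::euclidean_space set \<Rightarrow> ('a \<Rightarrow> real) \<Rightarrow> ('a \<Rightarrow> real) \<Rightarrow> bool" where
  "has_trace \<Omega> v w \<longleftrightarrow> v \<in> H1 \<Omega> \<and> w \<in> L2 (surf (frontier \<Omega>)) \<and>
     (\<exists>u u'. (\<forall>n::nat. C1_grad (u n) (u' n)) \<and>
        (\<lambda>n. l2_norm (lebesgue_on \<Omega>) (\<lambda>x. u n x - v x)) \<longlonglongrightarrow> 0 \<and>
        (\<lambda>n. l2_norm (lebesgue_on \<Omega>) (\<lambda>x. u' n x - wgrad \<Omega> v x)) \<longlonglongrightarrow> 0 \<and>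
        (\<lambda>n. l2_norm (surf (frontier \<Omega>)) (\<lambda>x. u n x - w x)) \<longlonglongrightarrow> 0)"

definition trace_of :: "'a::euclidean_space set \<Rightarrow> ('a \<Rightarrow> real) \<Rightarrow> 'a \<Rightarrow> real" where
  "trace_of \<Omega> v = (SOME w. has_trace \<Omega> v w)"

text \<open>\<open>(q \<sqdot> n)\<close> restricted to a relatively open part \<open>\<Gamma>\<close> of \<open>\<partial>\<Omega>\<close> is the function \<open>g \<in> L\<^sup>2(\<Gamma>)\<close>. The
  normal trace of \<open>q \<in> H(div)\<close> is the functional given by Green's formula; it is restricted to \<open>\<Gamma>\<close>
  by pairing it with the traces that vanish on \<open>\<partial>\<Omega> - \<Gamma>\<close>.\<close>

definition has_ntrace ::
  "'a::euclidean_space set \<Rightarrow> 'a set \<Rightarrow> ('a \<Rightarrow> 'a) \<Rightarrow> ('a \<Rightarrow> real) \<Rightarrow> bool" where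
  "has_ntrace \<Omega> \<Gamma> q g \<longleftrightarrow> q \<in> Hdiv \<Omega> \<and> g \<in> L2 (surf \<Gamma>) \<and>
     (\<forall>v w. has_trace \<Omega> v w \<and> (AE x in surf (frontier \<Omega> - \<Gamma>). w x = 0) \<longrightarrow>
        l2_inner (lebesgue_on \<Omega>) q (wgrad \<Omega> v) + l2_inner (lebesgue_on \<Omega>) (wdiv \<Omega> q) v
          = l2_inner (surf \<Gamma>) g w)"

definition ntrace :: "'a::euclidean_space set \<Rightarrow> 'a set \<Rightarrow> ('a \<Rightarrow> 'a) \<Rightarrow> 'a \<Rightarrow> real" where
  "ntrace \<Omega> \<Gamma> q = (SOME g. has_ntrace \<Omega> \<Gamma> q g)"

text \<open>The two boundary conditions on \<open>\<Gamma>V\<close> and \<open>\<Gamma>N\<close> are imposed jointly on \<open>\<Gamma>V \<union> \<Gamma>N\<close>, i.e. they are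
  tested with all \<open>H\<^sup>1\<close> functions that vanish on the remaining part of the boundary. This is the usual
  meaning of a homogeneous normal trace in mixed methods; the functional cannot
  carry a part concentrated on the interface of \<open>\<Gamma>V\<close> and \<open>\<Gamma>N\<close>.\<close>

definition Q_space :: "'a::euclidean_space set \<Rightarrow> 'a set \<Rightarrow> 'a set \<Rightarrow> ('a \<Rightarrow> 'a) set" where
  "Q_space \<Omega> \<Gamma>V \<Gamma>N = {q. \<exists>g. has_ntrace \<Omega> (\<Gamma>V \<union> \<Gamma>N) q g \<and> (AE x in surf \<Gamma>N. g x = 0)}"

text \<open>By the trace theorem the first conjunct holds for every \<open>H\<^sup>1\<close> function on a Lipschitz domain.
  It only makes explicit that \<^const>\<open>trace_of\<close> picks a genuine trace.\<close>

definition V_space :: "'a::euclidean_space set \<Rightarrow> 'a set \<Rightarrow> ('a \<Rightarrow> real) set" where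
  "V_space \<Omega> \<Gamma>D = {\<psi> \<in> H1 \<Omega>. has_trace \<Omega> \<psi> (trace_of \<Omega> \<psi>) \<and> (AE x in surf \<Gamma>D. trace_of \<Omega> \<psi> x = 0)}"

section \<open>Domains\<close>

definition lipschitz_boundary :: "'a::euclidean_space set \<Rightarrow> bool" where
  "lipschitz_boundary \<Omega> \<longleftrightarrow> (\<forall>x\<in>frontier \<Omega>. \<exists>r e \<gamma> L. 0 < r \<and> norm e = 1 \<and>
     L-lipschitz_on UNIV (\<gamma> :: 'a \<Rightarrow> real) \<and>
     \<Omega> \<inter> ball x r = {y \<in> ball x r. \<gamma> (y - (y \<bullet> e) *\<^sub>R e) < y \<bullet> e})"

text \<open>\<open>C\<^sup>\<infinity>\<close> on an open set: \<open>f\<close> lies in a family of differentiable functions that is closed under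
  taking partial derivatives.\<close>

definition C_infinity_on :: "'a::euclidean_space set \<Rightarrow> ('a \<Rightarrow> real) \<Rightarrow> bool" where
  "C_infinity_on U f \<longleftrightarrow> (\<exists>\<F>. f \<in> \<F> \<and> (\<forall>g\<in>\<F>. (\<forall>x\<in>U. g differentiable (at x)) \<and>
     (\<forall>b\<in>Basis. \<exists>h\<in>\<F>. \<forall>x\<in>U. h x = frechet_derivative g (at x) b)))"

definition piecewise_smooth_boundary :: "'a::euclidean_space set \<Rightarrow> bool" where
  "piecewise_smooth_boundary \<Omega> \<longleftrightarrow> (\<exists>\<M>. finite \<M> \<and> frontier \<Omega> = \<Union>\<M> \<and>
     (\<forall>M\<in>\<M>. compact M \<and> (\<exists>U f. open U \<and> M \<subseteq> U \<and> C_infinity_on U f \<and>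
        (\<forall>x\<in>M. f x = 0 \<and> (\<exists>b. frechet_derivative f (at x) b \<noteq> 0)))))"

definition regular_domain :: "'a::euclidean_space set \<Rightarrow> bool" where
  "regular_domain \<Omega> \<longleftrightarrow> open \<Omega> \<and> \<Omega> \<noteq> {} \<and> connected \<Omega> \<and> bounded \<Omega> \<and>
     lipschitz_boundary \<Omega> \<and> piecewise_smooth_boundary \<Omega>"

definition domain_partition :: "'a::euclidean_space set \<Rightarrow> 'a set set \<Rightarrow> bool" where
  "domain_partition \<Omega> P \<longleftrightarrow> finite P \<and> disjoint P \<and>
     (\<forall>S\<in>P. S \<subseteq> \<Omega> \<and> regular_domain S) \<and> closure \<Omega> = (\<Union>S\<in>P. closure S)"

text \<open>A relatively open \<open>\<Gamma> \<subseteq> \<partial>\<Omega>\<close> whose closure is a Lipschitz submanifold with boundary: near each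
  point of its relative boundary a bi-Lipschitz chart flattens \<open>\<partial>\<Omega>\<close> to a hyperplane and \<open>\<Gamma>\<close> to a
  half of it. At the points of \<open>\<Gamma>\<close> itself there is nothing to require since \<open>\<partial>\<Omega>\<close> is Lipschitz.\<close>

definition lipschitz_boundary_part :: "'a::euclidean_space set \<Rightarrow> 'a set \<Rightarrow> bool" where
  "lipschitz_boundary_part \<Omega> \<Gamma> \<longleftrightarrow> openin (top_of_set (frontier \<Omega>)) \<Gamma> \<and>
     (\<forall>x\<in>closure \<Gamma> - \<Gamma>. \<exists>U h L e1 e2. open U \<and> x \<in> U \<and> open (h ` U) \<and> inj_on h U \<and>
        L-lipschitz_on U (h :: 'a \<Rightarrow> 'a) \<and> L-lipschitz_on (h ` U) (inv_into U h) \<and>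
        h x = 0 \<and> norm e1 = 1 \<and> norm e2 = 1 \<and> e1 \<bullet> e2 = 0 \<and>
        h ` (U \<inter> frontier \<Omega>) = {y \<in> h ` U. y \<bullet> e1 = 0} \<and>
        h ` (U \<inter> \<Gamma>) = {y \<in> h ` U. y \<bullet> e1 = 0 \<and> 0 < y \<bullet> e2})"

definition boundary_partition ::
  "'a::euclidean_space set \<Rightarrow> 'a set \<Rightarrow> 'a set \<Rightarrow> 'a set \<Rightarrow> bool" where
  "boundary_partition \<Omega> \<Gamma>D \<Gamma>V \<Gamma>N \<longleftrightarrow>
     (\<forall>\<Gamma>\<in>{\<Gamma>D, \<Gamma>V, \<Gamma>N}. lipschitz_boundary_part \<Omega> \<Gamma>) \<and>
     \<Gamma>D \<inter> \<Gamma>V = {} \<and> \<Gamma>D \<inter> \<Gamma>N = {} \<and> \<Gamma>V \<inter> \<Gamma>N = {} \<and>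
     frontier \<Omega> = closure \<Gamma>D \<union> closure \<Gamma>V \<union> closure \<Gamma>N"

section \<open>Meshes\<close>

text \<open>Rectangles and cuboids need not be aligned with the coordinate axes.\<close>

definition cuboid :: "'a::euclidean_space set \<Rightarrow> bool" where
  "cuboid K \<longleftrightarrow> (\<exists>(f :: 'a \<Rightarrow> 'a) a b. orthogonal_transformation f \<and> box a b \<noteq> {} \<and> K = f ` cbox a b)"

definition boundary_facets :: "'a::euclidean_space set \<Rightarrow> 'a set set \<Rightarrow> 'a set set" where
  "boundary_facets \<Omega> \<T> = {F. F \<subseteq> frontier \<Omega> \<and> (\<exists>K\<in>\<T>. F facet_of K)}"

text \<open>Hanging nodes are permitted, provided that the boundary is the union of the boundary facets
  (which is automatic for conforming meshes) and that each of these belongs to one part of the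
  boundary.\<close>

definition mesh ::
  "'a::euclidean_space set \<Rightarrow> 'a set \<Rightarrow> 'a set \<Rightarrow> 'a set \<Rightarrow> 'a set set \<Rightarrow> bool" where
  "mesh \<Omega> \<Gamma>D \<Gamma>V \<Gamma>N \<T> \<longleftrightarrow> finite \<T> \<and>
     ((\<forall>K\<in>\<T>. int DIM('a) simplex K) \<or> (\<forall>K\<in>\<T>. cuboid K)) \<and>
     \<Union>\<T> = closure \<Omega> \<and>
     pairwise (\<lambda>K K'. interior K \<inter> interior K' = {}) \<T> \<and>
     \<Union>(boundary_facets \<Omega> \<T>) = frontier \<Omega> \<and>
     (\<forall>F\<in>boundary_facets \<Omega> \<T>. F \<subseteq> closure \<Gamma>D \<or> F \<subseteq> closure \<Gamma>V \<or> F \<subseteq> closure \<Gamma>N)"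

definition facets_in ::
  "'a::euclidean_space set \<Rightarrow> 'a set set \<Rightarrow> 'a set \<Rightarrow> 'a set set" where
  "facets_in \<Omega> \<T> \<Gamma> = {F \<in> boundary_facets \<Omega> \<T>. F \<subseteq> closure \<Gamma>}"

definition elem_of_facet :: "'a::euclidean_space set set \<Rightarrow> 'a set \<Rightarrow> 'a set" where
  "elem_of_facet \<T> F = (THE K. K \<in> \<T> \<and> F \<subseteq> frontier K)"

text \<open>The length of the altitude of \<open>K\<close> on the facet \<open>F\<close>: the largest distance of a point of \<open>K\<close> to the
  hyperplane spanned by \<open>F\<close>.\<close>

definition altitude :: "'a::euclidean_space set \<Rightarrow> 'a set \<Rightarrow> real" where
  "altitude K F = (SUP x\<in>K. infdist x (affine hull F))"

definition nbrs :: "'a::euclidean_space set set \<Rightarrow> 'a set \<Rightarrow> 'a set set" where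
  "nbrs \<T> K = {K' \<in> \<T>. hausdorff_dim (frontier K' \<inter> frontier K) = real DIM('a) - 1}"

text \<open>The facets of \<open>\<Gamma>\<close> that a flux supported in \<^term>\<open>\<Union>(nbrs \<T> K)\<close> can reach. Those of the neighbours
  of \<open>K\<close> have to be included: with the facets on \<open>\<partial>K\<close> alone, the residual on the facets of the
  neighbours is not controlled and the local estimate fails.\<close>

definition local_facets ::
  "'a::euclidean_space set \<Rightarrow> 'a set set \<Rightarrow> 'a set \<Rightarrow> 'a set \<Rightarrow> 'a set set" where
  "local_facets \<Omega> \<T> \<Gamma> K = {F \<in> facets_in \<Omega> \<T> \<Gamma>. \<exists>K'\<in>nbrs \<T> K. F \<subseteq> frontier K'}"

section \<open>Discrete spaces\<close>

definition fin_dim_subspace :: "('a \<Rightarrow> 'b::real_vector) set \<Rightarrow> bool" where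
  "fin_dim_subspace W \<longleftrightarrow>
     (\<exists>(n::nat) B. W = range (\<lambda>(c :: nat \<Rightarrow> real) x. \<Sum>k<n. c k *\<^sub>R B k x))"

definition discrete_spaces ::
  "'a::euclidean_space set \<Rightarrow> 'a set set \<Rightarrow> ('a \<Rightarrow> 'a) set \<Rightarrow> ('a \<Rightarrow> real) set \<Rightarrow> bool" where
  "discrete_spaces \<Omega> \<T> Qh Lh \<longleftrightarrow> fin_dim_subspace Qh \<and> fin_dim_subspace Lh \<and>
     (\<forall>q\<in>Qh. q \<in> Hdiv \<Omega> \<and> (\<exists>g. has_ntrace \<Omega> (frontier \<Omega>) q g)) \<and>
     Lh \<subseteq> L2 (lebesgue_on \<Omega>) \<and>
     (\<forall>K\<in>\<T>. \<exists>v\<in>Lh. AE x in lebesgue_on \<Omega>. v x = indicator K x) \<and>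
     (\<forall>q\<in>Qh. \<exists>v\<in>Lh. AE x in lebesgue_on \<Omega>. v x = wdiv \<Omega> q x)"

section \<open>Matrices\<close>

text \<open>Multi-component fields are indexed by \<^typ>\<open>'n \<times> 'g\<close>, where the type \<open>'n\<close> has as many elements as
  there are even (or odd) moments and \<open>'g\<close> is the set of energy groups. The order on \<open>'n\<close> serves to
  number the moments: \<open>idx\<close> counts from 0.\<close>

definition idx :: "'n::{finite,linorder} \<Rightarrow> nat" where
  "idx i = card {j. j < i}"

definition multi :: "('a \<Rightarrow> 'b) set \<Rightarrow> ('a \<Rightarrow> 'b ^ 'i) set" where
  "multi W = {u. \<forall>i. (\<lambda>x. u x $ i) \<in> W}"

text \<open>Blockwise action on multi-component vector fields.\<close>

definition mact :: "real ^ 'i ^ 'i \<Rightarrow> 'b::real_vector ^ 'i \<Rightarrow> 'b ^ 'i" where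
  "mact A p = (\<chi> r. \<Sum>c\<in>UNIV. (A $ r $ c) *\<^sub>R (p $ c))"

definition spd :: "real ^ 'i ^ 'i \<Rightarrow> bool" where
  "spd A \<longleftrightarrow> transpose A = A \<and> (\<forall>X. X \<noteq> 0 \<longrightarrow> 0 < X \<bullet> (A *v X))"

definition spd_sqrt :: "real ^ 'i ^ 'i \<Rightarrow> real ^ 'i ^ 'i" where
  "spd_sqrt A = (THE B. spd B \<and> B ** B = A)"

definition diag_part :: "real ^ 'i ^ 'i \<Rightarrow> real ^ 'i ^ 'i" where
  "diag_part A = (\<chi> r c. if r = c then A $ r $ r else 0)"

definition diag_inv_sqrt :: "real ^ 'i ^ 'i \<Rightarrow> real ^ 'i ^ 'i" where
  "diag_inv_sqrt A = (\<chi> r c. if r = c then 1 / sqrt (A $ r $ r) else 0)"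

fun alpha :: "nat \<Rightarrow> real" where
  "alpha 0 = 1"
| "alpha (Suc m) = (4 * (real m + 1)\<^sup>2 - 1) / ((real m + 1) * alpha m)"

definition tcoef :: "nat \<Rightarrow> real" where
  "tcoef m = (alpha m)\<^sup>2 / (2 * real m + 1)"

definition legendre :: "nat \<Rightarrow> real poly" where
  "legendre m = smult (1 / (2 ^ m * fact m)) ((pderiv ^^ m) ([:-1, 0, 1:] ^ m))"

text \<open>\<open>\<Sigma>s m g' g\<close> is the scattering cross section of moment \<open>m\<close> from group \<open>g'\<close> to group \<open>g\<close>.\<close>

definition removal ::
  "('g \<Rightarrow> 'a \<Rightarrow> real) \<Rightarrow> (nat \<Rightarrow> 'g \<Rightarrow> 'g \<Rightarrow> 'a \<Rightarrow> real) \<Rightarrow> nat \<Rightarrow> 'g \<Rightarrow> 'a \<Rightarrow> real" where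
  "removal \<Sigma>t \<Sigma>s m g x = \<Sigma>t g x - \<Sigma>s m g g x"

definition T_mat ::
  "('n::finite \<Rightarrow> nat) \<Rightarrow> ('g::finite \<Rightarrow> 'a \<Rightarrow> real) \<Rightarrow> (nat \<Rightarrow> 'g \<Rightarrow> 'g \<Rightarrow> 'a \<Rightarrow> real) \<Rightarrow> 'a
     \<Rightarrow> real ^ ('n \<times> 'g) ^ ('n \<times> 'g)" where
  "T_mat mom \<Sigma>t \<Sigma>s x = (\<chi> r c.
     if fst r \<noteq> fst c then 0
     else if snd r = snd c then tcoef (mom (fst r)) * removal \<Sigma>t \<Sigma>s (mom (fst r)) (snd r) x
     else - (tcoef (mom (fst r)) * \<Sigma>s (mom (fst r)) (snd c) (snd r) x))"

definition Te_mat ::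
  "('g \<Rightarrow> 'a \<Rightarrow> real) \<Rightarrow> (nat \<Rightarrow> 'g \<Rightarrow> 'g \<Rightarrow> 'a \<Rightarrow> real) \<Rightarrow> 'a
     \<Rightarrow> real ^ ('n::{finite,linorder} \<times> 'g::finite) ^ ('n \<times> 'g)" where
  "Te_mat = T_mat (\<lambda>i. 2 * idx i)"

definition To_mat ::
  "('g \<Rightarrow> 'a \<Rightarrow> real) \<Rightarrow> (nat \<Rightarrow> 'g \<Rightarrow> 'g \<Rightarrow> 'a \<Rightarrow> real) \<Rightarrow> 'a
     \<Rightarrow> real ^ ('n::{finite,linorder} \<times> 'g::finite) ^ ('n \<times> 'g)" where
  "To_mat = T_mat (\<lambda>i. 2 * idx i + 1)"

definition H_mat :: "real ^ ('n::{finite,linorder} \<times> 'g::finite) ^ ('n \<times> 'g)" where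
  "H_mat = (\<chi> r c. if snd r = snd c
     then of_bool (fst r = fst c) + of_bool (idx (fst c) = idx (fst r) + 1) else 0)"

definition Gamma_mat :: "real ^ ('n::{finite,linorder} \<times> 'g::finite) ^ ('n \<times> 'g)" where
  "Gamma_mat = (\<chi> r c. if snd r = snd c
     then alpha (2 * idx (fst r)) * alpha (2 * idx (fst c)) *
       integral {0..1} (\<lambda>x. x * poly (legendre (2 * idx (fst r))) x
                              * poly (legendre (2 * idx (fst c))) x)
     else 0)"

definition Gamma_tilde :: "real ^ ('n::{finite,linorder} \<times> 'g::finite) ^ ('n \<times> 'g)" where
  "Gamma_tilde = H_mat ** matrix_inv Gamma_mat ** transpose H_mat"

section \<open>The mixed problem\<close>

definition mgrad :: "'a::euclidean_space set \<Rightarrow> ('a \<Rightarrow> real ^ 'i) \<Rightarrow> 'a \<Rightarrow> 'a ^ 'i" where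
  "mgrad \<Omega> \<phi> x = (\<chi> i. wgrad \<Omega> (\<lambda>y. \<phi> y $ i) x)"

definition mdiv :: "'a::euclidean_space set \<Rightarrow> ('a \<Rightarrow> 'a ^ 'i) \<Rightarrow> 'a \<Rightarrow> real ^ 'i" where
  "mdiv \<Omega> p x = (\<chi> i. wdiv \<Omega> (\<lambda>y. p y $ i) x)"

definition mtrace :: "'a::euclidean_space set \<Rightarrow> ('a \<Rightarrow> real ^ 'i) \<Rightarrow> 'a \<Rightarrow> real ^ 'i" where
  "mtrace \<Omega> \<phi> x = (\<chi> i. trace_of \<Omega> (\<lambda>y. \<phi> y $ i) x)"

definition mntrace ::
  "'a::euclidean_space set \<Rightarrow> 'a set \<Rightarrow> 'a set \<Rightarrow> ('a \<Rightarrow> 'a ^ 'i) \<Rightarrow> 'a \<Rightarrow> real ^ 'i" where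
  "mntrace \<Omega> \<Gamma>V \<Gamma>N p x = (\<chi> i. ntrace \<Omega> (\<Gamma>V \<union> \<Gamma>N) (\<lambda>y. p y $ i) x)"

type_synonym ('a, 'i) mfields = "('a \<Rightarrow> 'a ^ 'i) \<times> ('a \<Rightarrow> real ^ 'i)"

definition X_space ::
  "'a::euclidean_space set \<Rightarrow> 'a set \<Rightarrow> 'a set \<Rightarrow> ('a, 'i::finite) mfields set" where
  "X_space \<Omega> \<Gamma>V \<Gamma>N = multi (Q_space \<Omega> \<Gamma>V \<Gamma>N) \<times> multi (L2 (lebesgue_on \<Omega>))"

definition c_form ::
  "'a::euclidean_space set \<Rightarrow> 'a set \<Rightarrow> 'a set
     \<Rightarrow> ('a \<Rightarrow> real ^ ('n \<times> 'g) ^ ('n \<times> 'g)) \<Rightarrow> ('a \<Rightarrow> real ^ ('n \<times> 'g) ^ ('n \<times> 'g))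
     \<Rightarrow> ('a, 'n::{finite,linorder} \<times> 'g::finite) mfields \<Rightarrow> ('a, 'n \<times> 'g) mfields \<Rightarrow> real" where
  "c_form \<Omega> \<Gamma>V \<Gamma>N To Te = (\<lambda>(p, \<phi>) (q, \<psi>).
     - l2_inner (lebesgue_on \<Omega>) (\<lambda>x. mact (To x) (p x)) q
     + l2_inner (lebesgue_on \<Omega>) \<phi> (\<lambda>x. transpose H_mat *v mdiv \<Omega> q x)
     + l2_inner (lebesgue_on \<Omega>) \<psi> (\<lambda>x. transpose H_mat *v mdiv \<Omega> p x)
     + l2_inner (lebesgue_on \<Omega>) (\<lambda>x. Te x *v \<phi> x) \<psi>
     - l2_inner (surf \<Gamma>V) (\<lambda>x. Gamma_tilde *v mntrace \<Omega> \<Gamma>V \<Gamma>N p x) (mntrace \<Omega> \<Gamma>V \<Gamma>N q))"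

definition d_form ::
  "'a::euclidean_space set \<Rightarrow> 'a set \<Rightarrow> 'a set
     \<Rightarrow> ('a \<Rightarrow> real ^ ('n \<times> 'g) ^ ('n \<times> 'g)) \<Rightarrow> ('a \<Rightarrow> real ^ ('n \<times> 'g) ^ ('n \<times> 'g))
     \<Rightarrow> ('a, 'n::{finite,linorder} \<times> 'g::finite) mfields \<Rightarrow> ('a, 'n \<times> 'g) mfields \<Rightarrow> real" where
  "d_form \<Omega> \<Gamma>V \<Gamma>N To Te \<zeta> = (\<lambda>(q, \<psi>). c_form \<Omega> \<Gamma>V \<Gamma>N To Te \<zeta> (\<lambda>x. - q x, \<psi>))"

section \<open>Norms and estimators\<close>

text \<open>The coefficients are defined up to null sets, so suprema on an element are essential ones.\<close>

definition delta_max :: "('a::euclidean_space \<Rightarrow> real ^ 'i ^ 'i) \<Rightarrow> 'a set \<Rightarrow> real" where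
  "delta_max To K =
     Max (range (\<lambda>r. real_of_ereal (esssup (lebesgue_on K) (\<lambda>x. ereal (To x $ r $ r)))))"

definition S_norm ::
  "'a::euclidean_space set \<Rightarrow> 'a set \<Rightarrow> 'a set \<Rightarrow> 'a set set
     \<Rightarrow> ('a \<Rightarrow> real ^ ('n \<times> 'g) ^ ('n \<times> 'g)) \<Rightarrow> ('a \<Rightarrow> real ^ ('n \<times> 'g) ^ ('n \<times> 'g))
     \<Rightarrow> ('a, 'n::{finite,linorder} \<times> 'g::finite) mfields \<Rightarrow> real" where
  "S_norm \<Omega> \<Gamma>V \<Gamma>N \<T> To Te = (\<lambda>(p, \<phi>). sqrt (
     l2_inner (lebesgue_on \<Omega>) (\<lambda>x. mact (diag_part (To x)) (p x)) p
     + l2_inner (lebesgue_on \<Omega>) (\<lambda>x. diag_part (Te x) *v \<phi> x) \<phi>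
     + (\<Sum>K\<in>\<T>. delta_max To K * (diameter K)\<^sup>2 * (l2_norm (lebesgue_on K) (mdiv \<Omega> p))\<^sup>2)
     + (\<Sum>F\<in>facets_in \<Omega> \<T> \<Gamma>V.
          delta_max To (elem_of_facet \<T> F) * altitude (elem_of_facet \<T> F) F *
          (l2_norm (surf F) (\<lambda>x. spd_sqrt Gamma_tilde *v mntrace \<Omega> \<Gamma>V \<Gamma>N p x))\<^sup>2)))"

definition X_local ::
  "'a::euclidean_space set \<Rightarrow> 'a set \<Rightarrow> 'a set \<Rightarrow> 'a set set \<Rightarrow> 'a set
     \<Rightarrow> ('a, 'i::finite) mfields set" where
  "X_local \<Omega> \<Gamma>V \<Gamma>N \<T> K = {(q, \<psi>) \<in> X_space \<Omega> \<Gamma>V \<Gamma>N.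
     (AE x in lebesgue_on \<Omega>. x \<notin> K \<longrightarrow> \<psi> x = 0) \<and>
     (AE x in lebesgue_on \<Omega>. x \<notin> \<Union>(nbrs \<T> K) \<longrightarrow> q x = 0)}"

text \<open>Valued in \<^typ>\<open>ereal\<close>, so that the supremum is meaningful without a boundedness proof.\<close>

definition plus_norm ::
  "'a::euclidean_space set \<Rightarrow> 'a set \<Rightarrow> 'a set \<Rightarrow> 'a set set
     \<Rightarrow> ('a \<Rightarrow> real ^ ('n \<times> 'g) ^ ('n \<times> 'g)) \<Rightarrow> ('a \<Rightarrow> real ^ ('n \<times> 'g) ^ ('n \<times> 'g))
     \<Rightarrow> 'a set \<Rightarrow> ('a, 'n::{finite,linorder} \<times> 'g::finite) mfields \<Rightarrow> ereal" where
  "plus_norm \<Omega> \<Gamma>V \<Gamma>N \<T> To Te K \<zeta> =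
     (SUP \<xi>\<in>{\<xi> \<in> X_local \<Omega> \<Gamma>V \<Gamma>N \<T> K. S_norm \<Omega> \<Gamma>V \<Gamma>N \<T> To Te \<xi> \<le> 1}.
        ereal (d_form \<Omega> \<Gamma>V \<Gamma>N To Te \<zeta> \<xi>))"

definition eta_r ::
  "'a::euclidean_space set \<Rightarrow> ('a \<Rightarrow> real ^ ('n \<times> 'g) ^ ('n \<times> 'g))
     \<Rightarrow> ('a \<Rightarrow> real ^ ('n \<times> 'g)) \<Rightarrow> ('a \<Rightarrow> 'a ^ ('n::{finite,linorder} \<times> 'g::finite))
     \<Rightarrow> ('a \<Rightarrow> real ^ ('n \<times> 'g)) \<Rightarrow> 'a set \<Rightarrow> real" where
  "eta_r \<Omega> Te Sf ph \<phi>t K = l2_norm (lebesgue_on K) (\<lambda>x.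
     diag_inv_sqrt (Te x) *v (Sf x - transpose H_mat *v mdiv \<Omega> ph x - Te x *v \<phi>t x))"

definition eta_f ::
  "'a::euclidean_space set \<Rightarrow> ('a \<Rightarrow> real ^ ('n \<times> 'g) ^ ('n \<times> 'g))
     \<Rightarrow> ('a \<Rightarrow> 'a ^ ('n::{finite,linorder} \<times> 'g::finite))
     \<Rightarrow> ('a \<Rightarrow> real ^ ('n \<times> 'g)) \<Rightarrow> 'a set \<Rightarrow> real" where
  "eta_f \<Omega> To ph \<phi>t K = l2_norm (lebesgue_on K) (\<lambda>x.
     mact (diag_inv_sqrt (To x)) (mact (To x) (ph x) + mact H_mat (mgrad \<Omega> \<phi>t x)))"

definition eta_bc ::
  "'a::euclidean_space set \<Rightarrow> 'a set \<Rightarrow> 'a set \<Rightarrow> 'a set set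
     \<Rightarrow> ('a \<Rightarrow> real ^ ('n \<times> 'g) ^ ('n \<times> 'g))
     \<Rightarrow> ('a \<Rightarrow> 'a ^ ('n::{finite,linorder} \<times> 'g::finite))
     \<Rightarrow> ('a \<Rightarrow> real ^ ('n \<times> 'g)) \<Rightarrow> 'a set \<Rightarrow> real" where
  "eta_bc \<Omega> \<Gamma>V \<Gamma>N \<T> To ph \<phi>t F =
     (delta_max To (elem_of_facet \<T> F) * altitude (elem_of_facet \<T> F) F) powr (- (1/2)) *
     l2_norm (surf F) (\<lambda>x. matrix_inv (spd_sqrt Gamma_tilde) *v
       (H_mat *v mtrace \<Omega> \<phi>t x - Gamma_tilde *v mntrace \<Omega> \<Gamma>V \<Gamma>N ph x))"

end

theory Submission
  imports Defs
begin

text \<open>Why the estimate holds. Let \<open>(q, \<psi>)\<close> be a local test pair of \<open>S\<close>-norm at most 1. The exact solution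
  turns \<open>c (\<zeta>, (- q, \<psi>))\<close> into \<open>(Sf, \<psi>)\<close>, so \<open>d (\<zeta> - \<zeta>t, (q, \<psi>)) = (Sf, \<psi>) - c (\<zeta>t, (- q, \<psi>))\<close>, where
  \<open>\<zeta>t = (ph, \<phi>t)\<close>. Because \<open>\<phi>t\<close> lies in \<open>H\<^sup>1\<close> and vanishes on \<open>\<Gamma>D\<close>, Green's formula moves the divergence
  from \<open>q\<close> to \<open>\<phi>t\<close> and leaves the sum of three pairings (\<open>residual_identity\<close>): the balance residual
  with \<open>\<psi>\<close>, the flux residual with \<open>q\<close>, and on \<open>\<Gamma>V\<close> the Robin residual with the normal trace of \<open>q\<close>.
  The supports of \<open>\<psi>\<close> and \<open>q\<close> restrict the first pairing to \<open>K\<close>, the second to the neighbours of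
  \<open>K\<close>, and the third to the facets of \<open>\<Gamma>V\<close> on the boundaries of these neighbours. A Cauchy-Schwarz
  inequality with the weights of the \<open>S\<close>-norm then gives the estimators
  (\<open>element_residual_bound\<close>, \<open>facet_residual_bound\<close>, \<open>local_residual_estimate\<close>).

  The analytic work behind these steps is about the boundary.
  First, the weights on the facets and the pairings over \<open>\<Gamma>V\<close> refer to Hausdorff measure, which is
  constructed from an outer measure; closed sets are measurable because the outer measure is
  additive on sets at a positive distance (\<open>hausdorff_outer_closed_split\<close>).
  Second, the function \<open>\<phi>t\<close> vanishes on \<open>\<Gamma>D\<close>, whereas Green's formula wants it to vanish on
  everything outside \<open>\<Gamma>V \<union> \<Gamma>N\<close>; the difference lies in the relative boundaries of the three
  parts, which are Lipschitz images of pieces of a codimension 2 subspace and hence null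
  (\<open>lipschitz_part_boundary_null\<close>).
  Third, normal traces are defined by duality only. That they are unique, linear and local
  follows from the fundamental lemma of the calculus of variations, which holds for Lebesgue and
  Hausdorff measure alike (\<open>fundamental_lemma\<close>, \<open>has_ntrace_local\<close>).
  Fourth, to see that \<open>q\<close> has no flux through a facet away from the neighbours of \<open>K\<close>, and that
  the weights of a facet are well defined and positive, exactly one element must touch the relative
  interior of a boundary facet. This holds because a Lipschitz domain is a half space near such
  a point (\<open>lipschitz_domain_flat\<close>, \<open>boundary_facet_unique_element\<close>).
  Finally, the square root of the coupling matrix on \<open>\<Gamma>V\<close> makes sense because that matrix is
  symmetric positive definite (\<open>Gamma_tilde_spd\<close>, \<open>spd_sqrt\<close>).\<close>

section \<open>Hausdorff measure\<close>

lemma hausdorff_pre_mono: "A \<subseteq> B \<Longrightarrow> hausdorff_pre s \<delta> A \<le> hausdorff_pre s \<delta> B"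
  unfolding hausdorff_pre_def by (rule INF_superset_mono) auto

lemma hausdorff_pre_antimono: "\<delta> \<le> \<delta>' \<Longrightarrow> hausdorff_pre s \<delta>' A \<le> hausdorff_pre s \<delta> A"
  unfolding hausdorff_pre_def by (rule INF_superset_mono) (auto intro: order_trans)

lemma hausdorff_pre_le_outer: "0 < \<delta> \<Longrightarrow> hausdorff_pre s \<delta> A \<le> hausdorff_outer s A"
  unfolding hausdorff_outer_def by (rule SUP_upper) simp

lemma hausdorff_pre_le:
  assumes "A \<subseteq> (\<Union>n. C n)" "\<And>n. bounded (C n)" "\<And>n. diameter (C n) \<le> \<delta>"
  shows "hausdorff_pre s \<delta> A \<le> (\<Sum>n. ennreal (unit_ball_vol s * (diameter (C n) / 2) powr s))"
  unfolding hausdorff_pre_def by (rule INF_lower) (use assms in auto)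

lemma hausdorff_pre_approx:
  assumes "hausdorff_pre s \<delta> A < top" "0 < e"
  obtains C where "A \<subseteq> (\<Union>n. C n)" "\<And>n. bounded (C n)" "\<And>n. diameter (C n) \<le> \<delta>"
    "(\<Sum>n. ennreal (unit_ball_vol s * (diameter (C n) / 2) powr s)) \<le> hausdorff_pre s \<delta> A + ennreal e"
proof -
  have "hausdorff_pre s \<delta> A < hausdorff_pre s \<delta> A + ennreal e"
    using assms by (simp add: ennreal_add_left_cancel_less less_top)
  then obtain C where "A \<subseteq> (\<Union>n. C n) \<and> (\<forall>n. bounded (C n) \<and> diameter (C n) \<le> \<delta>)"
    "(\<Sum>n. ennreal (unit_ball_vol s * (diameter (C n) / 2) powr s)) < hausdorff_pre s \<delta> A + ennreal e"
    unfolding hausdorff_pre_def INF_less_iff by blast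
  then show thesis by (intro that[of C]) auto
qed

lemma hausdorff_pre_countably_subadditive:
  "hausdorff_pre s \<delta> (\<Union>i. A i) \<le> (\<Sum>i::nat. hausdorff_pre s \<delta> (A i))"
proof (rule ennreal_le_epsilon)
  let ?w = "\<lambda>C::'a set. ennreal (unit_ball_vol s * (diameter C / 2) powr s)"
  fix e :: real assume fin: "(\<Sum>i. hausdorff_pre s \<delta> (A i)) < top" and e: "0 < e"
  have "\<exists>C. A i \<subseteq> (\<Union>n::nat. C n) \<and> (\<forall>n. bounded (C n)) \<and> (\<forall>n. diameter (C n) \<le> \<delta>) \<and>
      (\<Sum>n. ?w (C n)) \<le> hausdorff_pre s \<delta> (A i) + ennreal (e * (1/2) ^ Suc i)" for i
    by (rule hausdorff_pre_approx[of s \<delta> "A i" "e * (1/2) ^ Suc i"])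
      (use e ennreal_suminf_lessD[OF fin] in auto)
  then obtain C where C: "\<And>i. A i \<subseteq> (\<Union>n::nat. C i n)" "\<And>i n. bounded (C i n)"
      "\<And>i n. diameter (C i n) \<le> \<delta>"
      "\<And>i. (\<Sum>n. ?w (C i n)) \<le> hausdorff_pre s \<delta> (A i) + ennreal (e * (1/2) ^ Suc i)"
    by metis
  define D where "D k = C (fst (prod_decode k)) (snd (prod_decode k))" for k
  have cov: "(\<Union>i. A i) \<subseteq> (\<Union>k. D k)"
  proof
    fix x assume "x \<in> (\<Union>i. A i)"
    then obtain i n where "x \<in> C i n" using C(1) by blast
    then have "x \<in> D (prod_encode (i, n))" by (simp add: D_def)
    then show "x \<in> (\<Union>k. D k)" by blast
  qed
  have "hausdorff_pre s \<delta> (\<Union>i. A i) \<le> (\<Sum>k. ?w (D k))"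
    by (rule hausdorff_pre_le[OF cov]) (auto simp: D_def C)
  also have "\<dots> = (\<Sum>i. \<Sum>n. ?w (C i n))"
    by (rule trans[OF _ suminf_ennreal_2dimen[where f="\<lambda>(i, n). ?w (C i n)"]])
      (auto simp: D_def comp_def case_prod_beta)
  also have "\<dots> \<le> (\<Sum>i. hausdorff_pre s \<delta> (A i) + ennreal (e * (1/2) ^ Suc i))"
    by (intro suminf_le C(4)) auto
  also have "\<dots> = (\<Sum>i. hausdorff_pre s \<delta> (A i)) + (\<Sum>i. ennreal (e * (1/2) ^ Suc i))"
    by (rule suminf_add[symmetric]) auto
  also have "(\<Sum>i. ennreal (e * (1/2) ^ Suc i)) = ennreal e"
    using e power_half_series by (intro sums_unique[symmetric])
      (auto intro!: sums_mult[of _ 1 e, simplified] simp del: power_Suc)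
  finally show "hausdorff_pre s \<delta> (\<Union>i. A i) \<le> (\<Sum>i. hausdorff_pre s \<delta> (A i)) + ennreal e" .
qed

lemma hausdorff_outer_mono: "A \<subseteq> B \<Longrightarrow> hausdorff_outer s A \<le> hausdorff_outer s B"
  unfolding hausdorff_outer_def by (intro SUP_mono) (auto intro: hausdorff_pre_mono)

lemma hausdorff_outer_countably_subadditive:
  "hausdorff_outer s (\<Union>i. A i) \<le> (\<Sum>i::nat. hausdorff_outer s (A i))"
  unfolding hausdorff_outer_def[of s "\<Union>i. A i"]
proof (rule SUP_least)
  fix \<delta> :: real assume "\<delta> \<in> {0<..}"
  then show "hausdorff_pre s \<delta> (\<Union>i. A i) \<le> (\<Sum>i::nat. hausdorff_outer s (A i))"
    by (intro order_trans[OF hausdorff_pre_countably_subadditive] suminf_le hausdorff_pre_le_outer) auto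
qed

lemma hausdorff_outer_empty [simp]: "hausdorff_outer s {} = 0"
proof -
  have "hausdorff_pre s \<delta> ({}::'a set) \<le> 0" if "0 < \<delta>" for \<delta>
    using hausdorff_pre_le[of "{}::'a set" "\<lambda>_. {}" \<delta> s] that by simp
  then have "hausdorff_outer s ({}::'a set) \<le> 0"
    unfolding hausdorff_outer_def by (intro SUP_least) auto
  then show ?thesis by simp
qed

lemma hausdorff_outer_Un: "hausdorff_outer s (A \<union> B) \<le> hausdorff_outer s A + hausdorff_outer s B"
proof -
  have "hausdorff_outer s (A \<union> B) \<le> (\<Sum>i. hausdorff_outer s (binaryset A B i))"
    using hausdorff_outer_countably_subadditive[of s "binaryset A B"]
    by (simp add: range_binaryset_eq)
  also have "\<dots> = hausdorff_outer s A + hausdorff_outer s B"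
    by (rule suminf_binaryset_eq) simp
  finally show ?thesis .
qed

text \<open>A cover by sets of diameter less than the distance of two sets splits into a cover of one and a
  cover of the other; this is what makes closed sets measurable.\<close>

lemma hausdorff_outer_separated:
  assumes r: "0 < r" and sep: "\<And>x y. x \<in> A \<Longrightarrow> y \<in> B \<Longrightarrow> r \<le> dist x y"
  shows "hausdorff_outer s A + hausdorff_outer s B \<le> hausdorff_outer s (A \<union> B)"
proof -
  let ?w = "\<lambda>C::'a set. ennreal (unit_ball_vol s * (diameter C / 2) powr s)"
  have pre: "hausdorff_pre s \<delta> A + hausdorff_pre s \<delta> B \<le> hausdorff_outer s (A \<union> B)" if "0 < \<delta>" for \<delta>
  proof -
    define \<delta>' where "\<delta>' = min \<delta> (r/2)"
    have \<delta>': "0 < \<delta>'" "\<delta>' \<le> \<delta>" "\<delta>' < r" using r that by (auto simp: \<delta>'_def)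
    have "hausdorff_pre s \<delta>' A + hausdorff_pre s \<delta>' B \<le> hausdorff_pre s \<delta>' (A \<union> B)"
      unfolding hausdorff_pre_def[of s \<delta>' "A \<union> B"]
    proof (rule INF_greatest)
      fix C assume "C \<in> {C :: nat \<Rightarrow> 'a set. A \<union> B \<subseteq> (\<Union>n. C n) \<and> (\<forall>n. bounded (C n) \<and> diameter (C n) \<le> \<delta>')}"
      then have C: "A \<union> B \<subseteq> (\<Union>n. C n)" "\<And>n. bounded (C n)" "\<And>n. diameter (C n) \<le> \<delta>'" by auto
      define CA CB where "CA n = (if C n \<inter> A \<noteq> {} then C n else {})"
        and "CB n = (if C n \<inter> B \<noteq> {} then C n else {})" for n
      have disj: "CA n = {} \<or> CB n = {}" for n
      proof (rule ccontr)
        assume "\<not> ?thesis"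
        then obtain x y where "x \<in> C n" "x \<in> A" "y \<in> C n" "y \<in> B" by (auto simp: CA_def CB_def split: if_splits)
        then have "r \<le> diameter (C n)"
          using sep[of x y] diameter_bounded_bound[OF C(2), of x n y] by linarith
        then show False using C(3)[of n] \<delta>' by linarith
      qed
      have covA: "A \<subseteq> (\<Union>n. CA n)"
      proof
        fix x assume "x \<in> A"
        moreover from this obtain n where "x \<in> C n" using C(1) by blast
        ultimately have "x \<in> CA n" by (auto simp: CA_def)
        then show "x \<in> (\<Union>n. CA n)" by blast
      qed
      have covB: "B \<subseteq> (\<Union>n. CB n)"
      proof
        fix x assume "x \<in> B"
        moreover from this obtain n where "x \<in> C n" using C(1) by blast
        ultimately have "x \<in> CB n" by (auto simp: CB_def)
        then show "x \<in> (\<Union>n. CB n)" by blast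
      qed
      have "hausdorff_pre s \<delta>' A \<le> (\<Sum>n. ?w (CA n))"
        by (rule hausdorff_pre_le[OF covA]) (use C \<delta>' in \<open>auto simp: CA_def\<close>)
      moreover have "hausdorff_pre s \<delta>' B \<le> (\<Sum>n. ?w (CB n))"
        by (rule hausdorff_pre_le[OF covB]) (use C \<delta>' in \<open>auto simp: CB_def\<close>)
      ultimately have "hausdorff_pre s \<delta>' A + hausdorff_pre s \<delta>' B \<le> (\<Sum>n. ?w (CA n)) + (\<Sum>n. ?w (CB n))"
        by (rule add_mono)
      also have "\<dots> = (\<Sum>n. ?w (CA n) + ?w (CB n))" by (rule suminf_add) auto
      also have "\<dots> \<le> (\<Sum>n. ?w (C n))"
      proof (intro suminf_le allI)
        show "?w (CA n) + ?w (CB n) \<le> ?w (C n)" for n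
          using disj[of n] unfolding CA_def CB_def by (auto split: if_splits)
      qed auto
      finally show "hausdorff_pre s \<delta>' A + hausdorff_pre s \<delta>' B \<le> (\<Sum>n. ?w (C n))" .
    qed
    moreover have "hausdorff_pre s \<delta> A + hausdorff_pre s \<delta> B \<le> hausdorff_pre s \<delta>' A + hausdorff_pre s \<delta>' B"
      by (intro add_mono hausdorff_pre_antimono \<delta>')
    ultimately show ?thesis
      using hausdorff_pre_le_outer[OF \<delta>'(1), of s "A \<union> B"] by (meson order_trans)
  qed
  have "hausdorff_outer s A + hausdorff_outer s B = (SUP \<delta>\<in>{0<..}. hausdorff_pre s \<delta> A + hausdorff_pre s \<delta> B)"
    unfolding hausdorff_outer_def
  proof (rule SUP_add_directed_ennreal[symmetric])
    fix i j :: real assume "i \<in> {0<..}" "j \<in> {0<..}"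
    then show "\<exists>k\<in>{0<..}. hausdorff_pre s i A + hausdorff_pre s j B \<le> hausdorff_pre s k A + hausdorff_pre s k B"
      by (intro bexI[of _ "min i j"] add_mono hausdorff_pre_antimono) auto
  qed
  also have "\<dots> \<le> hausdorff_outer s (A \<union> B)" by (intro SUP_least pre) simp
  finally show ?thesis .
qed

lemma ennreal_suminf_tail:
  fixes f :: "nat \<Rightarrow> ennreal"
  assumes "(\<Sum>i. f i) < top" "0 < e"
  obtains n where "(\<Sum>i. f (i + n)) < e"
proof -
  let ?S = "\<Sum>i. f i"
  have "\<exists>n. ?S < (\<Sum>i<n. f i) + e"
  proof (cases "?S = 0")
    case True then show ?thesis using assms by (intro exI[of _ 0]) auto
  next
    case False
    show ?thesis
    proof (rule ccontr)
      assume "\<not> ?thesis"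
      then have "(\<Sum>i<n. f i) + e \<le> ?S" for n by (auto simp: not_less)
      then have "(SUP n. (\<Sum>i<n. f i) + e) \<le> ?S" by (intro SUP_least)
      moreover have "(SUP n. (\<Sum>i<n. f i) + e) = ?S + e"
        by (subst ennreal_SUP_add_left) (auto simp: suminf_eq_SUP)
      ultimately have "?S + e \<le> ?S" by simp
      then have "?S + e \<le> ?S + 0" by simp
      then show False
        unfolding ennreal_add_left_cancel_le using assms by (metis infinity_ennreal_def less_irrefl leD)
    qed
  qed
  then obtain n where n: "?S < (\<Sum>i<n. f i) + e" ..
  have S: "?S = (\<Sum>i<n. f i) + (\<Sum>i. f (i + n))"
    by (subst suminf_offset[of f n]) (auto simp: add.commute)
  have "(\<Sum>i. f (i + n)) < e"
    using n by (subst (asm) S) (simp add: ennreal_add_left_cancel_less)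
  then show thesis by (rule that)
qed

text \<open>Caratheodory's device: consecutive layers \<open>a (n + 1) - a n\<close> may touch, but the layers of even index are
  at positive distances from each other, and so are those of odd index. Either family therefore has
  total mass at most \<open>SUP n. hausdorff_outer s (a n)\<close>, so the layers beyond \<open>n\<close> contribute little.\<close>

lemma hausdorff_outer_incseq_separated:
  fixes a :: "nat \<Rightarrow> 'a::euclidean_space set"
  assumes inc: "\<And>n. a n \<subseteq> a (Suc n)"
    and sep: "\<And>n. \<exists>r>0. \<forall>x\<in>a n. \<forall>y\<in>(\<Union>k. a k) - a (Suc n). r \<le> dist x y"
  shows "hausdorff_outer s (\<Union>n. a n) \<le> (SUP n. hausdorff_outer s (a n))"
proof (cases "(SUP n. hausdorff_outer s (a n)) = top")
  case False
  define \<mu> :: "'a set \<Rightarrow> ennreal" where "\<mu> = hausdorff_outer s"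
  define M where "M = (SUP n. \<mu> (a n))"
  have M: "M < top" using False unfolding M_def \<mu>_def by (metis less_top)
  define R where "R n = a (Suc n) - a n" for n
  have incl: "m \<le> n \<Longrightarrow> a m \<subseteq> a n" for m n using inc by (rule lift_Suc_mono_le)
  have part: "(\<Sum>k<m. \<mu> (R (2*k+1+j))) \<le> \<mu> (a (2*m+j))" for m j
  proof (induction m)
    case (Suc m)
    obtain r where r: "r > 0" "\<forall>x\<in>a (2*m+j). \<forall>y\<in>(\<Union>k. a k) - a (Suc (2*m+j)). r \<le> dist x y"
      using sep by blast
    have "(\<Sum>k<Suc m. \<mu> (R (2*k+1+j))) \<le> \<mu> (a (2*m+j)) + \<mu> (R (2*m+1+j))"
      using Suc by (simp add: add_right_mono)
    also have "\<dots> \<le> \<mu> (a (2*m+j) \<union> R (2*m+1+j))"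
      unfolding \<mu>_def using r by (intro hausdorff_outer_separated[of r]) (auto simp: R_def)
    also have "\<dots> \<le> \<mu> (a (2 * Suc m + j))"
      unfolding \<mu>_def using incl[of "2*m+j" "2 * Suc m + j"]
      by (intro hausdorff_outer_mono) (auto simp: R_def)
    finally show ?case .
  qed simp
  have parity: "(\<Sum>k. \<mu> (R (2*k+1+j))) \<le> M" for j
    unfolding suminf_eq_SUP
  proof (rule SUP_least)
    fix m
    have "\<mu> (a (2*m+j)) \<le> M" unfolding M_def by (rule SUP_upper) simp
    then show "(\<Sum>k<m. \<mu> (R (2*k+1+j))) \<le> M" using part[where m=m and j=j] by (rule order_trans[rotated])
  qed
  have odd_even: "(\<Sum>k. f k) = (\<Sum>k. f (2*k)) + (\<Sum>k. f (2*k+1))" for f :: "nat \<Rightarrow> ennreal"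
  proof -
    have "(\<lambda>m. \<Sum>k<2*m. f k) \<longlonglongrightarrow> (\<Sum>k. f k)"
      using LIMSEQ_subseq_LIMSEQ[OF summable_LIMSEQ[of f], of "\<lambda>m. 2*m"] by (auto simp: strict_mono_def comp_def)
    moreover have "(\<Sum>k<2*m. f k) = (\<Sum>k<m. f (2*k)) + (\<Sum>k<m. f (2*k+1))" for m
      by (induction m) (auto simp: algebra_simps)
    moreover have "(\<lambda>m. (\<Sum>k<m. f (2*k)) + (\<Sum>k<m. f (2*k+1))) \<longlonglongrightarrow> (\<Sum>k. f (2*k)) + (\<Sum>k. f (2*k+1))"
      by (intro tendsto_add summable_LIMSEQ) auto
    ultimately show ?thesis by (simp add: LIMSEQ_unique)
  qed
  have "(\<Sum>k. \<mu> (R (Suc k))) \<le> M + M"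
    using parity[of 0] parity[of 1] by (subst odd_even) (auto intro!: add_mono)
  then have fin: "(\<Sum>k. \<mu> (R (Suc k))) < top" using M by (metis ennreal_add_less_top le_less_trans)
  have "\<mu> (\<Union>n. a n) \<le> M"
  proof (rule ennreal_le_epsilon)
    fix e :: real assume "0 < e"
    then obtain n where n: "(\<Sum>k. \<mu> (R (Suc (k + n)))) < ennreal e"
      using ennreal_suminf_tail[OF fin, of "ennreal e"] by auto
    have "(\<Union>n. a n) \<subseteq> a (Suc n) \<union> (\<Union>k. R (Suc (k + n)))"
    proof
      fix x assume "x \<in> (\<Union>n. a n)"
      then have ex: "\<exists>k. x \<in> a k" by auto
      define k where "k = (LEAST k. x \<in> a k)"
      have k: "x \<in> a k" "\<And>j. j < k \<Longrightarrow> x \<notin> a j"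
        unfolding k_def using LeastI_ex[OF ex] not_less_Least by auto
      show "x \<in> a (Suc n) \<union> (\<Union>k. R (Suc (k + n)))"
      proof (cases "k \<le> Suc n")
        case True then show ?thesis using incl[OF True] k by auto
      next
        case False
        then obtain i where i: "k = Suc (Suc (i + n))"
          using less_imp_Suc_add[of "Suc n" k] by (auto simp: add.commute)
        have "x \<in> R (Suc (i + n))" using k unfolding R_def i by auto
        then show ?thesis by blast
      qed
    qed
    then have "\<mu> (\<Union>n. a n) \<le> \<mu> (a (Suc n)) + \<mu> (\<Union>k. R (Suc (k + n)))"
      unfolding \<mu>_def by (intro order_trans[OF hausdorff_outer_mono hausdorff_outer_Un])
    also have "\<dots> \<le> M + (\<Sum>k. \<mu> (R (Suc (k + n))))"
      unfolding M_def by (intro add_mono SUP_upper) (auto simp: \<mu>_def hausdorff_outer_countably_subadditive)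
    also have "\<dots> \<le> M + ennreal e" using n by (intro add_left_mono) simp
    finally show "\<mu> (\<Union>n. a n) \<le> M + ennreal e" .
  qed
  then show ?thesis by (simp add: M_def \<mu>_def)
qed (metis top_greatest)

text \<open>The points of \<open>X\<close> at distance at least \<open>1 / n\<close> from \<open>C\<close> are separated from \<open>C\<close>, and they exhaust
  \<open>X - C\<close> in layers to which the previous lemma applies.\<close>

lemma hausdorff_outer_closed_split:
  fixes C :: "'a::euclidean_space set"
  assumes "closed C"
  shows "hausdorff_outer s (X \<inter> C) + hausdorff_outer s (X - C) \<le> hausdorff_outer s X"
proof (cases "C = {}")
  case False
  define a where "a n = {x \<in> X. 1 / real (Suc n) \<le> infdist x C}" for n
  have un: "(\<Union>n. a n) = X - C"
  proof (intro set_eqI iffI)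
    fix x assume x: "x \<in> X - C"
    then have "infdist x C > 0"
      using assms False in_closed_iff_infdist_zero[of C x] infdist_nonneg[of x C] by fastforce
    then obtain n where "1 / real (Suc n) < infdist x C" using nat_approx_posE by blast
    then show "x \<in> (\<Union>n. a n)" using x by (auto simp: a_def intro!: exI[of _ n])
  next
    fix x assume "x \<in> (\<Union>n. a n)"
    then obtain n where n: "x \<in> X" "1 / real (Suc n) \<le> infdist x C" by (auto simp: a_def)
    have "0 < 1 / real (Suc n)" by simp
    then have "0 < infdist x C" using n by linarith
    then have "x \<notin> C" by auto
    with n show "x \<in> X - C" by simp
  qed
  have lim: "hausdorff_outer s (X - C) \<le> (SUP n. hausdorff_outer s (a n))"
    unfolding un[symmetric]
  proof (rule hausdorff_outer_incseq_separated)
    fix n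
    have *: "1 / real (Suc (Suc n)) < 1 / real (Suc n)" by (simp add: field_simps)
    then show "a n \<subseteq> a (Suc n)" unfolding a_def by auto
    have "1 / real (Suc n) - 1 / real (Suc (Suc n)) \<le> dist x y"
      if "x \<in> a n" "y \<in> (\<Union>k. a k) - a (Suc n)" for x y
    proof -
      have "infdist x C \<le> infdist y C + dist x y" by (rule infdist_triangle)
      moreover have "infdist y C < 1 / real (Suc (Suc n))" using that by (auto simp: a_def)
      moreover have "1 / real (Suc n) \<le> infdist x C" using that by (auto simp: a_def)
      ultimately show ?thesis by linarith
    qed
    then show "\<exists>r>0. \<forall>x\<in>a n. \<forall>y\<in>(\<Union>k. a k) - a (Suc n). r \<le> dist x y"
      using * by (intro exI[of _ "1 / real (Suc n) - 1 / real (Suc (Suc n))"]) simp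
  qed
  have "hausdorff_outer s (X \<inter> C) + hausdorff_outer s (a n) \<le> hausdorff_outer s X" for n
  proof -
    have "hausdorff_outer s (X \<inter> C) + hausdorff_outer s (a n) \<le> hausdorff_outer s (X \<inter> C \<union> a n)"
    proof (rule hausdorff_outer_separated[of "1 / real (Suc n)"])
      fix x y assume "x \<in> X \<inter> C" "y \<in> a n"
      then show "1 / real (Suc n) \<le> dist x y"
        using infdist_le[of x C y] by (auto simp: a_def dist_commute)
    qed simp
    also have "\<dots> \<le> hausdorff_outer s X" by (rule hausdorff_outer_mono) (auto simp: a_def)
    finally show ?thesis .
  qed
  then have "(SUP n. hausdorff_outer s (X \<inter> C) + hausdorff_outer s (a n)) \<le> hausdorff_outer s X"
    by (intro SUP_least)
  then have "hausdorff_outer s (X \<inter> C) + (SUP n. hausdorff_outer s (a n)) \<le> hausdorff_outer s X"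
    by (simp add: ennreal_SUP_add_right)
  then show ?thesis using lim by (meson add_left_mono order_trans)
qed simp

lemma hausdorff_outer_measure_space: "outer_measure_space UNIV (hausdorff_outer s)"
  unfolding outer_measure_space_def positive_def increasing_def countably_subadditive_def
  by (auto intro: hausdorff_outer_mono hausdorff_outer_countably_subadditive)

lemma hausdorff_measure_space:
  "measure_space UNIV (lambda_system UNIV UNIV (hausdorff_outer s)) (hausdorff_outer s)"
  using sigma_algebra.caratheodory_lemma[OF sigma_algebra_Pow hausdorff_outer_measure_space[of s, folded Pow_UNIV]]
  by simp

lemma space_hausdorff [simp]: "space (hausdorff_measure s) = UNIV"
  unfolding hausdorff_measure_def by (rule space_measure_of) auto

lemma sets_hausdorff: "sets (hausdorff_measure s) = lambda_system UNIV UNIV (hausdorff_outer s)"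
proof -
  have "sigma_algebra UNIV (lambda_system UNIV UNIV (hausdorff_outer s))"
    using hausdorff_measure_space[of s] unfolding measure_space_def by blast
  then show ?thesis unfolding hausdorff_measure_def by (rule sigma_algebra.sets_measure_of_eq)
qed

lemma emeasure_hausdorff:
  assumes "A \<in> sets (hausdorff_measure s)"
  shows "emeasure (hausdorff_measure s) A = hausdorff_outer s A"
  using hausdorff_measure_space[of s] assms[unfolded sets_hausdorff]
  unfolding hausdorff_measure_def measure_space_def
  by (intro emeasure_measure_of_sigma) blast+

lemma closed_sets_hausdorff: "closed C \<Longrightarrow> C \<in> sets (hausdorff_measure s)"
  unfolding sets_hausdorff lambda_system_def
proof (intro CollectI conjI ballI UNIV_I antisym)
  fix X assume C: "closed C"
  have eq: "C \<inter> X = X \<inter> C" "(UNIV - C) \<inter> X = X - C" by auto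
  show "hausdorff_outer s (C \<inter> X) + hausdorff_outer s ((UNIV - C) \<inter> X) \<le> hausdorff_outer s X"
    unfolding eq by (rule hausdorff_outer_closed_split[OF C])
  show "hausdorff_outer s X \<le> hausdorff_outer s (C \<inter> X) + hausdorff_outer s ((UNIV - C) \<inter> X)"
    by (rule order_trans[OF hausdorff_outer_mono hausdorff_outer_Un]) auto
qed

lemma borel_in_sets_hausdorff: "A \<in> sets borel \<Longrightarrow> A \<in> sets (hausdorff_measure s)"
  using sets.sigma_sets_subset[of "Collect closed" "hausdorff_measure s"] closed_sets_hausdorff[of _ s]
  by (auto simp: borel_eq_closed)

lemma null_sets_hausdorff: "A \<in> null_sets (hausdorff_measure s) \<longleftrightarrow> hausdorff_outer s A = 0"
proof
  assume "hausdorff_outer s A = 0"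
  moreover have "A \<in> sets (hausdorff_measure s)"
    unfolding sets_hausdorff lambda_system_def
  proof (intro CollectI conjI ballI UNIV_I antisym)
    fix X
    have "hausdorff_outer s (A \<inter> X) = 0"
      using hausdorff_outer_mono[of "A \<inter> X" A s] \<open>hausdorff_outer s A = 0\<close> by simp
    then show "hausdorff_outer s (A \<inter> X) + hausdorff_outer s ((UNIV - A) \<inter> X) \<le> hausdorff_outer s X"
      using hausdorff_outer_mono[of "(UNIV - A) \<inter> X" X s] by simp
    show "hausdorff_outer s X \<le> hausdorff_outer s (A \<inter> X) + hausdorff_outer s ((UNIV - A) \<inter> X)"
      by (rule order_trans[OF hausdorff_outer_mono hausdorff_outer_Un]) auto
  qed
  ultimately show "A \<in> null_sets (hausdorff_measure s)"
    by (auto simp: null_sets_def emeasure_hausdorff)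
qed (auto simp: null_sets_def emeasure_hausdorff)

lemma complete_hausdorff: "complete_measure (hausdorff_measure s)"
proof
  fix A B assume "B \<subseteq> A" "A \<in> null_sets (hausdorff_measure s)"
  then have "B \<in> null_sets (hausdorff_measure s)"
    using hausdorff_outer_mono[of B A s] by (simp add: null_sets_hausdorff)
  then show "B \<in> sets (hausdorff_measure s)" by auto
qed

text \<open>Borel regularity: replacing the sets of a cover by their closures does not change its weight.\<close>

lemma hausdorff_borel_hull:
  fixes A :: "'a::euclidean_space set"
  assumes "hausdorff_outer s A < top"
  obtains B where "B \<in> sets borel" "A \<subseteq> B" "hausdorff_outer s B = hausdorff_outer s A"
proof -
  let ?w = "\<lambda>C::'a set. ennreal (unit_ball_vol s * (diameter C / 2) powr s)"
  have "\<exists>C. A \<subseteq> (\<Union>n::nat. C n) \<and> (\<forall>n. bounded (C n)) \<and> (\<forall>n. diameter (C n) \<le> 1 / Suc k) \<and>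
      (\<Sum>n. ?w (C n)) \<le> hausdorff_pre s (1 / Suc k) A + ennreal (1 / Suc k)" for k
  proof (rule hausdorff_pre_approx[of s "1 / Suc k" A "1 / Suc k"])
    show "hausdorff_pre s (1 / real (Suc k)) A < top"
      using hausdorff_pre_le_outer[of "1 / Suc k" s A] assms by (metis le_less_trans of_nat_0_less_iff zero_less_Suc zero_less_divide_1_iff)
  qed auto
  then obtain C where C: "\<And>k. A \<subseteq> (\<Union>n::nat. C k n)" "\<And>k n. bounded (C k n)"
      "\<And>k n. diameter (C k n) \<le> 1 / Suc k"
      "\<And>k. (\<Sum>n. ?w (C k n)) \<le> hausdorff_pre s (1 / Suc k) A + ennreal (1 / Suc k)"
    by metis
  define B where "B = (\<Inter>k. \<Union>n. closure (C k n))"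
  have "(\<Union>n. C k n) \<subseteq> (\<Union>n. closure (C k n))" for k by (intro UN_mono closure_subset) simp
  then have AB: "A \<subseteq> B" unfolding B_def using C(1) by (intro INF_greatest) (rule subset_trans)
  have pre: "hausdorff_pre s (1 / Suc k) B \<le> hausdorff_outer s A + ennreal (1 / Suc k)" for k
  proof -
    have "hausdorff_pre s (1 / Suc k) B \<le> (\<Sum>n. ?w (closure (C k n)))"
    proof (rule hausdorff_pre_le)
      show "B \<subseteq> (\<Union>n. closure (C k n))" unfolding B_def by blast
      show "bounded (closure (C k n))" for n using C(2) by (rule bounded_closure)
      show "diameter (closure (C k n)) \<le> 1 / Suc k" for n
        using C(3)[of k n] by (simp only: diameter_closure[OF C(2)])
    qed
    also have "\<dots> = (\<Sum>n. ?w (C k n))" by (simp only: diameter_closure[OF C(2)])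
    also have "\<dots> \<le> hausdorff_pre s (1 / Suc k) A + ennreal (1 / Suc k)" by (rule C)
    also have "\<dots> \<le> hausdorff_outer s A + ennreal (1 / Suc k)"
      by (intro add_right_mono hausdorff_pre_le_outer) simp
    finally show ?thesis .
  qed
  have "hausdorff_outer s B \<le> hausdorff_outer s A"
    unfolding hausdorff_outer_def[of s B]
  proof (rule SUP_least, rule ennreal_le_epsilon)
    fix \<delta> e :: real assume "\<delta> \<in> {0<..}" "0 < e"
    then have "0 < min \<delta> e" by simp
    then obtain k where k: "1 / Suc k < min \<delta> e" by (rule nat_approx_posE)
    have "hausdorff_pre s \<delta> B \<le> hausdorff_pre s (1 / Suc k) B"
      by (rule hausdorff_pre_antimono) (use k in simp)
    also have "\<dots> \<le> hausdorff_outer s A + ennreal (1 / Suc k)" by (rule pre)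
    also have "\<dots> \<le> hausdorff_outer s A + ennreal e"
      by (intro add_left_mono ennreal_leI) (use k in simp)
    finally show "hausdorff_pre s \<delta> B \<le> hausdorff_outer s A + ennreal e" .
  qed
  then have "hausdorff_outer s B = hausdorff_outer s A"
    using hausdorff_outer_mono[OF AB, of s] by (rule antisym)
  moreover have "B \<in> sets borel" unfolding B_def by (intro sets.countable_INT'' sets.countable_UN'') auto
  ultimately show thesis using AB that by blast
qed

text \<open>A grid of \<open>n\<^sup>k\<close> cubes of side \<open>O(1/n)\<close> covers \<open>S\<close>, and a Lipschitz map keeps the diameters \<open>O(1/n)\<close>.
  The resulting bound \<open>n\<^sup>k * O(n powr - s)\<close> for the \<open>s\<close>-dimensional measure is all that is used about
  dimension: it tends to 0 for \<open>k < s\<close> and stays bounded for \<open>k = s\<close>.\<close>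

lemma lipschitz_image_cover:
  fixes f :: "'b::euclidean_space \<Rightarrow> 'a::euclidean_space"
  assumes V: "subspace V" "dim V = k" and S: "S \<subseteq> V" "bounded S" and f: "L-lipschitz_on S f"
  obtains C where "0 < C" and "\<And>n::nat. 0 < n \<Longrightarrow> \<exists>D :: nat \<Rightarrow> 'a set. f ` S \<subseteq> (\<Union>j<n^k. D j) \<and>
     (\<forall>j. bounded (D j) \<and> diameter (D j) \<le> C / n)"
proof -
  obtain B where B: "B \<subseteq> V" "pairwise orthogonal B" "\<And>x. x \<in> B \<Longrightarrow> norm x = 1" "independent B"
      "card B = dim V" "span B = V"
    using orthonormal_basis_subspace[OF V(1)] by blast
  have fin: "finite B" using B(4) by (rule independent_imp_finite)
  obtain R where R: "0 < R" "\<And>x. x \<in> S \<Longrightarrow> norm x \<le> R"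
    using S(2) bounded_pos by metis
  have L: "0 \<le> L" using f by (rule lipschitz_on_nonneg)
  have expand: "norm x \<le> (\<Sum>b\<in>B. \<bar>x \<bullet> b\<bar>)" if "x \<in> V" for x
  proof -
    have "norm x = norm (\<Sum>b\<in>B. (x \<bullet> b) *\<^sub>R b)"
      using orthonormal_basis_expand[of B x] B fin that by simp
    also have "\<dots> \<le> (\<Sum>b\<in>B. norm ((x \<bullet> b) *\<^sub>R b))" by (rule norm_sum)
    also have "\<dots> = (\<Sum>b\<in>B. \<bar>x \<bullet> b\<bar>)" using B(3) by (intro sum.cong) auto
    finally show ?thesis .
  qed
  define C where "C = L * (real k * (2 * R)) + 1"
  have C: "0 < C" using L R by (auto simp: C_def intro!: add_nonneg_pos mult_nonneg_nonneg)
  have "\<exists>D :: nat \<Rightarrow> 'a set. f ` S \<subseteq> (\<Union>j<n^k. D j) \<and> (\<forall>j. bounded (D j) \<and> diameter (D j) \<le> C / n)"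
    if n: "0 < n" for n :: nat
  proof -
    define cell where "cell m = {x \<in> S. \<forall>b\<in>B. m b * (2*R/n) \<le> x \<bullet> b + R \<and> x \<bullet> b + R \<le> (m b + 1) * (2*R/n)}"
      for m :: "'b \<Rightarrow> nat"
    have grid: "\<exists>m<n. m * (2*R/n) \<le> t \<and> t \<le> (m + 1) * (2*R/n)" if "0 \<le> t" "t \<le> 2*R" for t :: real
    proof (cases "t = 2*R")
      case True
      then show ?thesis using n R by (intro exI[of _ "n - 1"]) (auto simp: field_simps of_nat_diff)
    next
      case False
      define u where "u = t * n / (2*R)"
      have u: "0 \<le> u" "u < n" using that False n R by (auto simp: u_def field_simps)
      have t: "t = u * (2*R/n)" using n R by (simp add: u_def)
      have fl: "real (nat \<lfloor>u\<rfloor>) \<le> u" "u \<le> real (nat \<lfloor>u\<rfloor>) + 1" "nat \<lfloor>u\<rfloor> < n" using u by linarith+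
      show ?thesis unfolding t using fl R
        by (intro exI[of _ "nat \<lfloor>u\<rfloor>"] conjI mult_right_mono) auto
    qed
    have cover: "\<exists>m\<in>(\<Pi>\<^sub>E b\<in>B. {..<n}). x \<in> cell m" if x: "x \<in> S" for x
    proof -
      have "\<exists>m<n. m * (2*R/n) \<le> x \<bullet> b + R \<and> x \<bullet> b + R \<le> (m + 1) * (2*R/n)" if "b \<in> B" for b
      proof (rule grid)
        have "\<bar>x \<bullet> b\<bar> \<le> R"
          using Cauchy_Schwarz_ineq2[of x b] B(3)[OF that] R(2)[OF x] by simp
        then show "0 \<le> x \<bullet> b + R" "x \<bullet> b + R \<le> 2*R" by auto
      qed
      then obtain m where "\<forall>b\<in>B. m b < n \<and> m b * (2*R/n) \<le> x \<bullet> b + R \<and> x \<bullet> b + R \<le> (m b + 1) * (2*R/n)"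
        by metis
      then show ?thesis using x
        by (intro bexI[of _ "restrict m B"]) (auto simp: cell_def algebra_simps)
    qed
    have close: "dist (f x) (f y) \<le> C / n" if xy: "x \<in> cell m" "y \<in> cell m" for x y m
    proof -
      have S': "x \<in> S" "y \<in> S" using xy by (auto simp: cell_def)
      have "\<bar>(x - y) \<bullet> b\<bar> \<le> 2*R/n" if "b \<in> B" for b
      proof -
        have "x \<bullet> b + R \<le> m b * (2*R/n) + 2*R/n" "m b * (2*R/n) \<le> x \<bullet> b + R"
          "y \<bullet> b + R \<le> m b * (2*R/n) + 2*R/n" "m b * (2*R/n) \<le> y \<bullet> b + R"
          using xy that by (auto simp: cell_def ring_distribs add_divide_distrib)
        then show ?thesis unfolding inner_diff_left by linarith
      qed
      then have "(\<Sum>b\<in>B. \<bar>(x - y) \<bullet> b\<bar>) \<le> real (card B) * (2*R/n)" by (rule sum_bounded_above)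
      moreover have "x - y \<in> V" using S S' V(1) by (auto intro: subspace_diff)
      ultimately have "dist x y \<le> real k * (2*R/n)"
        using expand[of "x - y"] B(5) V(2) by (simp add: dist_norm)
      then have "L * dist x y \<le> L * (real k * (2*R/n))" using L by (rule mult_left_mono)
      also have "\<dots> \<le> C / n" by (simp add: C_def divide_right_mono)
      finally show ?thesis using lipschitz_onD[OF f S'] by linarith
    qed
    have card: "card (\<Pi>\<^sub>E b\<in>B. {..<n}) = n^k" using fin B(5) V(2) by (simp add: card_PiE)
    have "finite (\<Pi>\<^sub>E b\<in>B. {..<n})" using fin by (intro finite_PiE) auto
    then obtain h where h: "bij_betw h {0..<n^k} (\<Pi>\<^sub>E b\<in>B. {..<n})"
      using ex_bij_betw_nat_finite[of "\<Pi>\<^sub>E b\<in>B. {..<n}"] card by auto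
    have bnd: "bounded (f ` S)"
      using f S(2) by (intro bounded_uniformly_continuous_image lipschitz_on_uniformly_continuous)
    show ?thesis
    proof (intro exI[of _ "\<lambda>j. f ` cell (h j)"] conjI allI)
      show "f ` S \<subseteq> (\<Union>j<n^k. f ` cell (h j))"
      proof clarify
        fix x assume "x \<in> S"
        then obtain m where m: "m \<in> (\<Pi>\<^sub>E b\<in>B. {..<n})" "x \<in> cell m" using cover by blast
        then have "m \<in> h ` {0..<n^k}" using h unfolding bij_betw_def by simp
        then obtain j where "j < n^k" "m = h j" by auto
        then show "f x \<in> (\<Union>j<n^k. f ` cell (h j))" using m by blast
      qed
      fix j
      show "bounded (f ` cell (h j))" by (rule bounded_subset[OF bnd]) (auto simp: cell_def)
      show "diameter (f ` cell (h j)) \<le> C / n"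
        by (rule diameter_le) (use C close in \<open>auto simp: dist_norm\<close>)
    qed
  qed
  then show thesis using C that by blast
qed

lemma hausdorff_pre_lipschitz_image:
  fixes f :: "'b::euclidean_space \<Rightarrow> 'a::euclidean_space"
  assumes "subspace V" "dim V = k" "S \<subseteq> V" "bounded S" "L-lipschitz_on S f" and s: "0 < s"
  obtains C where "0 < C" "\<And>n::nat. 0 < n \<Longrightarrow>
    hausdorff_pre s (C / n) (f ` S) \<le> ennreal (unit_ball_vol s * (C / 2) powr s * real n powr (k - s))"
proof (rule lipschitz_image_cover[OF assms(1-5)])
  fix C assume C: "0 < C" "\<And>n::nat. 0 < n \<Longrightarrow> \<exists>D :: nat \<Rightarrow> 'a set. f ` S \<subseteq> (\<Union>j<n^k. D j) \<and>
     (\<forall>j. bounded (D j) \<and> diameter (D j) \<le> C / n)"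
  have "hausdorff_pre s (C / n) (f ` S) \<le> ennreal (unit_ball_vol s * (C / 2) powr s * real n powr (k - s))"
    if n: "0 < n" for n :: nat
  proof -
    obtain D :: "nat \<Rightarrow> 'a set" where D: "f ` S \<subseteq> (\<Union>j<n^k. D j)" "\<And>j. bounded (D j)" "\<And>j. diameter (D j) \<le> C / n"
      using C(2)[OF n] by blast
    define E where "E j = (if j < n^k then D j else {})" for j
    have "hausdorff_pre s (C / n) (f ` S) \<le> (\<Sum>j. ennreal (unit_ball_vol s * (diameter (E j) / 2) powr s))"
      by (rule hausdorff_pre_le) (use D C(1) in \<open>fastforce simp: E_def\<close>)+
    also have "\<dots> = (\<Sum>j<n^k. ennreal (unit_ball_vol s * (diameter (E j) / 2) powr s))"
      by (rule suminf_finite) (auto simp: E_def)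
    also have "\<dots> \<le> (\<Sum>j<n^k. ennreal (unit_ball_vol s * (C / n / 2) powr s))"
      using s D by (intro sum_mono ennreal_leI mult_left_mono powr_mono2)
        (auto simp: E_def diameter_ge_0 unit_ball_vol_nonneg)
    also have "\<dots> = ennreal (real n ^ k * (unit_ball_vol s * (C / n / 2) powr s))"
      by (simp add: ennreal_mult' ennreal_power ennreal_of_nat_eq_real_of_nat)
    also have "real n ^ k * (unit_ball_vol s * (C / n / 2) powr s) = unit_ball_vol s * (C / 2) powr s * real n powr (k - s)"
      using n C(1) by (simp add: powr_diff powr_realpow powr_divide powr_mult mult_ac)
    finally show ?thesis .
  qed
  then show thesis using C(1) that by blast
qed

lemma hausdorff_outer_lipschitz_image_null:
  fixes f :: "'b::euclidean_space \<Rightarrow> 'a::euclidean_space"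
  assumes "subspace V" "dim V = k" "S \<subseteq> V" "bounded S" "L-lipschitz_on S f" and ks: "real k < s"
  shows "hausdorff_outer s (f ` S) = 0"
proof -
  have s: "0 < s" using ks by linarith
  obtain C where C: "0 < C" "\<And>n::nat. 0 < n \<Longrightarrow>
    hausdorff_pre s (C / n) (f ` S) \<le> ennreal (unit_ball_vol s * (C / 2) powr s * real n powr (k - s))"
    using hausdorff_pre_lipschitz_image[OF assms(1-5) s] by blast
  have lim: "(\<lambda>n. unit_ball_vol s * (C / 2) powr s * real n powr (k - s)) \<longlonglongrightarrow> unit_ball_vol s * (C / 2) powr s * 0"
    by (intro tendsto_intros tendsto_neg_powr filterlim_real_sequentially) (use ks in simp)
  have "hausdorff_outer s (f ` S) \<le> 0"
    unfolding hausdorff_outer_def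
  proof (rule SUP_least, rule ennreal_le_epsilon)
    fix \<delta> e :: real assume "\<delta> \<in> {0<..}" "0 < e"
    then have \<delta>: "0 < \<delta>" "0 < e" by auto
    have "eventually (\<lambda>n. unit_ball_vol s * (C / 2) powr s * real n powr (k - s) < e) sequentially"
      using order_tendstoD(2)[OF lim] \<delta> by simp
    moreover have "eventually (\<lambda>n. C / real n < \<delta>) sequentially"
      using \<delta> by (intro order_tendstoD(2)[of _ 0] real_tendsto_divide_at_top[OF tendsto_const] filterlim_real_sequentially)
    ultimately have "eventually (\<lambda>n. unit_ball_vol s * (C / 2) powr s * real n powr (k - s) < e \<and> C / real n < \<delta> \<and> 0 < n) sequentially"
      using eventually_gt_at_top[of "0::nat"] by eventually_elim auto
    then obtain n :: nat where n: "unit_ball_vol s * (C / 2) powr s * real n powr (k - s) < e" "C / n < \<delta>" "0 < n"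
      using eventually_happens'[OF sequentially_bot] by blast
    have "hausdorff_pre s \<delta> (f ` S) \<le> hausdorff_pre s (C / n) (f ` S)"
      using n by (intro hausdorff_pre_antimono) simp
    also have "\<dots> \<le> ennreal e" using C(2)[OF n(3)] n(1) by (meson ennreal_leI less_imp_le order_trans)
    finally show "hausdorff_pre s \<delta> (f ` S) \<le> 0 + ennreal e" by simp
  qed
  then show ?thesis by simp
qed

lemma hausdorff_outer_lipschitz_image_finite:
  fixes f :: "'b::euclidean_space \<Rightarrow> 'a::euclidean_space"
  assumes "subspace V" "dim V = k" "S \<subseteq> V" "bounded S" "L-lipschitz_on S f" and ks: "0 < k"
  shows "hausdorff_outer k (f ` S) < top"
proof (rule hausdorff_pre_lipschitz_image[OF assms(1-5), of "real k"])
  fix C assume C: "0 < C" "\<And>n::nat. 0 < n \<Longrightarrow>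
    hausdorff_pre k (C / n) (f ` S) \<le> ennreal (unit_ball_vol k * (C / 2) powr k * real n powr (real k - real k))"
  have "hausdorff_outer k (f ` S) \<le> ennreal (unit_ball_vol k * (C / 2) powr k)"
    unfolding hausdorff_outer_def
  proof (intro SUP_least)
    fix \<delta> :: real assume "\<delta> \<in> {0<..}"
    then have "0 < \<delta> / C" using C(1) by simp
    then obtain n where n: "inverse (real (Suc n)) < \<delta> / C" using reals_Archimedean by blast
    have "hausdorff_pre k \<delta> (f ` S) \<le> hausdorff_pre k (C / Suc n) (f ` S)"
      using n C(1) by (intro hausdorff_pre_antimono) (simp add: field_simps)
    also have "\<dots> \<le> ennreal (unit_ball_vol k * (C / 2) powr k)" using C(2)[of "Suc n"] by simp
    finally show "hausdorff_pre k \<delta> (f ` S) \<le> ennreal (unit_ball_vol k * (C / 2) powr k)" .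
  qed
  then show ?thesis by (rule le_less_trans) simp
qed (use ks in simp)

lemma affine_translation_subspace:
  fixes A :: "'a::euclidean_space set"
  assumes "affine A" "a \<in> A"
  obtains V where "subspace V" "int (dim V) = aff_dim A" "A = (+) a ` V"
proof -
  show thesis
  proof
    show "subspace ((\<lambda>x. x - a) ` A)" using assms by (rule affine_diffs_subspace_subtract)
    show "int (dim ((\<lambda>x. x - a) ` A)) = aff_dim A" by (rule aff_dim_dim_affine_diffs[OF assms, symmetric])
    show "A = (+) a ` (\<lambda>x. x - a) ` A" by (simp add: image_image)
  qed
qed

text \<open>The dimension is that of the affine hull, which a translation makes a subspace. Facets have finite measure
  by the second part, and their relative boundaries are null by the first.\<close>

lemma hausdorff_outer_flat:
  fixes S :: "'a::euclidean_space set"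
  assumes "bounded S"
  shows "aff_dim S < k \<Longrightarrow> 0 < k \<Longrightarrow> hausdorff_outer (real_of_int k) S = 0"
    and "aff_dim S = k \<Longrightarrow> 0 < k \<Longrightarrow> hausdorff_outer (real_of_int k) S < top"
proof -
  show null: "hausdorff_outer (real_of_int k) S = 0" if k: "aff_dim S < k" "0 < k"
  proof (cases "S = {}")
    case False
    then obtain a where a: "a \<in> S" by blast
    have "a \<in> affine hull S" using a by (rule hull_inc)
    then obtain V where V: "subspace V" "int (dim V) = aff_dim S" "affine hull S = (+) a ` V"
      by (rule affine_translation_subspace[OF affine_affine_hull, unfolded aff_dim_affine_hull])
    have S: "S = (+) a ` ((+) (- a) ` S)" by (simp add: image_image)
    have "hausdorff_outer (real_of_int k) ((+) a ` ((+) (- a) ` S)) = 0"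
    proof (rule hausdorff_outer_lipschitz_image_null[OF V(1) refl])
      show "(+) (- a) ` S \<subseteq> V" using hull_subset[of S affine] V(3) by force
      show "bounded ((+) (- a) ` S)" using assms by (rule bounded_translation)
      show "1-lipschitz_on ((+) (- a) ` S) ((+) a)" by (auto simp: lipschitz_on_def)
    qed (use V(2) k in linarith)
    then show ?thesis using S by simp
  qed simp
  show "hausdorff_outer (real_of_int k) S < top" if k: "aff_dim S = k" "0 < k"
  proof -
    obtain a where a: "a \<in> S" using k by fastforce
    have "a \<in> affine hull S" using a by (rule hull_inc)
    then obtain V where V: "subspace V" "int (dim V) = aff_dim S" "affine hull S = (+) a ` V"
      by (rule affine_translation_subspace[OF affine_affine_hull, unfolded aff_dim_affine_hull])
    have S: "S = (+) a ` ((+) (- a) ` S)" by (simp add: image_image)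
    have "hausdorff_outer (dim V) ((+) a ` ((+) (- a) ` S)) < top"
    proof (rule hausdorff_outer_lipschitz_image_finite[OF V(1) refl])
      show "(+) (- a) ` S \<subseteq> V" using hull_subset[of S affine] V(3) by force
      show "bounded ((+) (- a) ` S)" using assms by (rule bounded_translation)
      show "1-lipschitz_on ((+) (- a) ` S) ((+) a)" by (auto simp: lipschitz_on_def)
    qed (use V(2) k in linarith)
    then show ?thesis using S V(2) k(1) by (metis of_int_of_nat_eq)
  qed
qed

section \<open>Test functions\<close>

lemma C1_grad_has_derivative: "C1_grad u u' \<Longrightarrow> (u has_derivative (\<lambda>h. h \<bullet> u' x)) (at x)"
  by (simp add: C1_grad_def gderiv_def)

lemma C1_grad_continuous:
  assumes "C1_grad u u'" shows "continuous_on UNIV u" "continuous_on UNIV u'"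
proof -
  show "continuous_on UNIV u"
    using C1_grad_has_derivative[OF assms] by (intro has_derivative_continuous_on) (auto intro: has_derivative_at_withinI)
qed (use assms in \<open>simp add: C1_grad_def\<close>)

lemma C1_grad_measurable:
  assumes "C1_grad u u'"
  shows "u \<in> borel_measurable borel" "u' \<in> borel_measurable borel"
  using C1_grad_continuous[OF assms] by (auto intro: borel_measurable_continuous_onI)

lemma C1_grad_const: "C1_grad (\<lambda>x. c) (\<lambda>x. 0)"
  by (simp add: C1_grad_def GDERIV_const)

lemma C1_grad_add: "C1_grad u u' \<Longrightarrow> C1_grad v v' \<Longrightarrow> C1_grad (\<lambda>x. u x + v x) (\<lambda>x. u' x + v' x)"
  by (auto simp: C1_grad_def GDERIV_add intro!: continuous_intros)

lemma C1_grad_mult: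
  "C1_grad u u' \<Longrightarrow> C1_grad v v' \<Longrightarrow> C1_grad (\<lambda>x. u x * v x) (\<lambda>x. u x *\<^sub>R v' x + v x *\<^sub>R u' x)"
  using C1_grad_continuous[of u u'] C1_grad_continuous[of v v']
  by (auto simp: C1_grad_def GDERIV_mult intro!: continuous_intros)

lemma C1_grad_compose:
  assumes "C1_grad u u'" "\<And>t. DERIV f t :> f' t" "continuous_on UNIV f'"
  shows "C1_grad (\<lambda>x. f (u x)) (\<lambda>x. f' (u x) *\<^sub>R u' x)"
  unfolding C1_grad_def
proof (intro conjI allI)
  show "GDERIV (\<lambda>x. f (u x)) x :> f' (u x) *\<^sub>R u' x" for x
    using assms(1,2) by (intro GDERIV_DERIV_compose) (auto simp: C1_grad_def)
  show "continuous_on UNIV (\<lambda>x. f' (u x) *\<^sub>R u' x)"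
    using C1_grad_continuous[OF assms(1)]
    by (intro continuous_on_scaleR continuous_on_compose2[OF assms(3)]) auto
qed

lemma C1_grad_sum:
  assumes "finite I" "\<And>i. i \<in> I \<Longrightarrow> C1_grad (u i) (u' i)"
  shows "C1_grad (\<lambda>x. \<Sum>i\<in>I. u i x) (\<lambda>x. \<Sum>i\<in>I. u' i x)"
  using assms by (induction I rule: finite_induct) (auto intro: C1_grad_add C1_grad_const)

lemma DERIV_sq_pos: "DERIV (\<lambda>t. (max 0 t)\<^sup>2) t :> 2 * max 0 (t::real)"
proof (cases t "0::real" rule: linorder_cases)
  case less
  have "DERIV (\<lambda>t. 0) t :> (0::real)" by simp
  then have "DERIV (\<lambda>t. (max 0 t)\<^sup>2) t :> 0"
    by (rule has_field_derivative_transform_within_open[of _ _ _ "{..<0}"]) (use less in auto)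
  then show ?thesis using less by simp
next
  case greater
  have "DERIV (\<lambda>t. t\<^sup>2) t :> 2 * t" by (auto intro!: derivative_eq_intros)
  then have "DERIV (\<lambda>t. (max 0 t)\<^sup>2) t :> 2 * t"
    by (rule has_field_derivative_transform_within_open[of _ _ _ "{0<..}"]) (use greater in auto)
  then show ?thesis using greater by simp
next
  case equal
  have "((\<lambda>h::real. (max 0 h)\<^sup>2 / h) \<longlongrightarrow> 0) (at 0)"
  proof (rule Lim_null_comparison)
    have "\<bar>(max 0 h)\<^sup>2 / h\<bar> \<le> \<bar>h\<bar>" for h :: real by (cases "0 < h") (auto simp: power2_eq_square)
    then show "\<forall>\<^sub>F h in at 0. norm ((max 0 h)\<^sup>2 / h) \<le> \<bar>h::real\<bar>" by simp
    show "((\<lambda>h::real. \<bar>h\<bar>) \<longlongrightarrow> 0) (at 0)" by (intro tendsto_rabs_zero tendsto_ident_at)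
  qed
  then show ?thesis using equal by (simp add: DERIV_def)
qed

lemma C1_grad_sq_pos:
  assumes "C1_grad u u'"
  shows "C1_grad (\<lambda>x. (max 0 (u x))\<^sup>2) (\<lambda>x. (2 * max 0 (u x)) *\<^sub>R u' x)"
  by (rule C1_grad_compose[OF assms DERIV_sq_pos]) (intro continuous_intros)

lemma C1_grad_radial: "C1_grad (\<lambda>x. a - (x - c) \<bullet> (x - c)) (\<lambda>x. - 2 *\<^sub>R (x - c))"
  unfolding C1_grad_def gderiv_def
proof (intro conjI allI)
  fix x
  have d: "((\<lambda>x. x - c) has_derivative (\<lambda>h. h)) (at x)"
    using has_derivative_diff[OF has_derivative_ident has_derivative_const, of c "at x"] by simp
  show "((\<lambda>x. a - (x - c) \<bullet> (x - c)) has_derivative (\<lambda>h. h \<bullet> (- 2 *\<^sub>R (x - c)))) (at x)"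
    using has_derivative_diff[OF has_derivative_const has_derivative_inner[OF d d], of a]
    by (simp add: inner_commute)
  show "continuous_on UNIV (\<lambda>x. - 2 *\<^sub>R (x - c))" by (intro continuous_intros)
qed

text \<open>By the Lindeloef property \<open>V\<close> is a countable union of balls whose closures lie in \<open>V\<close>. With the radial
  bumps \<open>b k\<close> on these balls, \<open>\<theta> n\<close> is \<open>1 - (max 0 (1 - n * (\<Sum>k<n. b k)))\<^sup>2\<close>: the square of a positive part
  is \<open>C\<^sup>1\<close>, the support is contained in finitely many closed balls, and at each point of \<open>V\<close> the value
  is eventually 1.\<close>

lemma C1_approx_indicator:
  fixes V :: "'a::euclidean_space set"
  assumes "open V"
  shows "\<exists>\<theta>. (\<forall>n::nat. \<exists>\<theta>'. test_fun V (\<theta> n) \<theta>') \<and> (\<forall>n x. 0 \<le> \<theta> n x \<and> \<theta> n x \<le> 1) \<and>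
    (\<forall>x. (\<lambda>n. \<theta> n x) \<longlonglongrightarrow> indicator V x)"
proof -
  define \<F> where "\<F> = {ball c r |c r. cball c r \<subseteq> V}"
  have un: "\<Union>\<F> = V"
  proof
    show "\<Union>\<F> \<subseteq> V" unfolding \<F>_def using ball_subset_cball by blast
    show "V \<subseteq> \<Union>\<F>"
    proof
      fix x assume "x \<in> V"
      then obtain e where "0 < e" "cball x e \<subseteq> V" using assms open_contains_cball by blast
      then have "ball x e \<in> \<F>" "x \<in> ball x e" by (auto simp: \<F>_def)
      then show "x \<in> \<Union>\<F>" by blast
    qed
  qed
  obtain \<F>' where \<F>': "\<F>' \<subseteq> \<F>" "countable \<F>'" "\<Union>\<F>' = \<Union>\<F>"
    by (rule Lindelof[of \<F>]) (auto simp: \<F>_def)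
  \<comment> \<open>The empty set is a ball of negative radius; adding it makes the countable cover nonempty, so that it can be enumerated.\<close>
  have e: "ball (0::'a) (- 1) = {}" "cball (0::'a) (- 1) = {}" by simp_all
  have "{} = ball (0::'a) (- 1) \<and> cball (0::'a) (- 1) \<subseteq> V" by (simp only: e) simp
  then have "{} \<in> \<F>" unfolding \<F>_def by blast
  define B where "B = from_nat_into (insert {} \<F>')"
  have rB: "range B = insert {} \<F>'" unfolding B_def using \<F>'(2) by (intro range_from_nat_into) auto
  have "\<exists>c r. B k = ball c r \<and> cball c r \<subseteq> V" for k
  proof -
    have "B k \<in> range B" by simp
    then have "B k \<in> insert {} \<F>'" unfolding rB .
    then have "B k \<in> \<F>" using \<F>'(1) \<open>{} \<in> \<F>\<close> by auto
    then show ?thesis unfolding \<F>_def mem_Collect_eq .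
  qed
  then obtain c r where cr: "\<And>k. B k = ball (c k) (r k)" "\<And>k. cball (c k) (r k) \<subseteq> V" by metis
  have V: "V = (\<Union>k. ball (c k) (r k))" 
  proof -
    have "(\<Union>k. ball (c k) (r k)) = \<Union>(range B)" by (simp only: cr(1)[symmetric])
    also have "\<dots> = V" unfolding rB using un \<F>'(3) by simp
    finally show ?thesis ..
  qed
  define \<rho> where "\<rho> k = max 0 (r k)" for k
  define b where "b k x = (max 0 ((\<rho> k)\<^sup>2 - (x - c k) \<bullet> (x - c k)))\<^sup>2" for k x
  have ball: "x \<in> ball (c k) (r k) \<longleftrightarrow> (x - c k) \<bullet> (x - c k) < (\<rho> k)\<^sup>2" for x k
  proof -
    have "x \<in> ball (c k) (r k) \<longleftrightarrow> norm (x - c k) < \<rho> k"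
      using norm_ge_zero[of "x - c k"] by (simp add: \<rho>_def dist_norm norm_minus_commute less_max_iff_disj)
    also have "\<dots> \<longleftrightarrow> (norm (x - c k))\<^sup>2 < (\<rho> k)\<^sup>2"
      using power_strict_mono[of "norm (x - c k)" "\<rho> k" 2] power2_less_imp_less[of "norm (x - c k)" "\<rho> k"]
      by (auto simp: \<rho>_def)
    finally show ?thesis by (simp add: power2_norm_eq_inner)
  qed
  have b0: "0 \<le> b k x" for k x by (simp add: b_def)
  have bpos: "0 < b k x \<longleftrightarrow> x \<in> ball (c k) (r k)" for k x 
    unfolding b_def ball by (auto simp: max_def)
  have "C1_grad (\<lambda>x. (\<rho> k)\<^sup>2 - (x - c k) \<bullet> (x - c k)) (\<lambda>x. - 2 *\<^sub>R (x - c k))" for k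
    by (rule C1_grad_radial)
  then have bC1: "C1_grad (b k) (\<lambda>x. (2 * max 0 ((\<rho> k)\<^sup>2 - (x - c k) \<bullet> (x - c k))) *\<^sub>R (- 2 *\<^sub>R (x - c k)))" for k
    unfolding b_def by (rule C1_grad_sq_pos)
  define \<theta> where "\<theta> n x = 1 + (- 1) * (max 0 (1 + (- real n) * (\<Sum>k<n. b k x)))\<^sup>2" for n x
  have "\<exists>\<theta>'. C1_grad (\<theta> n) \<theta>'" for n
    unfolding \<theta>_def
    by (intro exI) (rule C1_grad_add C1_grad_mult C1_grad_const C1_grad_sq_pos C1_grad_sum bC1 finite_lessThan)+
  then obtain \<theta>' where \<theta>': "\<And>n. C1_grad (\<theta> n) (\<theta>' n)" by metis
  have S0: "0 \<le> (\<Sum>k<n. b k x)" for n x by (intro sum_nonneg b0)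
  have mx: "0 \<le> max 0 (1 + (- real n) * (\<Sum>k<n. b k x))" "max 0 (1 + (- real n) * (\<Sum>k<n. b k x)) \<le> 1" for n x
    using S0[where n=n and x=x] by auto
  show ?thesis
  proof (intro exI[of _ \<theta>] conjI allI)
    fix n
    have "\<theta> n x = 0" if "x \<notin> (\<Union>k<n. cball (c k) (r k))" for x
    proof -
      have "b k x = 0" if "k < n" for k
        using \<open>x \<notin> _\<close> that bpos[of k x] b0[of k x] ball_subset_cball[of "c k" "r k"] by fastforce
      then show ?thesis by (simp add: \<theta>_def)
    qed
    then show "\<exists>\<theta>'. test_fun V (\<theta> n) \<theta>'"
      unfolding test_fun_def using \<theta>' cr(2)
      by (intro exI[of _ "\<theta>' n"] conjI exI[of _ "\<Union>k<n. cball (c k) (r k)"]) (auto intro!: compact_UN)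
    fix x
    show "0 \<le> \<theta> n x" "\<theta> n x \<le> 1" using mx[where n=n and x=x] by (auto simp: \<theta>_def power_le_one)
  next
    fix x
    show "(\<lambda>n. \<theta> n x) \<longlonglongrightarrow> indicator V x"
    proof (cases "x \<in> V")
      case True
      then obtain j where "x \<in> ball (c j) (r j)" using V by auto
      then have bj: "0 < b j x" using bpos by simp
      obtain m :: nat where m: "1 / b j x \<le> m" using real_arch_simple by blast
      have "\<theta> n x = 1" if n: "max m (Suc j) \<le> n" for n
      proof -
        have "1 / b j x \<le> real n" using m n by (simp add: order_trans)
        then have "1 \<le> real n * b j x" using bj by (simp add: field_simps)
        also have "\<dots> \<le> real n * (\<Sum>k<n. b k x)"
          using n by (intro mult_left_mono member_le_sum) (auto simp: b0)
        finally show ?thesis by (simp add: \<theta>_def)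
      qed
      then have "\<forall>\<^sub>F n in sequentially. \<theta> n x = indicator V x"
        using True by (intro eventually_sequentiallyI[of "max m (Suc j)"]) simp
      then show ?thesis by (rule tendsto_eventually)
    next
      case False
      then have "b k x = 0" for k using V bpos[of k x] b0[of k x] by fastforce
      then show ?thesis using False by (simp add: \<theta>_def)
    qed
  qed
qed

section \<open>The fundamental lemma of the calculus of variations\<close>

text \<open>Lebesgue and Hausdorff measure share the one property that lets continuous test functions detect
  a density: up to null sets, measurable sets of finite measure are Borel.\<close>

definition borel_regular :: "'a::euclidean_space measure \<Rightarrow> bool" where
  "borel_regular M \<longleftrightarrow> space M = UNIV \<and> sets borel \<subseteq> sets M \<and>
     (\<forall>A\<in>sets M. emeasure M A < top \<longrightarrow> (\<exists>B\<in>sets borel. A \<subseteq> B \<and> B - A \<in> null_sets M))"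

lemma borel_regular_lebesgue: "borel_regular lebesgue"
  unfolding borel_regular_def
proof (intro conjI ballI impI)
  show "sets borel \<subseteq> sets lebesgue" by auto
  fix A :: "'a set" assume "A \<in> sets lebesgue"
  then obtain S N N' where SN: "A = S \<union> N" "N \<subseteq> N'" "N' \<in> null_sets lborel" "S \<in> sets lborel"
    by (rule sets_completionE)
  have "S \<union> N' - A \<in> null_sets lebesgue"
    using null_sets_completion_subset[OF _ null_sets_completionI[OF SN(3)], of "S \<union> N' - A"] SN by auto
  then show "\<exists>B\<in>sets borel. A \<subseteq> B \<and> B - A \<in> null_sets lebesgue"
    using SN by (intro bexI[of _ "S \<union> N'"]) auto
qed simp

lemma borel_regular_hausdorff: "borel_regular (hausdorff_measure s)"
  unfolding borel_regular_def
proof (intro conjI ballI impI)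
  show "sets borel \<subseteq> sets (hausdorff_measure s)" using borel_in_sets_hausdorff by blast
  fix A :: "'a set" assume A: "A \<in> sets (hausdorff_measure s)" "emeasure (hausdorff_measure s) A < top"
  then have "hausdorff_outer s A < top" by (simp add: emeasure_hausdorff)
  then obtain B where B: "B \<in> sets borel" "A \<subseteq> B" "hausdorff_outer s B = hausdorff_outer s A"
    by (rule hausdorff_borel_hull)
  have Bs: "B \<in> sets (hausdorff_measure s)" using B(1) by (rule borel_in_sets_hausdorff)
  have "emeasure (hausdorff_measure s) (B - A) = 0"
    using A B Bs by (subst emeasure_Diff) (auto simp: emeasure_hausdorff)
  then show "\<exists>B\<in>sets borel. A \<subseteq> B \<and> B - A \<in> null_sets (hausdorff_measure s)"
    using A B Bs by (intro bexI[of _ B]) (auto simp: null_sets_def)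
qed simp

lemma borel_measurable_borel_regular:
  "borel_regular M \<Longrightarrow> f \<in> borel_measurable borel \<Longrightarrow> f \<in> borel_measurable M"
  unfolding borel_regular_def measurable_def by auto

text \<open>Dominated convergence along \<open>C1_approx_indicator\<close> shows that \<open>g\<close> integrates to zero over open subsets of
  \<open>U\<close>; a Dynkin class argument extends this to Borel sets, and regularity to the superlevel
  sets \<open>{x \<in> U. 1 / k < g x}\<close>, which must then be null.\<close>

lemma fundamental_lemma_nonpos:
  fixes g :: "'a::euclidean_space \<Rightarrow> real"
  assumes M: "borel_regular M" and g: "integrable M g" and U: "open U"
    and ortho: "\<And>\<theta> \<theta>'. test_fun U \<theta> \<theta>' \<Longrightarrow> (LINT x|M. \<theta> x * g x) = 0"
  shows "AE x in M. x \<in> U \<longrightarrow> g x \<le> 0"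
proof -
  have sp: "space M = UNIV" and bs: "\<And>A. A \<in> sets borel \<Longrightarrow> A \<in> sets M" using M by (auto simp: borel_regular_def)
  have Us: "U \<in> sets M" using U bs by auto
  define h where "h x = indicator U x * g x" for x
  have h: "integrable M h" 
    using integrable_real_mult_indicator[OF Us g] by (simp add: h_def[abs_def] mult.commute)
  have ind: "integrable M (\<lambda>x. indicator A x * h x)" if "A \<in> sets M" for A
    using integrable_real_mult_indicator[OF that h] by (simp add: mult.commute)
  have op: "(LINT x|M. indicator W x * h x) = 0" if W: "open W" for W
  proof -
    obtain \<theta> where "(\<forall>n::nat. \<exists>\<theta>'. test_fun (W \<inter> U) (\<theta> n) \<theta>') \<and> (\<forall>n x. 0 \<le> \<theta> n x \<and> \<theta> n x \<le> 1) \<and>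
        (\<forall>x. (\<lambda>n. \<theta> n x) \<longlonglongrightarrow> indicator (W \<inter> U) x)"
      using C1_approx_indicator[OF open_Int[OF W U]] ..
    then have \<theta>: "\<And>n. \<exists>\<theta>'. test_fun (W \<inter> U) (\<theta> n) \<theta>'" "\<And>n x. 0 \<le> \<theta> n x" "\<And>n x. \<theta> n x \<le> 1"
      "\<And>x. (\<lambda>n. \<theta> n x) \<longlonglongrightarrow> indicator (W \<inter> U) x"
      by simp_all
    have "(\<lambda>n. LINT x|M. \<theta> n x * g x) \<longlonglongrightarrow> (LINT x|M. indicator (W \<inter> U) x * g x)"
    proof (rule integral_dominated_convergence)
      show "(\<lambda>x. indicator (W \<inter> U) x * g x) \<in> borel_measurable M"
        by (intro borel_measurable_times borel_measurable_indicator borel_measurable_integrable[OF g] bs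
            borel_open open_Int W U)
      have "\<theta> n \<in> borel_measurable M" for n
      proof -
        obtain \<theta>' where "test_fun (W \<inter> U) (\<theta> n) \<theta>'" using \<theta>(1) ..
        then have "C1_grad (\<theta> n) \<theta>'" unfolding test_fun_def by simp
        then show ?thesis by (intro borel_measurable_borel_regular[OF M] C1_grad_measurable(1))
      qed
      then show "(\<lambda>x. \<theta> n x * g x) \<in> borel_measurable M" for n
        by (intro borel_measurable_times borel_measurable_integrable[OF g])
      show "integrable M (\<lambda>x. \<bar>g x\<bar>)" using g by simp
      show "AE x in M. (\<lambda>n. \<theta> n x * g x) \<longlonglongrightarrow> indicator (W \<inter> U) x * g x"
        by (intro AE_I2 tendsto_intros \<theta>(4))
      show "AE x in M. norm (\<theta> n x * g x) \<le> \<bar>g x\<bar>" for n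
        using \<theta>(2,3) by (intro AE_I2) (auto simp: abs_mult intro!: mult_left_le_one_le)
    qed
    moreover have "(LINT x|M. \<theta> n x * g x) = 0" for n
    proof -
      obtain \<theta>' where "test_fun (W \<inter> U) (\<theta> n) \<theta>'" using \<theta>(1) ..
      then have "test_fun U (\<theta> n) \<theta>'" unfolding test_fun_def by blast
      then show ?thesis by (rule ortho)
    qed
    ultimately have "(LINT x|M. indicator (W \<inter> U) x * g x) = 0" by (simp add: LIMSEQ_const_iff)
    then show ?thesis by (simp add: h_def indicator_inter_arith mult.assoc)
  qed
  have bor: "(LINT x|M. indicator B x * h x) = 0" if B: "B \<in> sets borel" for B
  proof -
    have bd: "sets (borel::'a measure) = sigma_sets UNIV (Collect open)" by (simp add: borel_def)
    have "B \<in> sigma_sets UNIV (Collect open)" using B unfolding bd .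
    have "Int_stable (Collect open :: 'a set set)" "Collect open \<subseteq> Pow (UNIV :: 'a set)"
      by (auto simp: Int_stable_def)
    from this \<open>B \<in> sigma_sets UNIV (Collect open)\<close> show ?thesis
    proof (induction rule: sigma_sets_induct_disjoint)
      case (compl A)
      have "A \<in> sets M" using compl(1) bs unfolding bd by blast
      have U': "UNIV \<in> sets M" using sets.top[of M] by (simp add: sp)
      have "(LINT x|M. indicator UNIV x * h x - indicator A x * h x) = 0 - 0"
        using compl op[of UNIV] ind[OF U'] ind[OF \<open>A \<in> sets M\<close>] by (subst Bochner_Integration.integral_diff) auto
      moreover have "indicator (UNIV - A) x * h x = indicator UNIV x * h x - indicator A x * h x" for x
        by (simp split: split_indicator)
      ultimately show ?case by simp
    next
      case (union A)
      have A: "A i \<in> sets M" for i using union(2) bs unfolding bd by blast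
      have "(LINT x:(\<Union>i. A i)|M. h x) = (\<Sum>i. (LINT x:(A i)|M. h x))"
      proof (rule lebesgue_integral_countable_add[OF A])
        show "A i \<inter> A j = {}" if "i \<noteq> j" for i j using union(1) that by (auto simp: disjoint_family_on_def)
        show "set_integrable M (\<Union>i. A i) h" unfolding set_integrable_def using ind[OF sets.countable_UN[of A UNIV M]] A by auto
      qed
      then show ?case using union(3) by (simp add: set_lebesgue_integral_def)
    qed (auto simp: op)
  qed
  have null: "emeasure M {x. 1 / Suc k < h x} = 0" for k
  proof -
    define A where "A = {x. 1 / Suc k < h x}"
    have A: "A \<in> sets M"
      using borel_measurable_integrable[OF h] unfolding A_def by (simp add: borel_measurable_iff_greater sp)
    have "(\<integral>\<^sup>+x. ennreal (1 / Suc k) * indicator A x \<partial>M) \<le> (\<integral>\<^sup>+x. ennreal (norm (h x)) \<partial>M)"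
      by (intro nn_integral_mono) (auto simp: A_def split: split_indicator intro!: ennreal_leI)
    also have "\<dots> < top" using h by (simp add: integrable_iff_bounded)
    finally have fin: "emeasure M A < top"
      using A by (subst (asm) nn_integral_cmult_indicator) (auto simp: ennreal_mult_less_top)
    obtain B where B: "B \<in> sets borel" "A \<subseteq> B" "B - A \<in> null_sets M"
      using M A fin unfolding borel_regular_def by blast
    have "(LINT x|M. indicator A x * h x) = (LINT x|M. indicator B x * h x)"
    proof (rule integral_cong_AE)
      show "(\<lambda>x. indicator A x * h x) \<in> borel_measurable M" "(\<lambda>x. indicator B x * h x) \<in> borel_measurable M"
        using ind[OF A] ind[OF bs[OF B(1)]] by auto
      show "AE x in M. indicator A x * h x = indicator B x * h x"
        using AE_not_in[OF B(3)] by eventually_elim (use B(2) in \<open>auto split: split_indicator\<close>)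
    qed
    then have "(LINT x|M. indicator A x * h x) = 0" using bor[OF B(1)] by simp
    moreover have "(LINT x|M. indicator A x * (1 / Suc k)) \<le> (LINT x|M. indicator A x * h x)"
      using ind[OF A] A fin
      by (intro integral_mono) (auto simp: A_def split: split_indicator)
    moreover have "(LINT x|M. indicator A x * (1 / Suc k)) = measure M A * (1 / Suc k)"
      using A fin by (subst integral_mult_left_zero) (auto simp: sp)
    ultimately have "measure M A * (1 / Suc k) \<le> 0" by simp
    then have "measure M A = 0" using measure_nonneg[of M A] by (simp add: divide_le_0_iff)
    then have "emeasure M A = 0" using fin emeasure_eq_ennreal_measure[of M A] by simp
    then show ?thesis unfolding A_def .
  qed
  have "AE x in M. \<forall>k. \<not> 1 / Suc k < h x"
  proof (subst AE_all_countable, intro allI AE_I)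
    fix k
    show "{x \<in> space M. \<not> \<not> 1 / Suc k < h x} \<subseteq> {x. 1 / Suc k < h x}" by auto
    show "emeasure M {x. 1 / Suc k < h x} = 0" by (rule null)
    show "{x. 1 / Suc k < h x} \<in> sets M"
      using borel_measurable_integrable[OF h] sp by (simp add: borel_measurable_iff_greater)
  qed
  then show ?thesis
  proof eventually_elim
    case (elim x)
    show ?case
    proof (rule impI, rule ccontr)
      assume x: "x \<in> U" "\<not> g x \<le> 0"
      then have "0 < h x" by (simp add: h_def)
      then obtain k where "1 / Suc k < h x" by (rule nat_approx_posE)
      then show False using elim by blast
    qed
  qed
qed

lemma fundamental_lemma:
  fixes g :: "'a::euclidean_space \<Rightarrow> real"
  assumes M: "borel_regular M" and A: "A \<in> sets M" and g: "integrable (restrict_space M A) g" and U: "open U"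
    and ortho: "\<And>\<theta> \<theta>'. test_fun U \<theta> \<theta>' \<Longrightarrow> (LINT x|restrict_space M A. \<theta> x * g x) = 0"
  shows "AE x in restrict_space M A. x \<in> U \<longrightarrow> g x = 0"
proof -
  have sp: "A \<inter> space M \<in> sets M" using A by auto
  define h where "h x = indicator A x * g x" for x
  have h: "integrable M h" using g unfolding h_def by (simp add: integrable_restrict_space[OF sp])
  have oh: "(LINT x|M. \<theta> x * h x) = 0" if "test_fun U \<theta> \<theta>'" for \<theta> \<theta>'
    using ortho[OF that] by (simp add: h_def integral_restrict_space[OF sp] mult_ac)
  have "AE x in M. x \<in> U \<longrightarrow> h x \<le> 0"
    using M h U oh by (rule fundamental_lemma_nonpos)
  moreover have "AE x in M. x \<in> U \<longrightarrow> - h x \<le> 0"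
    by (rule fundamental_lemma_nonpos[OF M _ U]) (use h oh in auto)
  ultimately have "AE x in M. x \<in> U \<longrightarrow> h x = 0" by eventually_elim auto
  then show ?thesis unfolding AE_restrict_space_iff[OF sp] by eventually_elim (auto simp: h_def)
qed

section \<open>Square-integrable functions\<close>

lemma L2_measurable: "f \<in> L2 M \<Longrightarrow> f \<in> borel_measurable M"
  and L2_integrable: "f \<in> L2 M \<Longrightarrow> integrable M (\<lambda>x. (norm (f x))\<^sup>2)"
  by (simp_all add: L2_def)

lemma L2_bound:
  assumes f: "f \<in> borel_measurable M" and g: "g \<in> L2 M" and le: "AE x in M. norm (f x) \<le> C * norm (g x)"
  shows "f \<in> L2 M"
  unfolding L2_def
proof (intro CollectI conjI f)
  show "integrable M (\<lambda>x. (norm (f x))\<^sup>2)"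
  proof (rule Bochner_Integration.integrable_bound)
    show "integrable M (\<lambda>x. C\<^sup>2 * (norm (g x))\<^sup>2)" using L2_integrable[OF g] by simp
    show "(\<lambda>x. (norm (f x))\<^sup>2) \<in> borel_measurable M" using f by measurable
    show "AE x in M. norm ((norm (f x))\<^sup>2) \<le> norm (C\<^sup>2 * (norm (g x))\<^sup>2)"
      using le
    proof eventually_elim
      case (elim x)
      then have "(norm (f x))\<^sup>2 \<le> (C * norm (g x))\<^sup>2" by (intro power_mono) auto
      then show ?case by (simp add: power_mult_distrib)
    qed
  qed
qed

lemma L2_add:
  assumes f: "f \<in> L2 M" and g: "g \<in> L2 M" shows "(\<lambda>x. f x + g x) \<in> L2 M"
  unfolding L2_def
proof (intro CollectI conjI)
  have m: "f \<in> borel_measurable M" "g \<in> borel_measurable M" using f g by (simp_all add: L2_measurable)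
  then show "(\<lambda>x. f x + g x) \<in> borel_measurable M" by measurable
  show "integrable M (\<lambda>x. (norm (f x + g x))\<^sup>2)"
  proof (rule Bochner_Integration.integrable_bound)
    show "integrable M (\<lambda>x. 2 * (norm (f x))\<^sup>2 + 2 * (norm (g x))\<^sup>2)"
      using L2_integrable[OF f] L2_integrable[OF g] by simp
    show "(\<lambda>x. (norm (f x + g x))\<^sup>2) \<in> borel_measurable M" using m by measurable
    have "(norm (f x + g x))\<^sup>2 \<le> 2 * (norm (f x))\<^sup>2 + 2 * (norm (g x))\<^sup>2" for x
    proof -
      have "(norm (f x + g x))\<^sup>2 \<le> (norm (f x) + norm (g x))\<^sup>2" by (intro power_mono norm_triangle_ineq) simp
      also have "\<dots> \<le> 2 * (norm (f x))\<^sup>2 + 2 * (norm (g x))\<^sup>2"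
        using sum_squares_bound[of "norm (f x)" "norm (g x)"] by (simp add: power2_sum)
      finally show ?thesis .
    qed
    then show "AE x in M. norm ((norm (f x + g x))\<^sup>2) \<le> norm (2 * (norm (f x))\<^sup>2 + 2 * (norm (g x))\<^sup>2)" by simp
  qed
qed

lemma L2_zero: "(\<lambda>x. 0) \<in> L2 M" by (simp add: L2_def)

lemma L2_scaleR: "f \<in> L2 M \<Longrightarrow> (\<lambda>x. c *\<^sub>R f x) \<in> L2 M"
  by (rule L2_bound[of _ M f "\<bar>c\<bar>"]) (auto dest: L2_measurable)

lemma L2_cmult: "f \<in> L2 M \<Longrightarrow> (\<lambda>x. c * f x :: real) \<in> L2 M"
  using L2_scaleR[of f M c] by simp

lemma L2_minus: "f \<in> L2 M \<Longrightarrow> (\<lambda>x. - f x) \<in> L2 M"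
  using L2_scaleR[of f M "-1"] by simp

lemma L2_diff: "f \<in> L2 M \<Longrightarrow> g \<in> L2 M \<Longrightarrow> (\<lambda>x. f x - g x) \<in> L2 M"
  using L2_add[of f M "\<lambda>x. - g x"] by (simp add: L2_minus)

lemma L2_sum: "(\<And>i. i \<in> I \<Longrightarrow> f i \<in> L2 M) \<Longrightarrow> (\<lambda>x. \<Sum>i\<in>I. f i x) \<in> L2 M"
  by (induction I rule: infinite_finite_induct) (auto intro: L2_add L2_zero)

lemma L2_bounded_scaleR:
  assumes g: "g \<in> L2 M" and c: "c \<in> borel_measurable M" "AE x in M. \<bar>c x\<bar> \<le> C"
  shows "(\<lambda>x. c x *\<^sub>R g x) \<in> L2 M"
proof (rule L2_bound[OF _ g, of _ C])
  show "(\<lambda>x. c x *\<^sub>R g x) \<in> borel_measurable M"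
    using c(1) L2_measurable[OF g] by measurable
  show "AE x in M. norm (c x *\<^sub>R g x) \<le> C * norm (g x)"
    using c(2) by eventually_elim (simp add: mult_right_mono)
qed

lemma L2_inner_integrable:
  assumes f: "f \<in> L2 M" and g: "g \<in> L2 M" shows "integrable M (\<lambda>x. f x \<bullet> g x)"
proof (rule Bochner_Integration.integrable_bound)
  show "integrable M (\<lambda>x. (norm (f x))\<^sup>2 + (norm (g x))\<^sup>2)"
    using L2_integrable[OF f] L2_integrable[OF g] by simp
  show "(\<lambda>x. f x \<bullet> g x) \<in> borel_measurable M"
    using L2_measurable[OF f] L2_measurable[OF g] by measurable
  have "\<bar>f x \<bullet> g x\<bar> \<le> (norm (f x))\<^sup>2 + (norm (g x))\<^sup>2" for x
  proof -
    have "\<bar>f x \<bullet> g x\<bar> \<le> norm (f x) * norm (g x)" by (rule Cauchy_Schwarz_ineq2)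
    also have "\<dots> \<le> (norm (f x))\<^sup>2 + (norm (g x))\<^sup>2"
      using sum_squares_bound[of "norm (f x)" "norm (g x)"]
        mult_nonneg_nonneg[OF norm_ge_zero[of "f x"] norm_ge_zero[of "g x"]]
      unfolding mult.assoc by linarith
    finally show ?thesis .
  qed
  then show "AE x in M. norm (f x \<bullet> g x) \<le> norm ((norm (f x))\<^sup>2 + (norm (g x))\<^sup>2)" by simp
qed

lemma L2_norm_L2: "f \<in> L2 M \<Longrightarrow> (\<lambda>x. norm (f x)) \<in> L2 M"
  by (rule L2_bound[of _ M f 1]) (auto dest: L2_measurable)

lemma L2_inner_const: "f \<in> L2 M \<Longrightarrow> (\<lambda>x. f x \<bullet> b) \<in> L2 M"
  by (rule L2_bound[of _ M f "norm b"])
    (auto dest: L2_measurable simp: Cauchy_Schwarz_ineq2 mult.commute[of "norm b"])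

lemma L2_Cauchy_Schwarz:
  assumes f: "f \<in> L2 M" and g: "g \<in> L2 M"
  shows "(LINT x|M. norm (f x) * norm (g x)) \<le> l2_norm M f * l2_norm M g"
proof -
  define a b where "a = l2_norm M f" and "b = l2_norm M g"
  have ab: "0 \<le> a" "0 \<le> b" by (auto simp: a_def b_def l2_norm_def)
  have sq: "a\<^sup>2 = (LINT x|M. (norm (f x))\<^sup>2)" "b\<^sup>2 = (LINT x|M. (norm (g x))\<^sup>2)"
    by (simp_all add: a_def b_def l2_norm_def)
  have fg: "integrable M (\<lambda>x. norm (f x) * norm (g x))"
    using L2_inner_integrable[OF L2_norm_L2[OF f] L2_norm_L2[OF g]] by simp
  let ?c = "LINT x|M. norm (f x) * norm (g x)"
  have c: "0 \<le> ?c" by (rule Bochner_Integration.integral_nonneg) simp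
  \<comment> \<open>The Young inequality integrated; it is then optimised over the scaling of f.\<close>
  have key: "2 * t * ?c \<le> t\<^sup>2 * a\<^sup>2 + b\<^sup>2" for t
  proof -
    have "(LINT x|M. 2 * t * (norm (f x) * norm (g x))) \<le> (LINT x|M. t\<^sup>2 * (norm (f x))\<^sup>2 + (norm (g x))\<^sup>2)"
    proof (rule integral_mono)
      show "2 * t * (norm (f x) * norm (g x)) \<le> t\<^sup>2 * (norm (f x))\<^sup>2 + (norm (g x))\<^sup>2" for x
        using sum_squares_bound[of "t * norm (f x)" "norm (g x)"] by (simp add: power_mult_distrib mult_ac)
    qed (use fg L2_integrable[OF f] L2_integrable[OF g] in auto)
    also have "\<dots> = t\<^sup>2 * a\<^sup>2 + b\<^sup>2"
      unfolding sq using L2_integrable[OF f] L2_integrable[OF g] by simp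
    finally show ?thesis by simp
  qed
  have "?c \<le> a * b"
  proof (cases "a = 0")
    case True
    have "?c \<le> 0"
    proof (rule ccontr)
      assume n: "\<not> ?c \<le> 0"
      \<comment> \<open>With a = 0 the left side can be made as large as desired by the choice of t.\<close>
      have "2 * ((b\<^sup>2 + 1) / ?c) * ?c \<le> b\<^sup>2" using key[of "(b\<^sup>2 + 1) / ?c"] True by simp
      then have "2 * (b\<^sup>2 + 1) \<le> b\<^sup>2" using n by simp
      then show False by (smt (verit) zero_le_power2)
    qed
    then show ?thesis using True by simp
  next
    case False
    have "2 * (?c / a\<^sup>2) * ?c \<le> (?c / a\<^sup>2)\<^sup>2 * a\<^sup>2 + b\<^sup>2" by (rule key)
    moreover have "(?c / a\<^sup>2)\<^sup>2 * a\<^sup>2 = ?c\<^sup>2 / a\<^sup>2" "2 * (?c / a\<^sup>2) * ?c = 2 * (?c\<^sup>2 / a\<^sup>2)"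
      using False by (simp_all add: power2_eq_square)
    ultimately have "?c\<^sup>2 / a\<^sup>2 \<le> b\<^sup>2" by linarith
    then have "?c\<^sup>2 \<le> (a * b)\<^sup>2" using False by (simp add: field_simps power_mult_distrib)
    then show ?thesis by (rule power2_le_imp_le) (use ab in simp)
  qed
  then show ?thesis by (simp add: a_def b_def)
qed

lemma finite_L2_integrable:
  assumes "finite_measure M" "f \<in> L2 M" shows "integrable M f"
proof (rule Bochner_Integration.integrable_bound)
  show "integrable M (\<lambda>x. 1 + (norm (f x))\<^sup>2)"
    using finite_measure.integrable_const[OF assms(1), of "1::real"] L2_integrable[OF assms(2)] by simp
  show "f \<in> borel_measurable M" using assms(2) by (rule L2_measurable)
  have "norm (f x) \<le> 1 + (norm (f x))\<^sup>2" for x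
    using sum_squares_bound[of "norm (f x)" 1] by simp (smt (verit) norm_ge_zero)
  then show "AE x in M. norm (f x) \<le> norm (1 + (norm (f x))\<^sup>2)" by simp
qed

lemma L2_vec:
  fixes u :: "'a \<Rightarrow> 'b::euclidean_space ^ 'i"
  shows "u \<in> L2 M \<longleftrightarrow> (\<forall>i. (\<lambda>x. u x $ i) \<in> L2 M)"
proof
  assume u: "u \<in> L2 M"
  show "\<forall>i. (\<lambda>x. u x $ i) \<in> L2 M"
  proof
    fix i
    have "(\<lambda>x. u x $ i) \<in> borel_measurable M"
      by (rule borel_measurable_continuous_on[OF _ L2_measurable[OF u]]) (intro continuous_intros)
    then show "(\<lambda>x. u x $ i) \<in> L2 M" using u
      by (rule L2_bound[of _ _ _ 1]) (auto intro: Finite_Cartesian_Product.norm_nth_le)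
  qed
next
  assume u: "\<forall>i. (\<lambda>x. u x $ i) \<in> L2 M"
  have "(\<lambda>x. axis i (u x $ i)) \<in> L2 M" for i
  proof -
    have "bounded_linear (axis i :: 'b \<Rightarrow> 'b ^ 'i)"
      by (rule linear_conv_bounded_linear[THEN iffD1], rule linearI)
         (auto simp: axis_def vec_eq_iff)
    then have "(\<lambda>x. axis i (u x $ i)) \<in> borel_measurable M"
      using u by (intro borel_measurable_continuous_on[of "axis i"] linear_continuous_on L2_measurable) auto
    then show ?thesis
      by (rule L2_bound[of _ _ "\<lambda>x. u x $ i" 1]) (use u in \<open>auto simp: norm_eq_sqrt_inner inner_axis_axis\<close>)
  qed
  then have "(\<lambda>x. \<Sum>i\<in>UNIV. axis i (u x $ i)) \<in> L2 M" by (intro L2_sum)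
  moreover have "(\<Sum>i\<in>UNIV. axis i (u x $ i)) = u x" for x
    by (simp add: vec_eq_iff axis_def if_distrib[of "\<lambda>z. z $ _"] sum.delta cong: if_cong)
  ultimately show "u \<in> L2 M" by simp
qed

lemma multi_L2: "multi (L2 M) = (L2 M :: ('a \<Rightarrow> 'b::euclidean_space ^ 'i) set)"
  by (auto simp: multi_def L2_vec)

section \<open>Square roots of positive definite matrices\<close>

text \<open>A maximum point \<open>e\<close> of the Rayleigh quotient on the unit sphere of \<open>S\<close> is an eigenvector: moving from \<open>e\<close>
  in a direction \<open>w\<close> with \<open>w \<bullet> (f e - \<mu> e) \<noteq> 0\<close> changes the quotient at first order.\<close>

lemma self_adjoint_eigenvector:
  fixes f :: "'a::euclidean_space \<Rightarrow> 'a"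
  assumes f: "linear f" and sym: "\<And>x y. f x \<bullet> y = x \<bullet> f y"
    and S: "subspace S" "\<And>x. x \<in> S \<Longrightarrow> f x \<in> S" "S \<noteq> {0}"
  obtains e \<mu> where "e \<in> S" "norm e = 1" "f e = \<mu> *\<^sub>R e"
proof -
  obtain x0 where x0: "x0 \<in> S" "x0 \<noteq> 0" using S subspace_0 by blast
  let ?K = "S \<inter> sphere 0 1"
  have "compact ?K" using closed_subspace[OF S(1)] by (intro closed_Int_compact) auto
  moreover have "x0 /\<^sub>R norm x0 \<in> ?K" using x0 S(1) by (auto intro: subspace_mul)
  moreover have "continuous_on ?K (\<lambda>x. x \<bullet> f x)"
    by (intro continuous_intros linear_continuous_on) (use f in \<open>simp add: linear_conv_bounded_linear\<close>)
  ultimately obtain e where e: "e \<in> ?K" "\<And>y. y \<in> ?K \<Longrightarrow> y \<bullet> f y \<le> e \<bullet> f e"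
    using continuous_attains_sup[of ?K "\<lambda>x. x \<bullet> f x"] by blast
  define \<mu> where "\<mu> = e \<bullet> f e"
  have ne: "norm e = 1" "e \<in> S" "e \<bullet> e = 1" using e(1) by (auto simp: norm_eq_1)
  have max: "y \<bullet> f y \<le> \<mu> * (y \<bullet> y)" if "y \<in> S" for y
  proof (cases "y = 0")
    case True then show ?thesis using linear_0[OF f] by simp
  next
    case False
    then have "y /\<^sub>R norm y \<in> ?K" using that S(1) by (auto intro: subspace_mul)
    then have "(y /\<^sub>R norm y) \<bullet> f (y /\<^sub>R norm y) \<le> \<mu>" unfolding \<mu>_def by (rule e(2))
    then have "(y \<bullet> f y) / (norm y * norm y) \<le> \<mu>"
      by (simp add: linear_scale[OF f] divide_inverse mult_ac)
    then show ?thesis using False by (simp add: divide_le_eq power2_norm_eq_inner[symmetric] power2_eq_square)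
  qed
  have orth: "w \<bullet> (f e - \<mu> *\<^sub>R e) = 0" if w: "w \<in> S" for w
  proof (rule ccontr)
    assume nz: "w \<bullet> (f e - \<mu> *\<^sub>R e) \<noteq> 0"
    define b c where "b = w \<bullet> (f e - \<mu> *\<^sub>R e)" and "c = w \<bullet> f w - \<mu> * (w \<bullet> w)"
    have quad: "2 * t * b + t\<^sup>2 * c \<le> 0" for t
    proof -
      have "e + t *\<^sub>R w \<in> S" using ne w S(1) by (intro subspace_add subspace_mul) auto
      then have "(e + t *\<^sub>R w) \<bullet> f (e + t *\<^sub>R w) \<le> \<mu> * ((e + t *\<^sub>R w) \<bullet> (e + t *\<^sub>R w))" by (rule max)
      moreover have "e \<bullet> f w = w \<bullet> f e" using sym[of w e] by (simp add: inner_commute)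
      ultimately show ?thesis
        using ne(3) unfolding b_def c_def
        by (simp add: linear_add[OF f] linear_scale[OF f] inner_add_left inner_add_right inner_diff_right
            \<mu>_def[symmetric] inner_commute[of e w] power2_eq_square algebra_simps)
    qed
    define d where "d = \<bar>c\<bar> + 1"
    have d: "0 < d" by (simp add: d_def)
    have "2 * (b / d) * b + (b / d)\<^sup>2 * c = b\<^sup>2 / d * (2 + c / d)"
      using d by (simp add: power2_eq_square field_simps)
    moreover have "- 1 \<le> c / d" using d by (simp add: field_simps d_def)
    moreover have "0 < b\<^sup>2 / d" using nz d by (simp add: b_def)
    ultimately show False using quad[of "b / d"] by (smt (verit) mult_pos_pos)
  qed
  have "f e - \<mu> *\<^sub>R e \<in> S" using ne(2) S by (intro subspace_diff subspace_mul) auto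
  then have "(f e - \<mu> *\<^sub>R e) \<bullet> (f e - \<mu> *\<^sub>R e) = 0" by (rule orth)
  then have "f e = \<mu> *\<^sub>R e" by simp
  then show thesis using ne that by blast
qed

lemma self_adjoint_orthonormal_eigenbasis:
  fixes f :: "'a::euclidean_space \<Rightarrow> 'a"
  assumes f: "linear f" and sym: "\<And>x y. f x \<bullet> y = x \<bullet> f y"
  shows "subspace S \<Longrightarrow> (\<And>x. x \<in> S \<Longrightarrow> f x \<in> S) \<Longrightarrow>
    \<exists>B. finite B \<and> pairwise orthogonal B \<and> (\<forall>b\<in>B. norm b = 1 \<and> (\<exists>\<mu>. f b = \<mu> *\<^sub>R b)) \<and> B \<subseteq> S \<and> S \<subseteq> span B"
proof (induction "dim S" arbitrary: S rule: less_induct)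
  case less
  show ?case
  proof (cases "S = {0}")
    case True
    then show ?thesis by (intro exI[of _ "{}"]) auto
  next
    case False
    obtain e \<mu> where e: "e \<in> S" "norm e = 1" "f e = \<mu> *\<^sub>R e"
      using self_adjoint_eigenvector[OF f sym less.prems False] by blast
    define T where "T = {y \<in> S. e \<bullet> y = 0}"
    have "subspace {y. e \<bullet> y = 0}" by (rule subspace_hyperplane)
    then have sT: "subspace T" using subspace_inter[of S "{y. e \<bullet> y = 0}"] less.prems(1)
      by (simp add: T_def Collect_conj_eq)
    have fT: "f x \<in> T" if "x \<in> T" for x
      using that less.prems(2) sym[of e x] e(3) by (auto simp: T_def)
    have "e \<notin> T" using e(2) by (auto simp: T_def)
    moreover have "T \<subseteq> S" by (auto simp: T_def)
    ultimately have "T \<subset> S" using e(1) by blast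
    then have "span T \<subset> span S"
      using sT less.prems(1) by (simp only: span_eq_iff[THEN iffD2])
    then have dim: "dim T < dim S" by (rule dim_psubset)
    obtain B where "finite B \<and> pairwise orthogonal B \<and> (\<forall>b\<in>B. norm b = 1 \<and> (\<exists>\<mu>. f b = \<mu> *\<^sub>R b)) \<and> B \<subseteq> T \<and> T \<subseteq> span B"
      using less.hyps[OF dim sT fT] ..
    then have B: "finite B" "pairwise orthogonal B" "\<forall>b\<in>B. norm b = 1 \<and> (\<exists>\<mu>. f b = \<mu> *\<^sub>R b)" "B \<subseteq> T" "T \<subseteq> span B"
      by simp_all
    have "S \<subseteq> span (insert e B)"
    proof
      fix x assume x: "x \<in> S"
      have "x - (e \<bullet> x) *\<^sub>R e \<in> T"
        using x e less.prems(1) by (auto simp: T_def inner_diff_right norm_eq_1 intro: subspace_diff subspace_mul)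
      then have "x - (e \<bullet> x) *\<^sub>R e \<in> span (insert e B)" using B(5) span_mono[of B "insert e B"] by blast
      moreover have "(e \<bullet> x) *\<^sub>R e \<in> span (insert e B)" by (intro span_mul span_base) simp
      ultimately have "(x - (e \<bullet> x) *\<^sub>R e) + (e \<bullet> x) *\<^sub>R e \<in> span (insert e B)" by (rule span_add)
      then show "x \<in> span (insert e B)" by simp
    qed
    moreover have "pairwise orthogonal (insert e B)"
      using B(2,4) by (auto simp: pairwise_insert T_def orthogonal_def inner_commute)
    ultimately show ?thesis
      using B e by (intro exI[of _ "insert e B"]) (auto simp: T_def)
  qed
qed

lemma spd_inner: "spd A \<Longrightarrow> (A *v x) \<bullet> y = x \<bullet> (A *v y)"
  using transpose_matrix_vector[of A x] by (simp add: spd_def dot_lmul_matrix[symmetric])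

lemma spd_invertible: assumes "spd A" shows "invertible A"
proof -
  have "x = 0" if "A *v x = 0" for x
    using assms that unfolding spd_def by (metis inner_zero_right less_irrefl)
  then show ?thesis by (simp add: invertible_left_inverse matrix_left_invertible_ker)
qed

lemma transpose_eqI: "(\<And>x y. (A *v x) \<bullet> y = x \<bullet> (A *v y)) \<Longrightarrow> transpose A = (A :: real ^ 'n ^ 'n)"
  unfolding matrix_eq
proof
  fix x
  assume sym: "\<And>x y. (A *v x) \<bullet> y = x \<bullet> (A *v y)"
  have "(transpose A *v x) \<bullet> y = (A *v x) \<bullet> y" for y by (simp add: dot_lmul_matrix sym)
  then show "transpose A *v x = A *v x" using vector_eq_rdot by blast
qed

lemma spd_sqrt_exists:
  fixes A :: "real ^ 'i ^ 'i"
  assumes A: "spd A"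
  obtains B where "spd B" "B ** B = A"
proof -
  obtain E where E: "finite E" "pairwise orthogonal E" "\<forall>b\<in>E. norm b = 1 \<and> (\<exists>\<mu>. A *v b = \<mu> *\<^sub>R b)" "UNIV \<subseteq> span E"
    using self_adjoint_orthonormal_eigenbasis[OF matrix_vector_mul_linear spd_inner[OF A] subspace_UNIV] by auto
  define l where "l b = b \<bullet> (A *v b)" for b
  have Ab: "A *v b = l b *\<^sub>R b" if "b \<in> E" for b
    using E(3) that by (auto simp: l_def norm_eq_1)
  have lpos: "0 < l b" if "b \<in> E" for b
  proof -
    have "b \<noteq> 0" using E(3) that by fastforce
    then show ?thesis using A unfolding spd_def l_def by blast
  qed
  have ex: "(\<Sum>b\<in>E. (x \<bullet> b) *\<^sub>R b) = x" for x
    using orthonormal_basis_expand[of E x] E by auto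
  \<comment> \<open>The map with the same eigenvectors as A and the square roots of its eigenvalues.\<close>
  define g where "g x = (\<Sum>b\<in>E. (sqrt (l b) * (x \<bullet> b)) *\<^sub>R b)" for x
  have g: "linear g"
    by (rule linearI) (auto simp: g_def inner_add_left algebra_simps sum.distrib scaleR_sum_right)
  have inner_E: "b \<bullet> c = (if b = c then 1 else 0)" if "b \<in> E" "c \<in> E" for b c
    using E(2,3) that by (auto simp: pairwise_def orthogonal_def norm_eq_1)
  have gb: "g x \<bullet> c = sqrt (l c) * (x \<bullet> c)" if "c \<in> E" for x c
    using that E(1) by (simp add: g_def inner_sum_left inner_E if_distrib sum.delta cong: if_cong sum.cong)
  have gg: "g (g x) = A *v x" for x
  proof -
    have "g (g x) = (\<Sum>b\<in>E. (l b * (x \<bullet> b)) *\<^sub>R b)"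
      unfolding g_def[of "g x"] by (intro sum.cong refl) (use lpos in \<open>auto simp: gb less_imp_le\<close>)
    also have "\<dots> = (\<Sum>b\<in>E. A *v ((x \<bullet> b) *\<^sub>R b))"
      by (intro sum.cong refl) (simp add: Ab matrix_vector_mult_scaleR)
    also have "\<dots> = A *v x"
      using linear_sum[OF matrix_vector_mul_linear[of A], of "\<lambda>b. (x \<bullet> b) *\<^sub>R b" E] by (simp add: ex)
    finally show ?thesis .
  qed
  have gi: "x \<bullet> g y = (\<Sum>b\<in>E. sqrt (l b) * (x \<bullet> b) * (y \<bullet> b))" for x y
    by (simp add: g_def inner_sum_right mult_ac)
  have gpos: "0 < x \<bullet> g x" if "x \<noteq> 0" for x
  proof -
    have "\<exists>b\<in>E. x \<bullet> b \<noteq> 0"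
    proof (rule ccontr)
      assume "\<not> ?thesis"
      then have "(\<Sum>b\<in>E. (x \<bullet> b) *\<^sub>R b) = 0" by (intro sum.neutral) auto
      then show False using ex[of x] that by simp
    qed
    then obtain b where b: "b \<in> E" "x \<bullet> b \<noteq> 0" by blast
    have "0 < (x \<bullet> b) * (x \<bullet> b)" using b(2) not_real_square_gt_zero by blast
    then have "0 < sqrt (l b) * (x \<bullet> b) * (x \<bullet> b)"
      using lpos[OF b(1)] unfolding mult.assoc by (intro mult_pos_pos[OF real_sqrt_gt_zero])
    then show ?thesis unfolding gi using b E(1) lpos
      by (intro sum_pos2[of E b]) (auto simp: mult.assoc less_imp_le)
  qed
  have "(matrix g *v x) = g x" for x using g by (simp add: matrix_works)
  then have "transpose (matrix g) = matrix g" "\<forall>x. x \<noteq> 0 \<longrightarrow> 0 < x \<bullet> (matrix g *v x)"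
    using gpos by (auto intro!: transpose_eqI simp: gi inner_commute[of "g _"] mult_ac)
  then have "spd (matrix g)" unfolding spd_def by blast
  moreover have "matrix g ** matrix g = A"
    unfolding matrix_eq using g gg by (simp add: matrix_vector_mul_assoc[symmetric] matrix_works)
  ultimately show thesis by (rule that)
qed

text \<open>If \<open>B\<^sup>2 = C\<^sup>2\<close> then \<open>D = B - C\<close> satisfies \<open>B D + D C = 0\<close>. On an eigenvector \<open>e\<close> of \<open>D\<close> this
  reads \<open>\<mu> (e \<bullet> B e + e \<bullet> C e) = 0\<close>, hence all eigenvalues of \<open>D\<close> vanish.\<close>

lemma spd_sqrt_unique:
  fixes B C :: "real ^ 'i ^ 'i"
  assumes B: "spd B" and C: "spd C" and eq: "B ** B = C ** C"
  shows "B = C"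
proof -
  define D where "D = B - C"
  have sym: "(D *v x) \<bullet> y = x \<bullet> (D *v y)" for x y
    by (simp add: D_def matrix_vector_mult_diff_rdistrib inner_diff_left inner_diff_right
        spd_inner[OF B] spd_inner[OF C])
  have "B *v (B *v x) = C *v (C *v x)" for x using eq by (simp add: matrix_vector_mul_assoc)
  then have BD: "B *v (D *v x) + D *v (C *v x) = 0" for x
    by (simp add: D_def matrix_vector_mult_diff_rdistrib matrix_vector_mult_diff_distrib)
  obtain E where E: "\<forall>b\<in>E. norm b = 1 \<and> (\<exists>\<mu>. D *v b = \<mu> *\<^sub>R b)" "UNIV \<subseteq> span E"
    using self_adjoint_orthonormal_eigenbasis[OF matrix_vector_mul_linear sym subspace_UNIV] by auto
  have "D *v e = 0" if e: "e \<in> E" for e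
  proof -
    obtain \<mu> where \<mu>: "D *v e = \<mu> *\<^sub>R e" using E(1) e by blast
    have "e \<noteq> 0" using E(1) e by fastforce
    then have pos: "0 < e \<bullet> (B *v e)" "0 < e \<bullet> (C *v e)" using B C unfolding spd_def by blast+
    have "e \<bullet> (B *v (D *v e)) + e \<bullet> (D *v (C *v e)) = 0"
      using BD[of e] by (simp add: inner_add_right[symmetric])
    then have "\<mu> * (e \<bullet> (B *v e) + e \<bullet> (C *v e)) = 0"
      by (simp add: sym[symmetric] \<mu> matrix_vector_mult_scaleR distrib_left)
    then have "\<mu> = 0" using pos by auto
    then show ?thesis using \<mu> by simp
  qed
  then have "D *v x = 0" for x
    using linear_eq_0_on_span[OF matrix_vector_mul_linear[of D], of E x] E(2) by blast
  then have "D = 0" by (simp add: matrix_eq)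
  then show ?thesis by (simp add: D_def)
qed

lemma spd_sqrt:
  assumes "spd A" shows "spd (spd_sqrt A)" "spd_sqrt A ** spd_sqrt A = A"
proof -
  obtain B where "spd B" "B ** B = A" using spd_sqrt_exists[OF assms] by blast
  then have "\<exists>!B. spd B \<and> B ** B = A" using spd_sqrt_unique by metis
  then have "spd (spd_sqrt A) \<and> spd_sqrt A ** spd_sqrt A = A"
    unfolding spd_sqrt_def by (rule theI')
  then show "spd (spd_sqrt A)" "spd_sqrt A ** spd_sqrt A = A" by auto
qed

section \<open>The coupling matrices\<close>

lemma alpha_pos: "0 < alpha m"
  by (induction m rule: alpha.induct) (auto intro!: divide_pos_pos mult_pos_pos add_pos_nonneg simp: power2_eq_square algebra_simps)

lemma legendre_coeff:
  "coeff (legendre m) n = pochhammer (real (Suc n)) m * coeff ([:-1, 0, 1:] ^ m) (n + m) / (2 ^ m * fact m)"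
  by (simp add: legendre_def coeff_higher_pderiv)

lemma legendre_base_degree: "degree ([:-1, 0, 1:] ^ m :: real poly) = 2 * m"
  by (simp add: degree_power_eq)

lemma legendre_coeff_high: "m < n \<Longrightarrow> coeff (legendre m) n = 0"
  unfolding legendre_coeff by (simp add: coeff_eq_0 legendre_base_degree)

lemma legendre_lead: "coeff (legendre m) m \<noteq> 0"
proof -
  have "coeff ([:-1, 0, 1:] ^ m :: real poly) (m + m) = lead_coeff ([:-1, 0, 1:] ^ m)"
    unfolding legendre_base_degree by (simp add: mult_2)
  also have "\<dots> = 1" unfolding lead_coeff_power by simp
  finally show ?thesis unfolding legendre_coeff
    by (simp add: pochhammer_eq_0_iff)
qed

lemma weighted_integral_sum:
  fixes u :: "'k::finite \<Rightarrow> real poly"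
  shows "integral {0..1} (\<lambda>x. x * poly (\<Sum>i\<in>UNIV. smult (c i) (u i)) x * poly (\<Sum>i\<in>UNIV. smult (c i) (u i)) x)
    = (\<Sum>i\<in>UNIV. \<Sum>j\<in>UNIV. c i * c j * integral {0..1} (\<lambda>x. x * poly (u i) x * poly (u j) x))"
proof -
  have int: "(\<lambda>x. x * poly v x * poly w x) integrable_on {0..1}" for v w :: "real poly"
    by (intro integrable_continuous_interval continuous_intros)
  have "integral {0..1} (\<lambda>x. x * poly (\<Sum>i\<in>UNIV. smult (c i) (u i)) x * poly (\<Sum>i\<in>UNIV. smult (c i) (u i)) x)
    = integral {0..1} (\<lambda>x. \<Sum>i\<in>UNIV. \<Sum>j\<in>UNIV. c i * c j * (x * poly (u i) x * poly (u j) x))"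
    by (intro integral_cong) (simp add: poly_sum sum_product sum_distrib_left mult_ac)
  also have "\<dots> = (\<Sum>i\<in>UNIV. \<Sum>j\<in>UNIV. c i * c j * integral {0..1} (\<lambda>x. x * poly (u i) x * poly (u j) x))"
    using int by (subst integral_sum; simp add: integral_sum integrable_sum integrable_on_mult_right)
  finally show ?thesis .
qed

lemma weighted_integral_pos:
  fixes p :: "real poly"
  shows "0 \<le> integral {0..1} (\<lambda>x. x * poly p x * poly p x)"
    and "p \<noteq> 0 \<Longrightarrow> 0 < integral {0..1} (\<lambda>x. x * poly p x * poly p x)"
proof -
  have cont: "continuous_on {0..1} (\<lambda>x. x * poly p x * poly p x)" by (intro continuous_intros)
  have nonneg: "0 \<le> x * poly p x * poly p x" if "x \<in> {0..1}" for x
    using that by (simp add: mult.assoc)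
  show ge: "0 \<le> integral {0..1} (\<lambda>x. x * poly p x * poly p x)"
    by (intro integral_nonneg integrable_continuous_interval cont nonneg)
  assume p: "p \<noteq> 0"
  have "integral {0..1} (\<lambda>x. x * poly p x * poly p x) \<noteq> 0"
  proof
    assume "integral {0..1} (\<lambda>x. x * poly p x * poly p x) = 0"
    then have zero: "\<forall>x\<in>{0..1}. x * poly p x * poly p x = 0"
      using integral_eq_0_iff[OF cont _ nonneg] by auto
    have "{0<..1} \<subseteq> {x. poly p x = 0}"
    proof
      fix x :: real assume x: "x \<in> {0<..1}"
      then have "x * poly p x * poly p x = 0" by (intro bspec[OF zero]) auto
      then show "x \<in> {x. poly p x = 0}" using x by simp
    qed
    moreover have "finite {x. poly p x = 0}" using p by (rule poly_roots_finite)
    ultimately have "finite {0<..1::real}" by (rule finite_subset)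
    then show False by (simp add: infinite_Ioc)
  qed
  with ge show "0 < integral {0..1} (\<lambda>x. x * poly p x * poly p x)" by linarith
qed

lemma sum_UNIV_prod: "(\<Sum>r\<in>UNIV. f r) = (\<Sum>i\<in>UNIV. \<Sum>g\<in>UNIV. f (i :: 'n::finite, g :: 'g::finite))"
  by (simp add: sum.cartesian_product)

text \<open>The quadratic form is the sum over the groups of \<open>\<integral> x * (p x)\<^sup>2\<close> over \<open>[0, 1]\<close>, where \<open>p\<close> is the
  Legendre series whose coefficients are the entries of \<open>X\<close> in that group. It is positive because Legendre
  polynomials of different degrees are linearly independent.\<close>

lemma Gamma_mat_spd: "spd (Gamma_mat :: real ^ ('n::{finite,linorder} \<times> 'g::finite) ^ ('n \<times> 'g))"
proof -
  let ?u = "\<lambda>i::'n. smult (alpha (2 * idx i)) (legendre (2 * idx i))"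
  let ?I = "\<lambda>i j::'n. integral {0..1} (\<lambda>x. x * poly (?u i) x * poly (?u j) x)"
  have entry: "(Gamma_mat :: real ^ ('n \<times> 'g) ^ ('n \<times> 'g)) $ (i, g) $ (j, h) = (if g = h then ?I i j else 0)" for i j g h
  proof -
    have "?I i j = integral {0..1} (\<lambda>x. alpha (2 * idx i) * alpha (2 * idx j) *
        (x * poly (legendre (2 * idx i)) x * poly (legendre (2 * idx j)) x))"
      by (intro integral_cong) (simp add: mult_ac)
    then show ?thesis by (simp add: Gamma_mat_def)
  qed
  have sym: "transpose (Gamma_mat :: real ^ ('n \<times> 'g) ^ ('n \<times> 'g)) = Gamma_mat"
  proof -
    have "?I i j = ?I j i" for i j by (intro integral_cong) (simp add: mult_ac)
    then show ?thesis
      by (auto simp: vec_eq_iff transpose_def entry)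
  qed
  have "0 < X \<bullet> (Gamma_mat *v X)" if X: "X \<noteq> 0" for X :: "real ^ ('n \<times> 'g)"
  proof -
    define p where "p g = (\<Sum>i\<in>UNIV. smult (X $ (i, g)) (?u i))" for g
    have "(Gamma_mat *v X) $ (i, g) = (\<Sum>j\<in>UNIV. ?I i j * X $ (j, g))" for i g
    proof -
      have "(Gamma_mat *v X) $ (i, g) = (\<Sum>j\<in>UNIV. \<Sum>h\<in>UNIV. (if g = h then ?I i j else 0) * X $ (j, h))"
        unfolding matrix_vector_mult_def vec_lambda_beta
        by (simp add: sum_UNIV_prod entry)
      also have "\<dots> = (\<Sum>j\<in>UNIV. ?I i j * X $ (j, g))"
        by (intro sum.cong refl) (simp add: if_distrib[of "\<lambda>z. z * _"] sum.delta' cong: if_cong)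
      finally show ?thesis .
    qed
    then have "X \<bullet> (Gamma_mat *v X) = (\<Sum>i\<in>UNIV. \<Sum>g\<in>UNIV. X $ (i, g) * (\<Sum>j\<in>UNIV. ?I i j * X $ (j, g)))"
      unfolding inner_vec_def
      by (simp add: sum_UNIV_prod)
    also have "\<dots> = (\<Sum>g\<in>UNIV. \<Sum>i\<in>UNIV. \<Sum>j\<in>UNIV. X $ (i, g) * X $ (j, g) * ?I i j)"
      by (subst sum.swap) (simp add: sum_distrib_left mult_ac)
    also have "\<dots> = (\<Sum>g\<in>UNIV. integral {0..1} (\<lambda>x. x * poly (p g) x * poly (p g) x))"
      unfolding p_def weighted_integral_sum ..
    also have "\<dots> > 0"
    proof -
      obtain g i1 where "X $ (i1, g) \<noteq> 0" using X by (auto simp: vec_eq_iff)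
      then have ne: "{i. X $ (i, g) \<noteq> 0} \<noteq> {}" by blast
      \<comment> \<open>The leading term of the series comes from the highest moment with a nonzero coefficient.\<close>
      define m where "m = Max (idx ` {i. X $ (i, g) \<noteq> 0})"
      have "m \<in> idx ` {i. X $ (i, g) \<noteq> 0}" unfolding m_def using ne by (intro Max_in) auto
      then obtain i0 where i0: "m = idx i0" "X $ (i0, g) \<noteq> 0" by auto
      have top: "idx i \<le> m" if "X $ (i, g) \<noteq> 0" for i unfolding m_def using that by (intro Max_ge) auto
      have inj: "i = i0" if "idx i = idx i0" for i :: 'n
      proof (rule ccontr)
        assume "i \<noteq> i0"
        then consider "i < i0" | "i0 < i" by (metis linorder_neqE)
        then have "{j. j < i} \<subset> {j. j < i0} \<or> {j. j < i0} \<subset> {j. j < i}"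
          by cases (auto dest: less_trans)
        then have "idx i < idx i0 \<or> idx i0 < idx i" unfolding idx_def by (metis finite psubset_card_mono)
        then show False using that by simp
      qed
      have "coeff (p g) (2 * m) = (\<Sum>i\<in>UNIV. X $ (i, g) * (alpha (2 * idx i) * coeff (legendre (2 * idx i)) (2 * m)))"
        by (simp add: p_def coeff_sum mult.assoc)
      also have "\<dots> = (\<Sum>i\<in>UNIV. if i = i0 then X $ (i, g) * (alpha (2 * m) * coeff (legendre (2 * m)) (2 * m)) else 0)"
      proof (intro sum.cong refl)
        fix i
        show "X $ (i, g) * (alpha (2 * idx i) * coeff (legendre (2 * idx i)) (2 * m)) =
          (if i = i0 then X $ (i, g) * (alpha (2 * m) * coeff (legendre (2 * m)) (2 * m)) else 0)"
        proof (cases "i = i0 \<or> X $ (i, g) = 0")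
          case False
          then have "idx i < m" using top[of i] inj[of i] i0 by force
          then show ?thesis using False by (simp add: legendre_coeff_high)
        qed (auto simp: i0)
      qed
      also have "\<dots> \<noteq> 0" using i0(2) alpha_pos[of "2 * m"] legendre_lead[of "2 * m"] by simp
      finally have "p g \<noteq> 0" by auto
      then show ?thesis
        by (intro sum_pos2[of UNIV g] weighted_integral_pos) auto
    qed
    finally show ?thesis .
  qed
  with sym show ?thesis unfolding spd_def by blast
qed

text \<open>The transposed matrix is lower triangular with unit diagonal in the order of the moments.\<close>

lemma H_mat_transpose_injective:
  fixes X :: "real ^ ('n::{finite,linorder} \<times> 'g::finite)"
  assumes "transpose H_mat *v X = 0"
  shows "X = 0"
proof -
  have "X $ c = 0" for c
  proof (induction "idx (fst c)" arbitrary: c rule: less_induct)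
    case less
    have "(transpose H_mat *v X) $ c = (\<Sum>r\<in>UNIV. H_mat $ r $ c * X $ r)"
      by (simp add: matrix_vector_mult_def transpose_def)
    also have "\<dots> = (\<Sum>r\<in>UNIV. if r = c then X $ r else 0)"
    proof (intro sum.cong refl)
      fix r :: "'n \<times> 'g"
      show "H_mat $ r $ c * X $ r = (if r = c then X $ r else 0)"
        using less[of r] by (auto simp: H_mat_def prod_eq_iff)
    qed
    also have "\<dots> = X $ c" by simp
    finally show ?case using assms by simp
  qed
  then show ?thesis by (simp add: vec_eq_iff)
qed

lemma matrix_inv_right: "invertible A \<Longrightarrow> A ** matrix_inv A = mat 1"
  unfolding invertible_def matrix_inv_def by (rule someI2_ex) auto

lemma Gamma_tilde_spd: "spd (Gamma_tilde :: real ^ ('n::{finite,linorder} \<times> 'g::finite) ^ ('n \<times> 'g))"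
proof -
  let ?G = "Gamma_mat :: real ^ ('n \<times> 'g) ^ ('n \<times> 'g)" and ?H = "H_mat :: real ^ ('n \<times> 'g) ^ ('n \<times> 'g)"
  have inv: "invertible ?G" by (rule spd_invertible[OF Gamma_mat_spd])
  have GG: "?G *v (matrix_inv ?G *v y) = y" for y
    using matrix_inv_right[OF inv] by (simp add: matrix_vector_mul_assoc)
  have adj: "X \<bullet> (?H *v Y) = (transpose ?H *v X) \<bullet> Y" for X Y
    by (simp add: dot_lmul_matrix)
  have tilde: "Gamma_tilde *v X = ?H *v (matrix_inv ?G *v (transpose ?H *v X))" for X
    by (simp add: Gamma_tilde_def matrix_vector_mul_assoc matrix_mul_assoc del: transpose_matrix_vector)
  have isym: "(matrix_inv ?G *v x) \<bullet> y = x \<bullet> (matrix_inv ?G *v y)" for x y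
    using spd_inner[OF Gamma_mat_spd, of "matrix_inv ?G *v x" "matrix_inv ?G *v y"] by (simp add: GG)
  have form: "X \<bullet> (Gamma_tilde *v Y) = (transpose ?H *v X) \<bullet> (matrix_inv ?G *v (transpose ?H *v Y))" for X Y
    unfolding tilde by (rule adj)
  have "transpose (Gamma_tilde :: real ^ ('n \<times> 'g) ^ ('n \<times> 'g)) = Gamma_tilde"
  proof (rule transpose_eqI)
    fix x y :: "real ^ ('n \<times> 'g)"
    show "(Gamma_tilde *v x) \<bullet> y = x \<bullet> (Gamma_tilde *v y)"
      unfolding form inner_commute[of "Gamma_tilde *v x"] by (subst isym[symmetric]) (rule inner_commute)
  qed
  moreover have "0 < X \<bullet> (Gamma_tilde *v X)" if X: "X \<noteq> 0" for X :: "real ^ ('n \<times> 'g)"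
  proof -
    define z where "z = matrix_inv ?G *v (transpose ?H *v X)"
    have Gz: "?G *v z = transpose ?H *v X" unfolding z_def by (rule GG)
    have "transpose ?H *v X \<noteq> 0" using H_mat_transpose_injective X by blast
    then have "z \<noteq> 0" using Gz by (metis matrix_vector_mult_0_right)
    then have "0 < z \<bullet> (?G *v z)" using Gamma_mat_spd unfolding spd_def by blast
    moreover have "X \<bullet> (Gamma_tilde *v X) = (transpose ?H *v X) \<bullet> z" unfolding form z_def ..
    ultimately show ?thesis unfolding Gz[symmetric] by (simp only: inner_commute)
  qed
  ultimately show ?thesis unfolding spd_def by blast
qed

section \<open>Geometry of the mesh\<close>

text \<open>Simplices and cuboids share all the properties that matter below as full-dimensional polytopes.\<close>

definition element :: "'a::euclidean_space set \<Rightarrow> bool" where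
  "element K \<longleftrightarrow> polytope K \<and> interior K \<noteq> {}"

lemma element_props:
  fixes K :: "'a::euclidean_space set"
  assumes "element K"
  shows "convex K" "compact K" "closed K" "bounded K" "interior K \<noteq> {}" "K \<noteq> {}" "closure (interior K) = K"
    "aff_dim K = DIM('a)" "negligible (frontier K)"
proof -
  show c: "convex K" "compact K" and i: "interior K \<noteq> {}"
    using assms by (auto simp: element_def polytope_imp_convex polytope_imp_compact)
  then show "closed K" "bounded K" by (auto simp: compact_imp_closed compact_imp_bounded)
  then show "closure (interior K) = K" using convex_closure_interior[OF c(1) i] by simp
  show "K \<noteq> {}" using i interior_subset by blast
  show "aff_dim K = DIM('a)" using i by (rule aff_dim_nonempty_interior)
  show "negligible (frontier K)" using c(1) by (rule negligible_convex_frontier)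
qed

lemma mesh_elements:
  fixes \<T> :: "'a::euclidean_space set set"
  assumes "mesh \<Omega> \<Gamma>D \<Gamma>V \<Gamma>N \<T>" "K \<in> \<T>"
  shows "element K"
proof -
  consider "int DIM('a) simplex K" | "cuboid K" using assms unfolding mesh_def by blast
  then show ?thesis
  proof cases
    case 1
    then have "aff_dim K = int DIM('a)" by (simp add: aff_dim_simplex)
    moreover have "convex K" using 1 simplex_imp_polytope polytope_imp_convex by blast
    ultimately have "interior K \<noteq> {}"
      using interior_rel_interior_gen[of K] rel_interior_eq_empty[of K] by force
    then show ?thesis using 1 simplex_imp_polytope by (auto simp: element_def)
  next
    case 2
    then obtain f :: "'a \<Rightarrow> 'a" and a b where f: "orthogonal_transformation f" "box a b \<noteq> {}" "K = f ` cbox a b"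
      unfolding cuboid_def by blast
    have lin: "linear f" "inj f" using f(1) orthogonal_transformation_linear orthogonal_transformation_inj by blast+
    have "interior K = f ` interior (cbox a b)"
      unfolding f(3) using lin by (rule interior_injective_linear_image)
    then have "interior K \<noteq> {}" using f(2) by (simp add: interior_cbox)
    moreover have "polytope K" unfolding f(3)
      using lin(1) by (intro polytope_linear_image polytope_interval)
    ultimately show ?thesis by (simp add: element_def)
  qed
qed

text \<open>Locally the boundary is a Lipschitz graph over the hyperplane orthogonal to some direction \<open>e\<close>. A graph
  has only one point on each line in direction \<open>e\<close>, so \<open>e\<close> is transversal to a flat piece of the
  boundary. Near \<open>x\<close>, sliding along \<open>e\<close> reaches that piece, which thus is the graph.\<close>

lemma lipschitz_domain_flat:
  fixes \<Omega> :: "'a::euclidean_space set"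
  assumes L: "lipschitz_boundary \<Omega>" and x: "x \<in> frontier \<Omega>" and n: "n \<noteq> 0" "n \<bullet> x = b"
    and r: "0 < r" and flat: "ball x r \<inter> {y. n \<bullet> y = b} \<subseteq> frontier \<Omega>" and op: "open \<Omega>"
  shows "\<exists>\<rho> n' b'. 0 < \<rho> \<and> n' \<noteq> 0 \<and> {y. n' \<bullet> y = b'} = {y. n \<bullet> y = b} \<and>
    \<Omega> \<inter> ball x \<rho> = {y \<in> ball x \<rho>. n' \<bullet> y < b'}"
proof -
  obtain s e \<gamma> C where s: "0 < s" "norm e = 1" and \<gamma>: "C-lipschitz_on UNIV (\<gamma> :: 'a \<Rightarrow> real)"
    and G: "\<Omega> \<inter> ball x s = {y \<in> ball x s. \<gamma> (y - (y \<bullet> e) *\<^sub>R e) < y \<bullet> e}"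
    using L x unfolding lipschitz_boundary_def by meson
  have cont: "continuous_on UNIV \<gamma>" using \<gamma> by (rule lipschitz_on_continuous_on)
  have ee: "e \<bullet> e = 1" using s(2) by (simp add: norm_eq_1)
  define \<pi> where "\<pi> y = y - (y \<bullet> e) *\<^sub>R e" for y
  have \<pi>_shift: "\<pi> (y + t *\<^sub>R e) = \<pi> y" for y t
    by (simp add: \<pi>_def inner_add_left ee algebra_simps)
  have in_\<Omega>: "y \<in> \<Omega> \<longleftrightarrow> \<gamma> (\<pi> y) < y \<bullet> e" if "y \<in> ball x s" for y
    using G that unfolding \<pi>_def by blast
  have graph: "\<gamma> (\<pi> y) = y \<bullet> e" if y: "y \<in> frontier \<Omega>" "y \<in> ball x s" for y
  proof (rule antisym)
    have "y \<notin> \<Omega>" using y(1) op by (simp add: frontier_def interior_open)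
    then show "y \<bullet> e \<le> \<gamma> (\<pi> y)" using in_\<Omega>[OF y(2)] by simp
    show "\<gamma> (\<pi> y) \<le> y \<bullet> e"
    proof (rule ccontr)
      assume "\<not> ?thesis"
      then have lt: "y \<bullet> e < \<gamma> (\<pi> y)" by simp
      have "continuous_on UNIV (\<lambda>z. z \<bullet> e)" "continuous_on UNIV (\<lambda>z. \<gamma> (\<pi> z))"
        unfolding \<pi>_def by (intro continuous_intros continuous_on_compose2[OF cont]; auto)+
      then have o: "open {z. z \<bullet> e < \<gamma> (\<pi> z)}" by (rule open_Collect_less)
      have "open (ball x s \<inter> {z. z \<bullet> e < \<gamma> (\<pi> z)})" using o by (intro open_Int) auto
      moreover have "y \<in> ball x s \<inter> {z. z \<bullet> e < \<gamma> (\<pi> z)}" using lt y(2) by simp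
      moreover have "y \<in> closure \<Omega>" using y(1) by (simp add: frontier_def)
      ultimately have "\<Omega> \<inter> (ball x s \<inter> {z. z \<bullet> e < \<gamma> (\<pi> z)}) \<noteq> {}"
        using open_Int_closure_eq_empty by blast
      then show False using in_\<Omega> by fastforce
    qed
  qed
  have ne: "n \<bullet> e \<noteq> 0"
  proof
    assume z: "n \<bullet> e = 0"
    define t where "t = min r s / 2"
    have t: "0 < t" "t < r" "t < s" using r s by (auto simp: t_def)
    have "x + t *\<^sub>R e \<in> ball x r \<inter> {y. n \<bullet> y = b}" using t n(2) z s(2) by (simp add: dist_norm inner_add_right)
    then have "x + t *\<^sub>R e \<in> frontier \<Omega>" using flat by blast
    moreover have "x + t *\<^sub>R e \<in> ball x s" using t s(2) by (simp add: dist_norm)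
    ultimately have "\<gamma> (\<pi> x) = (x + t *\<^sub>R e) \<bullet> e" using graph \<pi>_shift by metis
    moreover have "\<gamma> (\<pi> x) = x \<bullet> e" using graph x s(1) by simp
    ultimately show False using t(1) ee by (simp add: inner_add_left)
  qed
  define m where "m = n /\<^sub>R (n \<bullet> e)"
  define c where "c = b / (n \<bullet> e)"
  have m: "m \<bullet> e = 1" "m \<bullet> x = c" using ne n(2) by (simp_all add: m_def c_def divide_inverse)
  have hyp: "m \<bullet> y = c \<longleftrightarrow> n \<bullet> y = b" for y using ne by (simp add: m_def c_def field_simps)
  \<comment> \<open>Small enough that a point within this distance of x stays in both balls when it slides along e to the hyperplane.\<close>
  define \<rho> where "\<rho> = min r s / (2 + norm m)"
  have \<rho>: "0 < \<rho>" using r s(1) by (simp add: \<rho>_def add_pos_nonneg)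
  have small: "\<rho> + norm m * \<rho> < min r s"
  proof -
    have "\<rho> * (2 + norm m) = min r s" by (simp add: \<rho>_def add_pos_nonneg add_nonneg_eq_0_iff)
    then have "2 * \<rho> + norm m * \<rho> = min r s" by (simp add: algebra_simps)
    then show ?thesis using \<rho> by linarith
  qed
  have "\<Omega> \<inter> ball x \<rho> = {y \<in> ball x \<rho>. (- m) \<bullet> y < - c}"
  proof -
    have "y \<in> \<Omega> \<longleftrightarrow> c < m \<bullet> y" if y: "y \<in> ball x \<rho>" for y
    proof -
      define t where "t = c - m \<bullet> y"
      have "\<bar>t\<bar> \<le> norm m * dist x y"
        using Cauchy_Schwarz_ineq2[of m "x - y"] m(2) by (simp add: t_def inner_diff_right dist_norm)
      also have "\<dots> \<le> norm m * \<rho>" using y by (intro mult_left_mono) auto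
      finally have t: "\<bar>t\<bar> \<le> norm m * \<rho>" .
      have "dist x (y + t *\<^sub>R e) \<le> dist x y + \<bar>t\<bar>"
        using dist_triangle[of x "y + t *\<^sub>R e" y] s(2) by (simp add: dist_norm)
      also have "\<dots> < min r s" using small t y by simp
      finally have d: "y + t *\<^sub>R e \<in> ball x r" "y + t *\<^sub>R e \<in> ball x s" by auto
      have "m \<bullet> (y + t *\<^sub>R e) = c" using m(1) by (simp add: inner_add_right t_def)
      then have "y + t *\<^sub>R e \<in> frontier \<Omega>" using flat d(1) hyp by blast
      then have "\<gamma> (\<pi> y) = (y + t *\<^sub>R e) \<bullet> e" using graph d(2) \<pi>_shift by metis
      then have "\<gamma> (\<pi> y) = y \<bullet> e + t" using ee by (simp add: inner_add_left)
      moreover have "0 \<le> norm m * \<rho>" using \<rho> by simp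
      then have "y \<in> ball x s" using y small by simp
      ultimately show ?thesis using in_\<Omega> by (auto simp: t_def)
    qed
    then show ?thesis by auto
  qed
  moreover have "- m \<noteq> 0" using m(1) by auto
  moreover have "{y. (- m) \<bullet> y = - c} = {y. n \<bullet> y = b}" using hyp by simp
  ultimately show ?thesis using \<rho> by blast
qed

lemma facet_props:
  assumes K: "element K" and F: "F facet_of K"
  shows "polytope F" "compact F" "closed F" "convex F" "bounded F" "F \<noteq> {}" "F \<subseteq> frontier K"
    "aff_dim F = int DIM('a) - 1" "(F :: 'a::euclidean_space set) \<subseteq> K"
proof -
  have face: "F face_of K" "F \<noteq> {}" and dim: "aff_dim F = aff_dim K - 1" using F by (auto simp: facet_of_def)
  show poly: "polytope F" using K face(1) face_of_polytope_polytope by (auto simp: element_def)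
  then show "compact F" "closed F" "convex F" "bounded F"
    by (auto simp: polytope_imp_compact polytope_imp_closed polytope_imp_convex polytope_imp_bounded)
  show "F \<noteq> {}" by (rule face(2))
  show "aff_dim F = int DIM('a) - 1" using dim element_props(8)[OF K] by simp
  show sub: "F \<subseteq> K" using face(1) by (rule face_of_imp_subset)
  have "F \<noteq> K" using dim by auto
  then have "F \<inter> interior K = {}" using face(1) by (intro face_of_disjoint_interior)
  then show "F \<subseteq> frontier K" using sub closure_subset[of K] by (auto simp: frontier_def)
qed

text \<open>Both elements lie in the half space on the side of \<open>\<Omega>\<close>, with interior points \<open>z\<close> and \<open>z'\<close> strictly
  inside it. Moving from \<open>x\<close> slightly towards \<open>z'\<close> gives an interior point of \<open>K'\<close>; after a small tangential
  shift from \<open>x\<close> to another point \<open>f\<close> of the facet, the same point lies on the way from \<open>f\<close> to \<open>z\<close>, so it is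
  interior to \<open>K\<close> as well.\<close>

lemma boundary_facet_unique_element:
  fixes \<Omega> :: "'a::euclidean_space set"
  assumes \<Omega>: "open \<Omega>" "lipschitz_boundary \<Omega>"
    and K: "element K" "K \<subseteq> closure \<Omega>" and F: "F facet_of K" "F \<subseteq> frontier \<Omega>" and x: "x \<in> rel_interior F"
    and K': "element K'" "K' \<subseteq> closure \<Omega>" "x \<in> K'"
  shows "interior K \<inter> interior K' \<noteq> {}"
proof -
  have q: "norm v / (norm v + 1) \<le> 1" for v :: 'a
    using norm_ge_zero[of v] by (intro divide_le_eq_1_pos[THEN iffD2]) linarith+
  have "aff_dim F = int DIM('a) - 1" using facet_props(8)[OF K(1) F(1)] .
  then obtain n b where n: "n \<noteq> 0" "affine hull F = {y. n \<bullet> y = b}"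
    using aff_dim_eq_hyperplane[of F] by auto
  obtain r where r: "0 < r" "ball x r \<inter> affine hull F \<subseteq> F" and xF: "x \<in> F"
    using x by (auto simp: mem_rel_interior_ball)
  have nx: "n \<bullet> x = b" using n(2) hull_inc[OF xF, of affine] by auto
  have xfr: "x \<in> frontier \<Omega>" using xF F(2) by auto
  have flat: "ball x r \<inter> {y. n \<bullet> y = b} \<subseteq> frontier \<Omega>" using r(2) n(2) F(2) by auto
  obtain \<rho> n' b' where "0 < \<rho> \<and> n' \<noteq> 0 \<and> {y. n' \<bullet> y = b'} = {y. n \<bullet> y = b} \<and>
      \<Omega> \<inter> ball x \<rho> = {y \<in> ball x \<rho>. n' \<bullet> y < b'}"
    using lipschitz_domain_flat[OF \<Omega>(2) xfr n(1) nx r(1) flat \<Omega>(1)] by (elim exE)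
  then have \<rho>: "0 < \<rho>" and n': "n' \<noteq> 0" and hyp: "{y. n' \<bullet> y = b'} = {y. n \<bullet> y = b}"
    and half: "\<Omega> \<inter> ball x \<rho> = {y \<in> ball x \<rho>. n' \<bullet> y < b'}" by auto
  have n'x: "n' \<bullet> x = b'" using hyp nx by blast
  have side: "n' \<bullet> y \<le> b'" if y: "y \<in> closure \<Omega>" "y \<in> ball x \<rho>" for y
  proof (rule ccontr)
    assume "\<not> ?thesis"
    then have "y \<in> (ball x \<rho> \<inter> {y. b' < n' \<bullet> y}) \<inter> closure \<Omega>" using y by simp
    moreover have "open (ball x \<rho> \<inter> {y. b' < n' \<bullet> y})"
      by (intro open_Int open_ball open_halfspace_gt)
    ultimately have "(ball x \<rho> \<inter> {y. b' < n' \<bullet> y}) \<inter> \<Omega> \<noteq> {}" using open_Int_closure_eq_empty by blast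
    then show False using half by force
  qed
  have below: "n' \<bullet> z < b'" if M: "element M" "M \<subseteq> closure \<Omega>" "x \<in> M" and z: "z \<in> interior M" for M z
  proof -
    define t where "t = min 1 (\<rho> / (2 * (norm (x - z) + 1)))"
    have t: "0 < t" "t \<le> 1" using \<rho> by (auto simp: t_def add_nonneg_pos)
    have "t * norm (x - z) \<le> \<rho> / (2 * (norm (x - z) + 1)) * norm (x - z)"
      by (intro mult_right_mono) (auto simp: t_def)
    also have "\<dots> = \<rho> / 2 * (norm (x - z) / (norm (x - z) + 1))" by simp
    also have "\<dots> \<le> \<rho> / 2 * 1" using \<rho> by (intro mult_left_mono q) auto
    also have "\<dots> < \<rho>" using \<rho> by simp
    finally have d: "x - t *\<^sub>R (x - z) \<in> ball x \<rho>" using t by (simp add: dist_norm)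
    have i: "x - t *\<^sub>R (x - z) \<in> interior M"
      by (rule mem_interior_convex_shrink[OF element_props(1)[OF M(1)] z M(3) t])
    have "interior M \<inter> ball x \<rho> \<subseteq> {y. n' \<bullet> y \<le> b'}" using side M(2) interior_subset by blast
    then have "interior M \<inter> ball x \<rho> \<subseteq> interior {y. n' \<bullet> y \<le> b'}" by (intro interior_maximal open_Int) auto
    then have "n' \<bullet> (x - t *\<^sub>R (x - z)) < b'" using i d n' by auto
    then have "t * (n' \<bullet> z) < t * b'" using n'x by (simp add: inner_diff_right algebra_simps)
    then show ?thesis using t(1) by simp
  qed
  have xK: "x \<in> K" using xF facet_props(9)[OF K(1) F(1)] by blast
  obtain z z' where z: "z \<in> interior K" and z': "z' \<in> interior K'"
    using element_props(5)[OF K(1)] element_props(5)[OF K'(1)] by blast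
  have s: "n' \<bullet> z < b'" "n' \<bullet> z' < b'" using below[OF K xK z] below[OF K' z'] by auto
  \<comment> \<open>The ratio of the depths of z' and z below the hyperplane; it makes the difference h tangential.\<close>
  define l where "l = (b' - n' \<bullet> z') / (b' - n' \<bullet> z)"
  define h where "h = (z' - x) - l *\<^sub>R (z - x)"
  have l: "0 < l" using s by (simp add: l_def)
  have "l * (b' - n' \<bullet> z) = b' - n' \<bullet> z'" using s by (simp add: l_def)
  moreover have "n' \<bullet> h = (n' \<bullet> z' - b') + l * (b' - n' \<bullet> z)"
    unfolding h_def inner_diff_right inner_scaleR_right n'x by (simp add: right_diff_distrib)
  ultimately have nh: "n' \<bullet> h = 0" by simp
  define M where "M = r / (2 * (norm h + 1))"
  have "0 < M" using r(1) by (simp add: M_def add_nonneg_pos)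
  define t where "t = min 1 (min (1 / (2 * l)) (M / 2))"
  have t: "0 < t" "t \<le> 1" using l \<open>0 < M\<close> by (auto simp: t_def)
  have "t * l \<le> 1 / (2 * l) * l" using l by (intro mult_right_mono) (auto simp: t_def)
  then have tl: "0 < t * l" "t * l \<le> 1 / 2" using t l by auto
  define f where "f = x + (t / (1 - t * l)) *\<^sub>R h"
  have "f \<in> F"
  proof -
    have "t / (1 - t * l) \<le> t / (1 / 2)" using tl t by (intro divide_left_mono) auto
    then have "t / (1 - t * l) * norm h \<le> 2 * t * norm h" by (intro mult_right_mono) auto
    also have "\<dots> \<le> 2 * (M / 2) * norm h" by (intro mult_right_mono mult_left_mono) (auto simp: t_def)
    also have "\<dots> = M * norm h" by simp
    also have "\<dots> = r / 2 * (norm h / (norm h + 1))" by (simp add: M_def)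
    also have "\<dots> \<le> r / 2 * 1" using r(1) by (intro mult_left_mono q) auto
    also have "\<dots> < r" using r(1) by simp
    finally have "f \<in> ball x r" using tl t by (simp add: f_def dist_norm)
    moreover have "n' \<bullet> f = b'" using nh n'x by (simp add: f_def inner_add_right)
    ultimately show ?thesis using r(2) n(2) hyp by blast
  qed
  then have fK: "f \<in> K" using facet_props(9)[OF K(1) F(1)] by blast
  have "f - (t * l) *\<^sub>R (f - z) \<in> interior K"
    using tl by (intro mem_interior_convex_shrink[OF element_props(1)[OF K(1)] z fK]) auto
  moreover have "f - (t * l) *\<^sub>R (f - z) = x - t *\<^sub>R (x - z')"
  proof -
    have "f - (t * l) *\<^sub>R (f - z) = (1 - t * l) *\<^sub>R f + (t * l) *\<^sub>R z" by (simp add: algebra_simps)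
    also have "(1 - t * l) *\<^sub>R f = (1 - t * l) *\<^sub>R x + t *\<^sub>R h"
      using tl by (simp add: f_def scaleR_right_distrib)
    also have "(1 - t * l) *\<^sub>R x + t *\<^sub>R h + (t * l) *\<^sub>R z = x - t *\<^sub>R (x - z')"
      by (simp add: h_def algebra_simps)
    finally show ?thesis .
  qed
  moreover have "x - t *\<^sub>R (x - z') \<in> interior K'"
    by (rule mem_interior_convex_shrink[OF element_props(1)[OF K'(1)] z' K'(3) t])
  ultimately show ?thesis by auto
qed

locale lipschitz_mesh =
  fixes \<Omega> \<Gamma>D \<Gamma>V \<Gamma>N :: "'a::euclidean_space set" and \<T> :: "'a set set"
  assumes dim: "2 \<le> DIM('a)"
    and domain: "regular_domain \<Omega>"
    and boundary: "boundary_partition \<Omega> \<Gamma>D \<Gamma>V \<Gamma>N"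
    and mesh: "mesh \<Omega> \<Gamma>D \<Gamma>V \<Gamma>N \<T>"
begin

lemma domain_props: "open \<Omega>" "lipschitz_boundary \<Omega>" "bounded \<Omega>" "\<Omega> \<noteq> {}"
  using domain by (auto simp: regular_domain_def)

lemma mesh_props: "finite \<T>" "\<Union>\<T> = closure \<Omega>" "pairwise (\<lambda>K K'. interior K \<inter> interior K' = {}) \<T>"
  "\<Union>(boundary_facets \<Omega> \<T>) = frontier \<Omega>"
  using mesh by (auto simp: mesh_def)

lemma mesh_element: "K \<in> \<T> \<Longrightarrow> element K" "K \<in> \<T> \<Longrightarrow> K \<subseteq> closure \<Omega>"
  using mesh_elements[OF mesh] mesh_props(2) by auto

lemma boundary_facet_element_unique:
  assumes F: "F \<subseteq> frontier \<Omega>" "F facet_of K" "K \<in> \<T>" and K': "K' \<in> \<T>" "x \<in> rel_interior F" "x \<in> K'"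
  shows "K' = K"
proof (rule ccontr)
  assume "K' \<noteq> K"
  then have "interior K \<inter> interior K' = {}" using mesh_props(3) F(3) K'(1) by (auto simp: pairwise_def)
  moreover have "interior K \<inter> interior K' \<noteq> {}"
    using boundary_facet_unique_element[OF domain_props(1,2) mesh_element[OF F(3)] F(2,1) K'(2) mesh_element[OF K'(1)] K'(3)] .
  ultimately show False by simp
qed

text \<open>Removing all other elements leaves an open set that sees only \<open>K\<close> inside \<open>\<Omega>\<close>; by uniqueness of the touching
  element it still contains the relative interior of the facet. Normal traces on the facet are localised on
  this set.\<close>

lemma boundary_facet_neighbourhood:
  assumes F: "F \<subseteq> frontier \<Omega>" "F facet_of K" "K \<in> \<T>"
  shows "open (- \<Union>(\<T> - {K}))" "rel_interior F \<subseteq> - \<Union>(\<T> - {K})" "\<Omega> \<inter> - \<Union>(\<T> - {K}) \<subseteq> K"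
proof -
  have "closed (\<Union>(\<T> - {K}))"
    using mesh_props(1) mesh_element(1) element_props(3) by (intro closed_Union) auto
  then show "open (- \<Union>(\<T> - {K}))" by (rule open_Compl)
  show "rel_interior F \<subseteq> - \<Union>(\<T> - {K})" using boundary_facet_element_unique[OF F] by blast
  show "\<Omega> \<inter> - \<Union>(\<T> - {K}) \<subseteq> K" using mesh_props(2) closure_subset[of \<Omega>] by blast
qed

text \<open>The definite description in \<open>elem_of_facet\<close> is proper because all elements whose frontier contains \<open>F\<close>
  touch a common relative interior point of \<open>F\<close>.\<close>

lemma boundary_facetE:
  assumes "F \<in> boundary_facets \<Omega> \<T>"
  shows "elem_of_facet \<T> F \<in> \<T>" "F facet_of elem_of_facet \<T> F" "F \<subseteq> frontier \<Omega>"
proof -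
  obtain K where K: "K \<in> \<T>" "F facet_of K" and F: "F \<subseteq> frontier \<Omega>" using assms by (auto simp: boundary_facets_def)
  note p = facet_props[OF mesh_element(1)[OF K(1)] K(2)]
  obtain x where x: "x \<in> rel_interior F" using p(4,6) rel_interior_eq_empty by blast
  have "elem_of_facet \<T> F = K"
    unfolding elem_of_facet_def
  proof (rule the_equality)
    show "K \<in> \<T> \<and> F \<subseteq> frontier K" using K p(7) by simp
    fix K' assume K': "K' \<in> \<T> \<and> F \<subseteq> frontier K'"
    then have "x \<in> K'"
      using x rel_interior_subset[of F] frontier_subset_closed[OF element_props(3)[OF mesh_element(1)]] by blast
    then show "K' = K" using boundary_facet_element_unique[OF F K(2,1)] K' x by blast
  qed
  then show "elem_of_facet \<T> F \<in> \<T>" "F facet_of elem_of_facet \<T> F" "F \<subseteq> frontier \<Omega>" using K F by auto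
qed

lemma facet_element: "F \<in> boundary_facets \<Omega> \<T> \<Longrightarrow> element (elem_of_facet \<T> F)"
  using boundary_facetE(1) mesh_element(1) by blast

lemma finite_boundary_facets: "finite (boundary_facets \<Omega> \<T>)"
proof (rule finite_subset)
  show "boundary_facets \<Omega> \<T> \<subseteq> (\<Union>K\<in>\<T>. {F. F facet_of K})" by (auto simp: boundary_facets_def)
  show "finite (\<Union>K\<in>\<T>. {F. F facet_of K})"
    using mesh_props(1) mesh_element(1) by (intro finite_UN_I finite_polytope_facets) (auto simp: element_def)
qed

text \<open>An interior point of the element has a positive distance from the supporting hyperplane of the facet.\<close>

lemma altitude_pos:
  assumes "F \<in> boundary_facets \<Omega> \<T>"
  shows "0 < altitude (elem_of_facet \<T> F) F"
proof -
  let ?K = "elem_of_facet \<T> F"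
  note p = facet_props[OF facet_element boundary_facetE(2)] and e = element_props[OF facet_element]
  obtain z where z: "z \<in> interior ?K" using e(5)[OF assms] by blast
  then have zK: "z \<in> ?K" using interior_subset by blast
  have "z \<notin> affine hull F"
  proof
    assume "z \<in> affine hull F"
    moreover have "affine hull F \<inter> ?K = F"
      using face_of_imp_eq_affine_Int[OF e(1)[OF assms] facet_of_imp_face_of[OF boundary_facetE(2)[OF assms]]] by simp
    ultimately have "z \<in> frontier ?K" using zK p(7)[OF assms assms] by blast
    then show False using z by (simp add: frontier_def)
  qed
  then have "0 < infdist z (affine hull F)"
    using p(6)[OF assms assms] closed_affine_hull[of F] infdist_pos_not_in_closed by (metis affine_hull_eq_empty)
  also have "infdist z (affine hull F) \<le> altitude ?K F"
    unfolding altitude_def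
  proof (rule cSUP_upper[OF zK])
    have "compact ((\<lambda>x. infdist x (affine hull F)) ` ?K)"
      by (intro compact_continuous_image continuous_intros e(2)[OF assms])
    then show "bdd_above ((\<lambda>x. infdist x (affine hull F)) ` ?K)" by (intro bounded_imp_bdd_above compact_imp_bounded)
  qed
  finally show ?thesis .
qed

end

lemma hausdorff_outer_null_local:
  fixes A :: "'a::euclidean_space set"
  assumes "\<And>x. x \<in> A \<Longrightarrow> \<exists>W. open W \<and> x \<in> W \<and> hausdorff_outer s (W \<inter> A) = 0"
  shows "hausdorff_outer s A = 0"
proof -
  define \<F> where "\<F> = {W. open W \<and> hausdorff_outer s (W \<inter> A) = 0}"
  obtain \<F>' where \<F>': "\<F>' \<subseteq> \<F>" "countable \<F>'" "\<Union>\<F>' = \<Union>\<F>"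
    by (rule Lindelof[of \<F>]) (auto simp: \<F>_def)
  have "W \<inter> A \<in> null_sets (hausdorff_measure s)" if "W \<in> \<F>'" for W
    using \<F>'(1) that by (auto simp: null_sets_hausdorff \<F>_def)
  then have "(\<Union>W\<in>\<F>'. W \<inter> A) \<in> null_sets (hausdorff_measure s)"
    using \<F>'(2) by (intro null_sets_UN')
  moreover have "A = (\<Union>W\<in>\<F>'. W \<inter> A)"
  proof -
    have "A \<subseteq> \<Union>\<F>" using assms unfolding \<F>_def by blast
    then show ?thesis using \<F>'(3) by blast
  qed
  ultimately show ?thesis by (simp add: null_sets_hausdorff)
qed

lemma dim_orthogonal_pair:
  fixes e1 e2 :: "'a::euclidean_space"
  assumes "norm e1 = 1" "norm e2 = 1" "e1 \<bullet> e2 = 0"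
  shows "subspace {y. y \<bullet> e1 = 0 \<and> y \<bullet> e2 = 0}" "dim {y. y \<bullet> e1 = 0 \<and> y \<bullet> e2 = 0} + 2 \<le> DIM('a)"
proof -
  show "subspace {y. y \<bullet> e1 = 0 \<and> y \<bullet> e2 = 0}" by (auto simp: subspace_def inner_add_left)
  have ne: "e1 \<noteq> e2" "e1 \<noteq> 0" "e2 \<noteq> 0" using assms by auto
  have "pairwise orthogonal {e1, e2}" using assms by (auto simp: pairwise_insert orthogonal_def inner_commute)
  then have "independent {e1, e2}" using ne by (intro pairwise_orthogonal_independent) auto
  then have "dim {e1, e2} = 2" using ne by (simp add: dim_eq_card_independent)
  moreover have "dim ({y. y \<bullet> e1 = 0 \<and> y \<bullet> e2 = 0} \<union> {e1, e2}) = dim {y. y \<bullet> e1 = 0 \<and> y \<bullet> e2 = 0} + dim {e1, e2}"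
    by (rule dim_orthogonal_sum) auto
  ultimately show "dim {y. y \<bullet> e1 = 0 \<and> y \<bullet> e2 = 0} + 2 \<le> DIM('a)"
    using dim_subset_UNIV[of "{y. y \<bullet> e1 = 0 \<and> y \<bullet> e2 = 0} \<union> {e1, e2}"] by simp
qed

text \<open>A flattening chart maps \<open>\<Gamma>\<close> to a half of a hyperplane and hence the relative boundary of \<open>\<Gamma>\<close> into the
  edge of that half, which has codimension 2. The Lipschitz inverse of the chart takes bounded pieces of the edge to
  null sets.\<close>

lemma lipschitz_part_boundary_null:
  fixes \<Omega> \<Gamma> :: "'a::euclidean_space set"
  assumes \<Gamma>: "lipschitz_boundary_part \<Omega> \<Gamma>"
  shows "hausdorff_outer (real DIM('a) - 1) (closure \<Gamma> - \<Gamma>) = 0"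
proof (rule hausdorff_outer_null_local)
  fix x assume x: "x \<in> closure \<Gamma> - \<Gamma>"
  have "\<Gamma> \<subseteq> frontier \<Omega>" using \<Gamma> openin_imp_subset unfolding lipschitz_boundary_part_def by blast
  then have sub: "closure \<Gamma> \<subseteq> frontier \<Omega>" by (simp add: closure_minimal)
  have "\<exists>U h L e1 e2. open U \<and> x \<in> U \<and> open (h ` U) \<and> inj_on h U \<and>
        L-lipschitz_on U (h :: 'a \<Rightarrow> 'a) \<and> L-lipschitz_on (h ` U) (inv_into U h) \<and>
        h x = 0 \<and> norm e1 = 1 \<and> norm e2 = 1 \<and> e1 \<bullet> e2 = 0 \<and>
        h ` (U \<inter> frontier \<Omega>) = {y \<in> h ` U. y \<bullet> e1 = 0} \<and>
        h ` (U \<inter> \<Gamma>) = {y \<in> h ` U. y \<bullet> e1 = 0 \<and> 0 < y \<bullet> e2}"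
    using \<Gamma> x unfolding lipschitz_boundary_part_def by (elim conjE ballE) auto
  then obtain U h L e1 e2 where "open U \<and> x \<in> U \<and> open (h ` U) \<and> inj_on h U \<and>
        L-lipschitz_on U (h :: 'a \<Rightarrow> 'a) \<and> L-lipschitz_on (h ` U) (inv_into U h) \<and>
        h x = 0 \<and> norm e1 = 1 \<and> norm e2 = 1 \<and> e1 \<bullet> e2 = 0 \<and>
        h ` (U \<inter> frontier \<Omega>) = {y \<in> h ` U. y \<bullet> e1 = 0} \<and>
        h ` (U \<inter> \<Gamma>) = {y \<in> h ` U. y \<bullet> e1 = 0 \<and> 0 < y \<bullet> e2}"
    by (elim exE)
  then have U: "open U" "x \<in> U" "inj_on h U" and L: "L-lipschitz_on U h" "L-lipschitz_on (h ` U) (inv_into U h)"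
    and e: "norm e1 = 1" "norm e2 = 1" "e1 \<bullet> e2 = 0"
    and fr: "h ` (U \<inter> frontier \<Omega>) = {y \<in> h ` U. y \<bullet> e1 = 0}"
    and \<Gamma>h: "h ` (U \<inter> \<Gamma>) = {y \<in> h ` U. y \<bullet> e1 = 0 \<and> 0 < y \<bullet> e2}"
    by simp_all
  let ?V = "{y. y \<bullet> e1 = 0 \<and> y \<bullet> e2 = 0}"
  define A where "A = U \<inter> ball x 1 \<inter> (closure \<Gamma> - \<Gamma>)"
  have "h ` A \<subseteq> ?V"
  proof
    fix z assume "z \<in> h ` A"
    then obtain y where y: "y \<in> U" "y \<in> closure \<Gamma>" "y \<notin> \<Gamma>" "z = h y" by (auto simp: A_def)
    have "h y \<in> h ` (U \<inter> frontier \<Omega>)" using y sub by blast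
    then have z1: "h y \<bullet> e1 = 0" unfolding fr by simp
    have "\<not> 0 < h y \<bullet> e2"
    proof
      assume "0 < h y \<bullet> e2"
      then have "h y \<in> h ` (U \<inter> \<Gamma>)" unfolding \<Gamma>h using z1 y(1) by simp
      then obtain w where "w \<in> U" "w \<in> \<Gamma>" "h y = h w" by auto
      then have "y = w" using U(3) y(1) by (auto dest: inj_onD)
      then show False using y(3) \<open>w \<in> \<Gamma>\<close> by simp
    qed
    moreover have "\<not> h y \<bullet> e2 < 0"
    proof
      assume neg: "h y \<bullet> e2 < 0"
      have "continuous_on U (\<lambda>w. h w \<bullet> e2)"
        using lipschitz_on_continuous_on[OF L(1)] by (intro continuous_intros)
      then have "open (U \<inter> (\<lambda>w. h w \<bullet> e2) -` {..<0})"
        using U(1) by (intro continuous_open_preimage) auto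
      moreover have "y \<in> U \<inter> (\<lambda>w. h w \<bullet> e2) -` {..<0}" using y(1) neg by simp
      ultimately have "(U \<inter> (\<lambda>w. h w \<bullet> e2) -` {..<0}) \<inter> \<Gamma> \<noteq> {}"
        using y(2) open_Int_closure_eq_empty[of "U \<inter> (\<lambda>w. h w \<bullet> e2) -` {..<0}" \<Gamma>] by blast
      then obtain w where w: "w \<in> U" "w \<in> \<Gamma>" "h w \<bullet> e2 < 0" by auto
      then have "h w \<in> h ` (U \<inter> \<Gamma>)" by blast
      then show False unfolding \<Gamma>h using w(3) by simp
    qed
    ultimately show "z \<in> ?V" using z1 y(4) by simp
  qed
  moreover have "bounded (h ` A)"
  proof -
    have "dist (h x) (h y) \<le> L" if "y \<in> A" for y
    proof -
      have "dist (h x) (h y) \<le> L * dist x y" using that U(2) by (intro lipschitz_onD[OF L(1)]) (auto simp: A_def)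
      also have "\<dots> \<le> L * 1"
        using that lipschitz_on_nonneg[OF L(1)] by (intro mult_left_mono) (auto simp: A_def)
      finally show ?thesis by simp
    qed
    then show ?thesis unfolding bounded_def by (intro exI[of _ "h x"] exI[of _ L]) auto
  qed
  moreover have "L-lipschitz_on (h ` A) (inv_into U h)"
    by (rule lipschitz_on_subset[OF L(2)]) (auto simp: A_def)
  ultimately have "hausdorff_outer (real DIM('a) - 1) (inv_into U h ` (h ` A)) = 0"
    using dim_orthogonal_pair(2)[OF e]
    by (intro hausdorff_outer_lipschitz_image_null[OF dim_orthogonal_pair(1)[OF e] refl]) auto
  moreover have "inv_into U h ` (h ` A) = A"
  proof -
    have "A \<subseteq> U" by (auto simp: A_def)
    with U(3) show ?thesis by (rule inv_into_image_cancel)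
  qed
  ultimately have "hausdorff_outer (real DIM('a) - 1) ((U \<inter> ball x 1) \<inter> (closure \<Gamma> - \<Gamma>)) = 0"
    by (simp add: A_def)
  then show "\<exists>W. open W \<and> x \<in> W \<and> hausdorff_outer (real DIM('a) - 1) (W \<inter> (closure \<Gamma> - \<Gamma>)) = 0"
    using U by (intro exI[of _ "U \<inter> ball x 1"]) auto
qed

context lipschitz_mesh
begin

abbreviation H :: "'a measure" where "H \<equiv> hausdorff_measure (real DIM('a) - 1)"

lemma part_lipschitz: "\<Gamma> \<in> {\<Gamma>D, \<Gamma>V, \<Gamma>N} \<Longrightarrow> lipschitz_boundary_part \<Omega> \<Gamma>"
  using boundary unfolding boundary_partition_def by blast

lemma part_openin: "\<Gamma> \<in> {\<Gamma>D, \<Gamma>V, \<Gamma>N} \<Longrightarrow> openin (top_of_set (frontier \<Omega>)) \<Gamma>"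
  using part_lipschitz unfolding lipschitz_boundary_part_def by blast

lemma parts:
  "\<Gamma>V \<subseteq> frontier \<Omega>" "\<Gamma>N \<subseteq> frontier \<Omega>" "\<Gamma>V \<inter> closure \<Gamma>D = {}" "\<Gamma>V \<inter> closure \<Gamma>N = {}"
  "frontier \<Omega> = closure \<Gamma>D \<union> closure \<Gamma>V \<union> closure \<Gamma>N"
proof -
  have sub: "\<Gamma>' \<subseteq> frontier \<Omega>" if "\<Gamma>' \<in> {\<Gamma>D, \<Gamma>V, \<Gamma>N}" for \<Gamma>'
    using part_openin[OF that] by (rule openin_imp_subset)
  then show "\<Gamma>V \<subseteq> frontier \<Omega>" "\<Gamma>N \<subseteq> frontier \<Omega>" by simp_all
  obtain W where W: "open W" "\<Gamma>V = frontier \<Omega> \<inter> W" using part_openin[of \<Gamma>V] unfolding openin_open by auto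
  have disj: "\<Gamma>V \<inter> closure \<Gamma>' = {}" if "\<Gamma>' \<in> {\<Gamma>D, \<Gamma>N}" for \<Gamma>'
  proof -
    have "\<Gamma>V \<inter> \<Gamma>' = {}" using that boundary unfolding boundary_partition_def by blast
    then have "W \<inter> \<Gamma>' = {}" using W(2) sub[of \<Gamma>'] that by blast
    then have "W \<inter> closure \<Gamma>' = {}" using W(1) by (simp add: open_Int_closure_eq_empty)
    then show ?thesis using W(2) by auto
  qed
  then show "\<Gamma>V \<inter> closure \<Gamma>D = {}" "\<Gamma>V \<inter> closure \<Gamma>N = {}" by simp_all
  show "frontier \<Omega> = closure \<Gamma>D \<union> closure \<Gamma>V \<union> closure \<Gamma>N"
    using boundary unfolding boundary_partition_def by blast
qed

lemma relatively_open_Un: "\<exists>W. open W \<and> \<Gamma>V \<union> \<Gamma>N = frontier \<Omega> \<inter> W"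
proof -
  have "openin (top_of_set (frontier \<Omega>)) (\<Gamma>V \<union> \<Gamma>N)"
    by (intro openin_Un part_openin) simp_all
  then show ?thesis by (auto simp: openin_open)
qed

lemma parts_borel: "\<Gamma>D \<in> sets borel" "\<Gamma>V \<in> sets borel" "\<Gamma>N \<in> sets borel" "frontier \<Omega> \<in> sets borel"
proof -
  have "\<Gamma> \<in> sets borel" if "\<Gamma> \<in> {\<Gamma>D, \<Gamma>V, \<Gamma>N}" for \<Gamma>
  proof -
    have "openin (top_of_set (frontier \<Omega>)) \<Gamma>"
      using that by (rule part_openin)
    then obtain W where "open W" "\<Gamma> = frontier \<Omega> \<inter> W" by (auto simp: openin_open)
    then show ?thesis by auto
  qed
  then show "\<Gamma>D \<in> sets borel" "\<Gamma>V \<in> sets borel" "\<Gamma>N \<in> sets borel" "frontier \<Omega> \<in> sets borel" by auto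
qed

lemma part_boundary_null: "\<Gamma> \<in> {\<Gamma>D, \<Gamma>V, \<Gamma>N} \<Longrightarrow> closure \<Gamma> - \<Gamma> \<in> null_sets H"
  unfolding null_sets_hausdorff by (rule lipschitz_part_boundary_null[OF part_lipschitz])

lemma boundary_gap_null: "frontier \<Omega> - (\<Gamma>D \<union> \<Gamma>V \<union> \<Gamma>N) \<in> null_sets H"
proof (rule null_sets_subset)
  show "(closure \<Gamma>D - \<Gamma>D) \<union> (closure \<Gamma>V - \<Gamma>V) \<union> (closure \<Gamma>N - \<Gamma>N) \<in> null_sets H"
    by (intro null_sets.Un part_boundary_null) auto
  show "frontier \<Omega> - (\<Gamma>D \<union> \<Gamma>V \<union> \<Gamma>N) \<in> sets H"
    using parts_borel by (intro borel_in_sets_hausdorff) auto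
  show "frontier \<Omega> - (\<Gamma>D \<union> \<Gamma>V \<union> \<Gamma>N) \<subseteq> (closure \<Gamma>D - \<Gamma>D) \<union> (closure \<Gamma>V - \<Gamma>V) \<union> (closure \<Gamma>N - \<Gamma>N)"
    using parts(5) by blast
qed

lemma facet_measure:
  assumes F: "F \<in> boundary_facets \<Omega> \<T>"
  shows "F \<in> sets borel" "hausdorff_outer (real DIM('a) - 1) F < top" "F - rel_interior F \<in> null_sets H"
proof -
  note p = facet_props[OF facet_element[OF F] boundary_facetE(2)[OF F]]
  have eq: "real_of_int (int DIM('a) - 1) = real DIM('a) - 1" by simp
  show "F \<in> sets borel" using p(3) by (rule borel_closed)
  show "hausdorff_outer (real DIM('a) - 1) F < top"
    using hausdorff_outer_flat(2)[OF p(5,8)] dim unfolding eq by simp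
  have "rel_frontier F = \<Union>{G. G facet_of F}"
    using p(1) by (intro rel_frontier_of_polyhedron polytope_imp_polyhedron)
  then have Fr: "F - rel_interior F = \<Union>{G. G facet_of F}"
    using p(3) by (simp add: rel_frontier_def)
  have "G \<in> null_sets H" if "G facet_of F" for G
  proof -
    have "aff_dim G = int DIM('a) - 2" using that p(8) by (simp add: facet_of_def)
    moreover have "bounded G" using bounded_subset[OF p(5) facet_of_imp_subset[OF that]] .
    ultimately show ?thesis
      using hausdorff_outer_flat(1)[of G "int DIM('a) - 1"] dim unfolding eq by (simp add: null_sets_hausdorff)
  qed
  then show "F - rel_interior F \<in> null_sets H"
    unfolding Fr using finite_polytope_facets[OF p(1)]
    by (intro null_sets_UN'[where N="\<lambda>x. x", simplified]) (auto intro: countable_finite)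
qed

text \<open>The boundary is a finite union of boundary facets, each of which is bounded and flat.\<close>

lemma frontier_finite: "hausdorff_outer (real DIM('a) - 1) (frontier \<Omega>) < top"
proof -
  have "boundary_facets \<Omega> \<T> \<subseteq> sets H" using borel_in_sets_hausdorff[OF facet_measure(1)] by blast
  then have "emeasure H (\<Union>(boundary_facets \<Omega> \<T>)) \<le> (\<Sum>F\<in>boundary_facets \<Omega> \<T>. emeasure H F)"
    using emeasure_subadditive_finite[OF finite_boundary_facets, of "\<lambda>F. F" H] by simp
  also have "\<dots> < top"
    unfolding ennreal_sum_less_top[OF finite_boundary_facets]
    using facet_measure(2) by (simp add: emeasure_hausdorff borel_in_sets_hausdorff[OF facet_measure(1)])
  finally show ?thesis
    unfolding mesh_props(4) by (simp add: emeasure_hausdorff borel_in_sets_hausdorff[OF parts_borel(4)])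
qed

end

section \<open>Weak derivatives\<close>

lemma C1_grad_zero_open:
  assumes u: "C1_grad u u'" and V: "open V" "\<And>x. x \<in> V \<Longrightarrow> u x = 0" and x: "x \<in> V"
  shows "u' x = 0"
proof -
  have "((\<lambda>_. 0) has_derivative (\<lambda>_. 0)) (at x)" by (rule has_derivative_const)
  then have "(u has_derivative (\<lambda>_. 0)) (at x)"
    by (rule has_derivative_transform_within_open[OF _ V(1) x]) (simp add: V(2))
  then have "(\<lambda>h. h \<bullet> u' x) = (\<lambda>_. 0)"
    by (rule has_derivative_unique[OF C1_grad_has_derivative[OF u]])
  then have "u' x \<bullet> u' x = 0" by meson
  then show ?thesis by simp
qed

lemma test_fun_support:
  assumes "test_fun \<Omega> \<theta> \<theta>'"
  shows "\<exists>S. compact S \<and> S \<subseteq> \<Omega> \<and> (\<forall>x. x \<notin> S \<longrightarrow> \<theta> x = 0 \<and> \<theta>' x = 0)"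
proof -
  obtain S where S: "compact S" "S \<subseteq> \<Omega>" "\<And>x. x \<notin> S \<Longrightarrow> \<theta> x = 0" and C: "C1_grad \<theta> \<theta>'"
    using assms unfolding test_fun_def by blast
  have "\<theta>' x = 0" if "x \<notin> S" for x
    using S that by (intro C1_grad_zero_open[OF C, of "- S"]) (auto intro: compact_imp_closed)
  then show ?thesis using S by blast
qed

lemma test_fun_outside: "test_fun \<Omega> \<theta> \<theta>' \<Longrightarrow> x \<notin> \<Omega> \<Longrightarrow> \<theta> x = 0 \<and> \<theta>' x = 0"
  using test_fun_support by blast

lemma test_fun_C1: "test_fun \<Omega> \<theta> \<theta>' \<Longrightarrow> C1_grad \<theta> \<theta>'"
  by (simp add: test_fun_def)

lemma compact_support_integrable:
  fixes g :: "'a::euclidean_space \<Rightarrow> 'b::euclidean_space"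
  assumes g: "continuous_on UNIV g" and S: "compact S" "\<And>x. x \<notin> S \<Longrightarrow> g x = 0"
  shows "integrable lborel g"
proof -
  have "integrable lborel (\<lambda>x. indicator S x *\<^sub>R g x)"
    using S(1) continuous_on_subset[OF g] by (intro borel_integrable_compact) auto
  moreover have "indicator S x *\<^sub>R g x = g x" for x using S(2) by (cases "x \<in> S") auto
  ultimately show ?thesis by simp
qed

lemma compact_support_bounded:
  fixes g :: "'a::euclidean_space \<Rightarrow> 'b::euclidean_space"
  assumes g: "continuous_on UNIV g" and S: "compact S" "\<And>x. x \<notin> S \<Longrightarrow> g x = 0"
  shows "\<exists>C\<ge>0. \<forall>x. norm (g x) \<le> C"
proof -
  have "bounded (g ` S)"
    using S(1) continuous_on_subset[OF g] by (intro compact_imp_bounded compact_continuous_image) auto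
  then obtain C where "0 < C" "\<And>x. x \<in> S \<Longrightarrow> norm (g x) \<le> C" by (auto simp: bounded_pos)
  then show ?thesis using S(2) by (intro exI[of _ C]) (metis less_imp_le norm_zero)
qed

text \<open>The integral of a derivative is the limit of the integrals of difference quotients, and these vanish
  because Lebesgue measure is translation invariant.\<close>

lemma integral_gradient_zero:
  fixes f :: "'a::euclidean_space \<Rightarrow> real"
  assumes f: "C1_grad f f'" and S: "compact S" "\<And>x. x \<notin> S \<Longrightarrow> f x = 0"
  shows "(LINT x|lborel. f' x) = 0"
proof -
  have cont: "continuous_on UNIV f" "continuous_on UNIV f'" using C1_grad_continuous[OF f] .
  have S': "f' x = 0" if "x \<notin> S" for x
    using S that by (intro C1_grad_zero_open[OF f, of "- S"]) (auto intro: compact_imp_closed)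
  have int: "integrable lborel f" "integrable lborel f'"
    using compact_support_integrable[OF cont(1) S] compact_support_integrable[OF cont(2) S(1) S'] by auto
  obtain C where C: "0 \<le> C" "\<And>x. norm (f' x) \<le> C"
    using compact_support_bounded[OF cont(2) S(1) S'] by blast
  obtain R where R: "0 < R" "\<And>x. x \<in> S \<Longrightarrow> norm x \<le> R"
    using compact_imp_bounded[OF S(1)] by (auto simp: bounded_pos)
  have lip: "\<bar>f y - f x\<bar> \<le> C * norm (y - x)" for x y
  proof -
    have "norm (f y - f x) \<le> C * norm (y - x)"
    proof (rule differentiable_bound[of UNIV f "\<lambda>x h. h \<bullet> f' x"])
      show "(f has_derivative (\<lambda>h. h \<bullet> f' z)) (at z within UNIV)" for z
        using C1_grad_has_derivative[OF f] by simp
      show "onorm (\<lambda>h. h \<bullet> f' z) \<le> C" for z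
      proof (rule onorm_le)
        fix h
        have "norm (h \<bullet> f' z) \<le> norm h * norm (f' z)" by (simp add: Cauchy_Schwarz_ineq2)
        also have "\<dots> \<le> norm h * C" by (intro mult_left_mono C(2) norm_ge_zero)
        also have "\<dots> = C * norm h" by (rule mult.commute)
        finally show "norm (h \<bullet> f' z) \<le> C * norm h" .
      qed
    qed auto
    then show ?thesis by simp
  qed
  have "(LINT x|lborel. e \<bullet> f' x) = 0" for e
  proof -
    define t where "t n = inverse (real (Suc n))" for n
    have t: "0 < t n" "t n \<le> 1" for n by (auto simp: t_def inverse_le_1_iff)
    define D where "D n x = (f (t n *\<^sub>R e + x) - f x) / t n" for n x
    have shift: "integrable lborel (\<lambda>x. f (c + x))" "(LINT x|lborel. f (c + x)) = (LINT x|lborel. f x)" for c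
    proof -
      have m: "(+) c \<in> measurable lborel borel" "f \<in> borel_measurable borel"
        using C1_grad_measurable(1)[OF f] by auto
      show "(LINT x|lborel. f (c + x)) = (LINT x|lborel. f x)"
        using integral_distr[OF m] by (simp add: lborel_distr_plus)
      show "integrable lborel (\<lambda>x. f (c + x))"
        using integrable_distr_eq[OF m] int(1) by (simp add: lborel_distr_plus)
    qed
    have D0: "(LINT x|lborel. D n x) = 0" for n
      unfolding D_def using shift int(1) by simp
    have "(\<lambda>n. LINT x|lborel. D n x) \<longlonglongrightarrow> (LINT x|lborel. e \<bullet> f' x)"
    proof (rule integral_dominated_convergence)
      show "integrable lborel (\<lambda>x. indicator (cball 0 (R + norm e)) x *\<^sub>R (C * norm e))"
        by (intro borel_integrable_compact) auto
      show "(\<lambda>x. e \<bullet> f' x) \<in> borel_measurable lborel"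
        using C1_grad_measurable(2)[OF f] by simp
      have "f \<in> borel_measurable borel" by (rule C1_grad_measurable(1)[OF f])
      then show "D n \<in> borel_measurable lborel" for n unfolding D_def[abs_def] by measurable
      show "AE x in lborel. (\<lambda>n. D n x) \<longlonglongrightarrow> e \<bullet> f' x"
      proof (rule AE_I2)
        fix x
        have "((\<lambda>s. f (s *\<^sub>R e + x)) has_derivative (\<lambda>s. (s *\<^sub>R e) \<bullet> f' (0 *\<^sub>R e + x))) (at 0)"
          by (rule has_derivative_compose[of "\<lambda>s. s *\<^sub>R e + x" "\<lambda>s. s *\<^sub>R e" 0 UNIV f, OF _ C1_grad_has_derivative[OF f]])
            (auto intro!: derivative_eq_intros)
        then have "DERIV (\<lambda>s. f (s *\<^sub>R e + x)) 0 :> e \<bullet> f' x"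
          by (simp add: has_field_derivative_def mult.commute[of _ "e \<bullet> f' x"] mult_commute_abs)
        then have "((\<lambda>h. (f (h *\<^sub>R e + x) - f x) / h) \<longlongrightarrow> e \<bullet> f' x) (at 0)"
          by (simp add: DERIV_def)
        moreover have "filterlim t (at 0) sequentially"
        proof (rule filterlim_atI)
          show "t \<longlonglongrightarrow> 0" unfolding t_def by (rule LIMSEQ_inverse_real_of_nat)
          show "\<forall>\<^sub>F n in sequentially. t n \<noteq> 0" using t(1) by (intro always_eventually) (simp add: less_imp_neq[symmetric])
        qed
        ultimately show "(\<lambda>n. D n x) \<longlonglongrightarrow> e \<bullet> f' x"
          unfolding D_def by (rule filterlim_compose)
      qed
      show "AE x in lborel. norm (D n x) \<le> indicator (cball 0 (R + norm e)) x *\<^sub>R (C * norm e)" for n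
      proof (rule AE_I2)
        fix x
        show "norm (D n x) \<le> indicator (cball 0 (R + norm e)) x *\<^sub>R (C * norm e)"
        proof (cases "x \<in> cball 0 (R + norm e)")
          case True
          have "\<bar>f (t n *\<^sub>R e + x) - f x\<bar> \<le> C * norm (t n *\<^sub>R e)" using lip[where x=x and y="t n *\<^sub>R e + x"] by simp
          then have "\<bar>f (t n *\<^sub>R e + x) - f x\<bar> \<le> (C * norm e) * t n" using t[of n] by (simp add: mult_ac)
          then show ?thesis using True t[of n] by (simp add: D_def divide_le_eq)
        next
          case False
          then have n: "R + norm e < norm x" by simp
          have "norm (t n *\<^sub>R e) \<le> norm e" using t[of n] by (simp add: mult_left_le_one_le)
          then have "R < norm (t n *\<^sub>R e + x)" using n norm_diff_ineq[of x "t n *\<^sub>R e"] by (simp add: add.commute)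
          then have "t n *\<^sub>R e + x \<notin> S" using R(2)[of "t n *\<^sub>R e + x"] by auto
          moreover have "x \<notin> S"
          proof
            assume "x \<in> S"
            then have "norm x \<le> R" by (rule R(2))
            then show False using n norm_ge_zero[of e] by linarith
          qed
          ultimately show ?thesis using False S(2) by (simp add: D_def)
        qed
      qed
    qed
    then show ?thesis using D0 by (simp add: LIMSEQ_const_iff)
  qed
  then have "(LINT x|lborel. f' x) \<bullet> (LINT x|lborel. f' x) = 0"
    using int(2) by (metis integral_inner_right)
  then show ?thesis by simp
qed

lemma is_wgrad_C1:
  fixes v :: "'a::euclidean_space \<Rightarrow> real"
  assumes \<Omega>: "open \<Omega>" and v: "C1_grad v v'"
  shows "is_wgrad \<Omega> v v'"
  unfolding is_wgrad_def
proof (intro allI impI)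
  fix \<theta> \<theta>' assume \<theta>: "test_fun \<Omega> \<theta> \<theta>'"
  obtain S where S: "compact S" "\<And>x. x \<notin> S \<Longrightarrow> \<theta> x = 0" "\<And>x. x \<notin> S \<Longrightarrow> \<theta>' x = 0"
    using test_fun_support[OF \<theta>] by blast
  have C: "C1_grad (\<lambda>x. v x * \<theta> x) (\<lambda>x. v x *\<^sub>R \<theta>' x + \<theta> x *\<^sub>R v' x)"
    by (rule C1_grad_mult[OF v test_fun_C1[OF \<theta>]])
  have c: "continuous_on UNIV (\<lambda>x. v x *\<^sub>R \<theta>' x)" "continuous_on UNIV (\<lambda>x. \<theta> x *\<^sub>R v' x)"
    using C1_grad_continuous[OF v] C1_grad_continuous[OF test_fun_C1[OF \<theta>]] by (auto intro!: continuous_intros)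
  have i: "integrable lborel (\<lambda>x. v x *\<^sub>R \<theta>' x)" "integrable lborel (\<lambda>x. \<theta> x *\<^sub>R v' x)"
    using S by (auto intro!: compact_support_integrable[OF c(1) S(1)] compact_support_integrable[OF c(2) S(1)])
  have "(LINT x|lborel. v x *\<^sub>R \<theta>' x + \<theta> x *\<^sub>R v' x) = 0"
    by (rule integral_gradient_zero[OF C S(1)]) (simp add: S(2))
  then have sum: "(LINT x|lborel. v x *\<^sub>R \<theta>' x) = - (LINT x|lborel. \<theta> x *\<^sub>R v' x)"
    using i by (simp add: add_eq_0_iff2)
  have on: "(LINT x|lebesgue_on \<Omega>. w x) = (LINT x|lborel. w x)"
    if w: "continuous_on UNIV w" "\<And>x. x \<notin> \<Omega> \<Longrightarrow> w x = 0" for w :: "'a \<Rightarrow> 'a"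
  proof -
    have "(LINT x|lebesgue_on \<Omega>. w x) = (LINT x|lebesgue. indicator \<Omega> x *\<^sub>R w x)"
      using \<Omega> by (intro integral_restrict_space) auto
    also have "\<dots> = (LINT x|lebesgue. w x)"
      by (rule arg_cong[where f="integral\<^sup>L lebesgue"]) (use w(2) in \<open>auto simp: fun_eq_iff indicator_def\<close>)
    also have "\<dots> = (LINT x|lborel. w x)"
      using w(1) by (intro integral_completion) (simp add: borel_measurable_continuous_onI)
    finally show ?thesis .
  qed
  have out: "\<theta> x = 0 \<and> \<theta>' x = 0" if "x \<notin> \<Omega>" for x by (rule test_fun_outside[OF \<theta> that])
  have "(LINT x|lebesgue_on \<Omega>. v x *\<^sub>R \<theta>' x) = (LINT x|lborel. v x *\<^sub>R \<theta>' x)"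
    by (rule on[OF c(1)]) (simp add: out)
  moreover have "(LINT x|lebesgue_on \<Omega>. \<theta> x *\<^sub>R v' x) = (LINT x|lborel. \<theta> x *\<^sub>R v' x)"
    by (rule on[OF c(2)]) (simp add: out)
  ultimately show "(LINT x|lebesgue_on \<Omega>. v x *\<^sub>R \<theta>' x) = - (LINT x|lebesgue_on \<Omega>. \<theta> x *\<^sub>R v' x)"
    using sum by simp
qed

lemma continuous_L2:
  fixes g :: "'a::euclidean_space \<Rightarrow> 'b::euclidean_space"
  assumes M: "borel_regular M" and A: "A \<in> sets M" "bounded A" "finite_measure (restrict_space M A)"
    and g: "continuous_on UNIV g"
  shows "g \<in> L2 (restrict_space M A)"
  unfolding L2_def
proof (intro CollectI conjI)
  have "g \<in> borel_measurable M"
    using g by (intro borel_measurable_borel_regular[OF M] borel_measurable_continuous_onI)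
  then show m: "g \<in> borel_measurable (restrict_space M A)" by (rule measurable_restrict_space1)
  have "bounded (g ` closure A)"
    using A(2) continuous_on_subset[OF g] by (intro compact_imp_bounded compact_continuous_image) auto
  then obtain C where C: "\<And>x. x \<in> closure A \<Longrightarrow> norm (g x) \<le> C" by (auto simp: bounded_iff)
  show "integrable (restrict_space M A) (\<lambda>x. (norm (g x))\<^sup>2)"
  proof (rule finite_measure.integrable_const_bound[OF A(3), of _ "C\<^sup>2"])
    show "(\<lambda>x. (norm (g x))\<^sup>2) \<in> borel_measurable (restrict_space M A)" using m by measurable
    show "AE x in restrict_space M A. norm ((norm (g x))\<^sup>2) \<le> C\<^sup>2"
    proof (rule AE_I2)
      fix x assume "x \<in> space (restrict_space M A)"
      then have "x \<in> closure A" using closure_subset[of A] by (auto simp: space_restrict_space)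
      then show "norm ((norm (g x))\<^sup>2) \<le> C\<^sup>2" using C by (simp add: power_mono)
    qed
  qed
qed

text \<open>Traces, coefficients and test functions live on domains that differ by null sets only (an element and its part in
  \<open>\<Omega>\<close>, a facet and its part in \<open>\<Gamma>V\<close>). Completeness of Lebesgue and Hausdorff measure allows measurability
  to pass between them.\<close>

lemma complete_measurable_AE:
  assumes M: "complete_measure M" and f: "f \<in> borel_measurable M" and eq: "AE x in M. f x = g x"
  shows "g \<in> borel_measurable M"
proof (rule measurableI)
  fix S :: "'b set" assume S: "S \<in> sets borel"
  show "g -` S \<inter> space M \<in> sets M"
  proof (rule complete_measure.in_sets_AE[OF M])
    show "f -` S \<inter> space M \<in> sets M" using f S by (rule measurable_sets)
    show "AE x in M. x \<in> f -` S \<inter> space M \<longleftrightarrow> x \<in> g -` S \<inter> space M"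
      using eq by eventually_elim auto
  qed auto
qed simp

lemma restrict_space_AE_subset:
  fixes f :: "'a \<Rightarrow> 'b::euclidean_space"
  assumes M: "complete_measure M" and AB: "A \<in> sets M" "B \<in> sets M" "A - B \<in> null_sets M"
  shows "f \<in> borel_measurable (restrict_space M B) \<Longrightarrow> f \<in> borel_measurable (restrict_space M A)"
    and "integrable (restrict_space M B) f \<Longrightarrow> integrable (restrict_space M A) f"
proof -
  have sp: "A \<inter> space M \<in> sets M" "B \<inter> space M \<in> sets M" using AB by auto
  have eq: "AE x in M. indicator A x *\<^sub>R (indicator B x *\<^sub>R f x) = indicator A x *\<^sub>R f x"
    using AE_not_in[OF AB(3)] by eventually_elim (auto simp: indicator_def)
  show m: "f \<in> borel_measurable (restrict_space M A)" if f: "f \<in> borel_measurable (restrict_space M B)"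
  proof -
    have "(\<lambda>x. indicator B x *\<^sub>R f x) \<in> borel_measurable M"
      using f by (simp add: borel_measurable_restrict_space_iff[OF sp(2)])
    then have "(\<lambda>x. indicator A x *\<^sub>R (indicator B x *\<^sub>R f x)) \<in> borel_measurable M"
      by (rule borel_measurable_scaleR[OF borel_measurable_indicator[OF AB(1)]])
    then show ?thesis
      unfolding borel_measurable_restrict_space_iff[OF sp(1)] by (rule complete_measurable_AE[OF M _ eq])
  qed
  show "integrable (restrict_space M A) f" if f: "integrable (restrict_space M B) f"
  proof -
    have "integrable M (\<lambda>x. indicator A x *\<^sub>R (indicator B x *\<^sub>R f x))"
      using f unfolding integrable_restrict_space[OF sp(2)] by (rule integrable_mult_indicator[OF AB(1)])
    moreover have "(\<lambda>x. indicator A x *\<^sub>R f x) \<in> borel_measurable M"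
      using m[OF borel_measurable_integrable[OF f]] by (simp add: borel_measurable_restrict_space_iff[OF sp(1)])
    ultimately have "integrable M (\<lambda>x. indicator A x *\<^sub>R f x)"
      using eq by (subst integrable_cong_AE[symmetric]) auto
    then show ?thesis by (simp add: integrable_restrict_space[OF sp(1)])
  qed
qed

lemma L2_restrict_AE_subset:
  assumes "complete_measure M" "A \<in> sets M" "B \<in> sets M" "A - B \<in> null_sets M" and f: "f \<in> L2 (restrict_space M B)"
  shows "f \<in> L2 (restrict_space M A)"
  unfolding L2_def
  using restrict_space_AE_subset(1)[OF assms(1-4) L2_measurable[OF f]]
    restrict_space_AE_subset(2)[OF assms(1-4) L2_integrable[OF f]] by simp

lemma L2_surf_subset:
  assumes "f \<in> L2 (surf B)" "A - B \<in> null_sets (hausdorff_measure (real DIM('a) - 1))" "B \<in> sets borel"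
    "(A :: 'a::euclidean_space set) \<in> sets borel"
  shows "f \<in> L2 (surf A)"
  using assms unfolding surf_def
  by (intro L2_restrict_AE_subset[OF complete_hausdorff, of A _ B]) (auto intro: borel_in_sets_hausdorff)

context lipschitz_mesh
begin

abbreviation \<Lambda> :: "'a measure" where "\<Lambda> \<equiv> lebesgue_on \<Omega>"

abbreviation \<Gamma> :: "'a set" where "\<Gamma> \<equiv> \<Gamma>V \<union> \<Gamma>N"

lemma \<Omega>_sets: "\<Omega> \<in> sets lebesgue" "\<Omega> \<inter> space lebesgue \<in> sets lebesgue"
  using domain_props(1) by auto

lemma finite_\<Lambda>: "finite_measure \<Lambda>"
  by (intro finite_measure_lebesgue_on lmeasurable_open domain_props)

lemma bounded_boundary: "bounded (frontier \<Omega>)"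
  by (rule bounded_subset[OF bounded_closure[OF domain_props(3)]]) (auto simp: frontier_def)

lemma finite_surf:
  assumes "A \<subseteq> frontier \<Omega>" "A \<in> sets borel"
  shows "finite_measure (surf A)"
proof
  have "hausdorff_outer (real DIM('a) - 1) A < top"
    using hausdorff_outer_mono[OF assms(1)] frontier_finite by (rule le_less_trans)
  then show "emeasure (surf A) (space (surf A)) \<noteq> \<infinity>"
    using borel_in_sets_hausdorff[OF assms(2)]
    by (simp add: surf_def space_restrict_space emeasure_restrict_space emeasure_hausdorff)
qed

lemma AE_surf:
  assumes "A \<in> sets borel"
  shows "(AE x in surf A. Q x) \<longleftrightarrow> (AE x in H. x \<in> A \<longrightarrow> Q x)"
  unfolding surf_def using borel_in_sets_hausdorff[OF assms] by (intro AE_restrict_space_iff) auto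

lemma \<Gamma>_props: "\<Gamma> \<subseteq> frontier \<Omega>" "\<Gamma> \<in> sets borel" "bounded \<Gamma>"
proof -
  show s: "\<Gamma> \<subseteq> frontier \<Omega>" using parts by auto
  show "\<Gamma> \<in> sets borel" using parts_borel by auto
  show "bounded \<Gamma>" using bounded_subset[OF bounded_boundary s] .
qed

lemma continuous_L2_\<Lambda>:
  fixes g :: "'a \<Rightarrow> 'b::euclidean_space"
  shows "continuous_on UNIV g \<Longrightarrow> g \<in> L2 \<Lambda>"
  by (rule continuous_L2[OF borel_regular_lebesgue \<Omega>_sets(1) domain_props(3) finite_\<Lambda>])

lemma continuous_L2_surf:
  fixes g :: "'a \<Rightarrow> 'b::euclidean_space"
  assumes "A \<subseteq> frontier \<Omega>" "A \<in> sets borel" "continuous_on UNIV g"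
  shows "g \<in> L2 (surf A)"
  unfolding surf_def
  using assms finite_surf[OF assms(1,2)] bounded_subset[OF bounded_boundary assms(1)]
  by (intro continuous_L2 borel_regular_hausdorff borel_in_sets_hausdorff) (simp_all add: surf_def)

lemma fundamental_lemma_\<Lambda>:
  assumes f: "f \<in> L2 \<Lambda>" and U: "open U"
    and ortho: "\<And>\<theta> \<theta>'. test_fun (\<Omega> \<inter> U) \<theta> \<theta>' \<Longrightarrow> (LINT x|\<Lambda>. \<theta> x * f x) = 0"
  shows "AE x in \<Lambda>. x \<in> U \<longrightarrow> f x = 0"
proof -
  have "AE x in \<Lambda>. x \<in> \<Omega> \<inter> U \<longrightarrow> f x = 0"
    by (rule fundamental_lemma[OF borel_regular_lebesgue \<Omega>_sets(1) finite_L2_integrable[OF finite_\<Lambda> f]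
        open_Int[OF domain_props(1) U] ortho])
  then show ?thesis using AE_space by eventually_elim auto
qed

lemma test_fun_L2:
  assumes "test_fun U \<theta> \<theta>'" shows "\<theta> \<in> L2 \<Lambda>" "\<theta>' \<in> L2 \<Lambda>"
  using C1_grad_continuous[OF test_fun_C1[OF assms]] by (auto intro: continuous_L2_\<Lambda>)

lemma L2_mult_integrable:
  fixes f g :: "'b \<Rightarrow> real"
  shows "f \<in> L2 M \<Longrightarrow> g \<in> L2 M \<Longrightarrow> integrable M (\<lambda>x. f x * g x)"
  using L2_inner_integrable[of f M g] by simp

lemma Hdiv_wdiv:
  assumes "q \<in> Hdiv \<Omega>" shows "q \<in> L2 \<Lambda>" "wdiv \<Omega> q \<in> L2 \<Lambda>" "is_wdiv \<Omega> q (wdiv \<Omega> q)"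
proof -
  have "\<exists>f. f \<in> L2 \<Lambda> \<and> is_wdiv \<Omega> q f" "q \<in> L2 \<Lambda>" using assms by (auto simp: Hdiv_def)
  then show "q \<in> L2 \<Lambda>" "wdiv \<Omega> q \<in> L2 \<Lambda>" "is_wdiv \<Omega> q (wdiv \<Omega> q)"
    using someI_ex[of "\<lambda>f. f \<in> L2 \<Lambda> \<and> is_wdiv \<Omega> q f"] unfolding wdiv_def by simp_all
qed

text \<open>Both divergences have the same pairing with every test function supported in \<open>U\<close>.\<close>

lemma wdiv_local:
  assumes q: "q \<in> L2 \<Lambda>" "q' \<in> L2 \<Lambda>" and f: "f \<in> L2 \<Lambda>" "f' \<in> L2 \<Lambda>"
    and d: "is_wdiv \<Omega> q f" "is_wdiv \<Omega> q' f'"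
    and U: "open U" and eq: "AE x in \<Lambda>. x \<in> U \<longrightarrow> q x = q' x"
  shows "AE x in \<Lambda>. x \<in> U \<longrightarrow> f x = f' x"
proof -
  have "AE x in \<Lambda>. x \<in> U \<longrightarrow> f x - f' x = 0"
  proof (rule fundamental_lemma_\<Lambda>[OF L2_diff[OF f] U])
    fix \<theta> \<theta>' assume t: "test_fun (\<Omega> \<inter> U) \<theta> \<theta>'"
    then have t\<Omega>: "test_fun \<Omega> \<theta> \<theta>'" unfolding test_fun_def by blast
    note L = test_fun_L2[OF t]
    have "(LINT x|\<Lambda>. q x \<bullet> \<theta>' x) = (LINT x|\<Lambda>. q' x \<bullet> \<theta>' x)"
    proof (rule integral_cong_AE)
      show "(\<lambda>x. q x \<bullet> \<theta>' x) \<in> borel_measurable \<Lambda>" "(\<lambda>x. q' x \<bullet> \<theta>' x) \<in> borel_measurable \<Lambda>"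
        using L2_inner_integrable[OF q(1) L(2)] L2_inner_integrable[OF q(2) L(2)] by auto
      show "AE x in \<Lambda>. q x \<bullet> \<theta>' x = q' x \<bullet> \<theta>' x"
        using eq
      proof eventually_elim
        case (elim x)
        then show ?case using test_fun_outside[OF t, of x] by (cases "x \<in> U") auto
      qed
    qed
    then have "(LINT x|\<Lambda>. \<theta> x * f x) = (LINT x|\<Lambda>. \<theta> x * f' x)"
      using d t\<Omega> unfolding is_wdiv_def by simp
    then show "(LINT x|\<Lambda>. \<theta> x * (f x - f' x)) = 0"
      using L2_mult_integrable[OF L(1) f(1)] L2_mult_integrable[OF L(1) f(2)] by (simp add: right_diff_distrib)
  qed
  then show ?thesis by eventually_elim auto
qed

lemma is_wdiv_lin:
  assumes q: "q \<in> L2 \<Lambda>" "q' \<in> L2 \<Lambda>" and f: "f \<in> L2 \<Lambda>" "f' \<in> L2 \<Lambda>"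
    and d: "is_wdiv \<Omega> q f" "is_wdiv \<Omega> q' f'"
  shows "is_wdiv \<Omega> (\<lambda>x. a *\<^sub>R q x + b *\<^sub>R q' x) (\<lambda>x. a * f x + b * f' x)"
  unfolding is_wdiv_def
proof (intro allI impI)
  fix \<theta> \<theta>' assume t: "test_fun \<Omega> \<theta> \<theta>'"
  note L = test_fun_L2[OF t]
  have "(LINT x|\<Lambda>. (a *\<^sub>R q x + b *\<^sub>R q' x) \<bullet> \<theta>' x) = a * (LINT x|\<Lambda>. q x \<bullet> \<theta>' x) + b * (LINT x|\<Lambda>. q' x \<bullet> \<theta>' x)"
    using L2_inner_integrable[OF q(1) L(2)] L2_inner_integrable[OF q(2) L(2)]
    by (simp add: inner_add_left)
  moreover have "(LINT x|\<Lambda>. \<theta> x * (a * f x + b * f' x)) = a * (LINT x|\<Lambda>. \<theta> x * f x) + b * (LINT x|\<Lambda>. \<theta> x * f' x)"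
    using L2_mult_integrable[OF L(1) f(1)] L2_mult_integrable[OF L(1) f(2)]
    by (simp add: distrib_left mult.left_commute)
  ultimately show "(LINT x|\<Lambda>. (a *\<^sub>R q x + b *\<^sub>R q' x) \<bullet> \<theta>' x) = - (LINT x|\<Lambda>. \<theta> x * (a * f x + b * f' x))"
    using d t unfolding is_wdiv_def by simp
qed

lemma H1_wgrad:
  assumes "v \<in> H1 \<Omega>" shows "v \<in> L2 \<Lambda>" "wgrad \<Omega> v \<in> L2 \<Lambda>" "is_wgrad \<Omega> v (wgrad \<Omega> v)"
proof -
  have "\<exists>g. g \<in> L2 \<Lambda> \<and> is_wgrad \<Omega> v g" "v \<in> L2 \<Lambda>" using assms by (auto simp: H1_def)
  then show "v \<in> L2 \<Lambda>" "wgrad \<Omega> v \<in> L2 \<Lambda>" "is_wgrad \<Omega> v (wgrad \<Omega> v)"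
    using someI_ex[of "\<lambda>g. g \<in> L2 \<Lambda> \<and> is_wgrad \<Omega> v g"] unfolding wgrad_def by simp_all
qed

lemma is_wgrad_unique:
  assumes g: "g \<in> L2 \<Lambda>" "g' \<in> L2 \<Lambda>" and w: "is_wgrad \<Omega> v g" "is_wgrad \<Omega> v g'"
  shows "AE x in \<Lambda>. g x = g' x"
proof -
  have "AE x in \<Lambda>. x \<in> UNIV \<longrightarrow> (g x - g' x) \<bullet> b = 0" for b
  proof (rule fundamental_lemma_\<Lambda>[OF L2_inner_const[OF L2_diff[OF g]] open_UNIV])
    fix \<theta> \<theta>' assume "test_fun (\<Omega> \<inter> UNIV) \<theta> \<theta>'"
    then have t: "test_fun \<Omega> \<theta> \<theta>'" by simp
    have i: "integrable \<Lambda> (\<lambda>x. \<theta> x *\<^sub>R h x)" if h: "h \<in> L2 \<Lambda>" for h :: "'a \<Rightarrow> 'a"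
    proof (rule finite_L2_integrable[OF finite_\<Lambda>])
      obtain S where "compact S" "\<And>x. x \<notin> S \<Longrightarrow> \<theta> x = 0" using test_fun_support[OF t] by blast
      then obtain C where "\<And>x. norm (\<theta> x) \<le> C"
        using compact_support_bounded[of \<theta> S] C1_grad_continuous(1)[OF test_fun_C1[OF t]] by blast
      then show "(\<lambda>x. \<theta> x *\<^sub>R h x) \<in> L2 \<Lambda>"
        using L2_measurable[OF test_fun_L2(1)[OF t]] by (intro L2_bounded_scaleR[OF h, of _ C]) auto
    qed
    have "(LINT x|\<Lambda>. v x *\<^sub>R \<theta>' x) = - (LINT x|\<Lambda>. \<theta> x *\<^sub>R g x)"
      "(LINT x|\<Lambda>. v x *\<^sub>R \<theta>' x) = - (LINT x|\<Lambda>. \<theta> x *\<^sub>R g' x)"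
      by (rule w(1)[unfolded is_wgrad_def, rule_format, OF t], rule w(2)[unfolded is_wgrad_def, rule_format, OF t])
    then have "(LINT x|\<Lambda>. \<theta> x *\<^sub>R g x) = (LINT x|\<Lambda>. \<theta> x *\<^sub>R g' x)" by simp
    then have "(LINT x|\<Lambda>. \<theta> x *\<^sub>R g x - \<theta> x *\<^sub>R g' x) = 0"
      using i[OF g(1)] i[OF g(2)] by simp
    then have "(LINT x|\<Lambda>. (\<theta> x *\<^sub>R g x - \<theta> x *\<^sub>R g' x) \<bullet> b) = 0"
      using i[OF g(1)] i[OF g(2)] by (subst integral_inner_left) auto
    then show "(LINT x|\<Lambda>. \<theta> x * ((g x - g' x) \<bullet> b)) = 0"
      by (simp add: inner_diff_left right_diff_distrib)
  qed
  then have "AE x in \<Lambda>. \<forall>b\<in>Basis. (g x - g' x) \<bullet> b = 0"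
    by (intro AE_finite_allI) auto
  then show ?thesis by eventually_elim (simp add: euclidean_eq_iff[where 'a='a] inner_diff_left)
qed

lemma C1_grad_H1:
  assumes v: "C1_grad v v'"
  shows "v \<in> H1 \<Omega>" "AE x in \<Lambda>. wgrad \<Omega> v x = v' x"
proof -
  have L: "v \<in> L2 \<Lambda>" "v' \<in> L2 \<Lambda>" using C1_grad_continuous[OF v] by (auto intro: continuous_L2_\<Lambda>)
  have w: "is_wgrad \<Omega> v v'" by (rule is_wgrad_C1[OF domain_props(1) v])
  show H: "v \<in> H1 \<Omega>" using L w by (auto simp: H1_def)
  show "AE x in \<Lambda>. wgrad \<Omega> v x = v' x"
    using is_wgrad_unique[OF H1_wgrad(2)[OF H] L(2) H1_wgrad(3)[OF H] w] .
qed

text \<open>The constant sequence approximates.\<close>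

lemma has_trace_C1:
  assumes v: "C1_grad v v'"
  shows "has_trace \<Omega> v v"
  unfolding has_trace_def
proof (intro conjI exI[of _ "\<lambda>_. v"] exI[of _ "\<lambda>_. v'"] allI v)
  show "v \<in> H1 \<Omega>" by (rule C1_grad_H1(1)[OF v])
  show "v \<in> L2 (surf (frontier \<Omega>))"
    using C1_grad_continuous[OF v] parts_borel by (intro continuous_L2_surf) auto
  have "AE x in \<Lambda>. (norm (v' x - wgrad \<Omega> v x))\<^sup>2 = 0" using C1_grad_H1(2)[OF v] by eventually_elim simp
  then have "(LINT x|\<Lambda>. (norm (v' x - wgrad \<Omega> v x))\<^sup>2) = 0" by (rule integral_eq_zero_AE)
  then show "(\<lambda>n. l2_norm \<Lambda> (\<lambda>x. v' x - wgrad \<Omega> v x)) \<longlonglongrightarrow> 0" by (simp add: l2_norm_def)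
qed (simp_all add: l2_norm_def)

section \<open>Normal traces\<close>

text \<open>Tested with \<open>C\<^sup>1\<close> functions supported in an open set \<open>U\<close>, Green's formula sees the field and its
  divergence on \<open>U\<close> only. The normal trace is therefore unique and local.\<close>

lemma has_ntrace_local:
  assumes n: "has_ntrace \<Omega> \<Gamma> q g" "has_ntrace \<Omega> \<Gamma> q' g'"
    and U: "open U" and eq: "AE x in \<Lambda>. x \<in> U \<longrightarrow> q x = q' x"
  shows "AE x in surf \<Gamma>. x \<in> U \<longrightarrow> g x = g' x"
proof -
  have Hd: "q \<in> Hdiv \<Omega>" "q' \<in> Hdiv \<Omega>" and g: "g \<in> L2 (surf \<Gamma>)" "g' \<in> L2 (surf \<Gamma>)"
    using n by (auto simp: has_ntrace_def)
  note d = Hdiv_wdiv[OF Hd(1)] and d' = Hdiv_wdiv[OF Hd(2)]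
  have eqd: "AE x in \<Lambda>. x \<in> U \<longrightarrow> wdiv \<Omega> q x = wdiv \<Omega> q' x"
    by (rule wdiv_local[OF d(1) d'(1) d(2) d'(2) d(3) d'(3) U eq])
  obtain W where W: "open W" "\<Gamma> = frontier \<Omega> \<inter> W" using relatively_open_Un by blast
  have Hs: "\<Gamma> \<in> sets H" by (rule borel_in_sets_hausdorff[OF \<Gamma>_props(2)])
  have ortho: "(LINT x|restrict_space H \<Gamma>. \<theta> x * (g x - g' x)) = 0" if t: "test_fun (W \<inter> U) \<theta> \<theta>'" for \<theta> \<theta>'
  proof -
    note C = test_fun_C1[OF t] and L = test_fun_L2[OF t]
    have tr: "has_trace \<Omega> \<theta> \<theta>" by (rule has_trace_C1[OF C])
    have van: "AE x in surf (frontier \<Omega> - \<Gamma>). \<theta> x = 0"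
    proof (rule AE_I2)
      fix x assume "x \<in> space (surf (frontier \<Omega> - \<Gamma>))"
      then have "x \<notin> W \<inter> U" using W(2) by (auto simp: surf_def space_restrict_space)
      then show "\<theta> x = 0" using test_fun_outside[OF t] by blast
    qed
    have w: "wgrad \<Omega> \<theta> \<in> L2 \<Lambda>" using H1_wgrad(2)[OF C1_grad_H1(1)[OF C]] .
    have e1: "l2_inner \<Lambda> q (wgrad \<Omega> \<theta>) = l2_inner \<Lambda> q' (wgrad \<Omega> \<theta>)"
      unfolding l2_inner_def
    proof (rule integral_cong_AE)
      show "(\<lambda>x. q x \<bullet> wgrad \<Omega> \<theta> x) \<in> borel_measurable \<Lambda>" "(\<lambda>x. q' x \<bullet> wgrad \<Omega> \<theta> x) \<in> borel_measurable \<Lambda>"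
        using L2_inner_integrable[OF d(1) w] L2_inner_integrable[OF d'(1) w] by auto
      show "AE x in \<Lambda>. q x \<bullet> wgrad \<Omega> \<theta> x = q' x \<bullet> wgrad \<Omega> \<theta> x"
        using eq C1_grad_H1(2)[OF C]
      proof eventually_elim
        case (elim x)
        then show ?case using test_fun_outside[OF t, of x] by (cases "x \<in> U") auto
      qed
    qed
    have e2: "l2_inner \<Lambda> (wdiv \<Omega> q) \<theta> = l2_inner \<Lambda> (wdiv \<Omega> q') \<theta>"
      unfolding l2_inner_def
    proof (rule integral_cong_AE)
      show "(\<lambda>x. wdiv \<Omega> q x \<bullet> \<theta> x) \<in> borel_measurable \<Lambda>" "(\<lambda>x. wdiv \<Omega> q' x \<bullet> \<theta> x) \<in> borel_measurable \<Lambda>"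
        using L2_inner_integrable[OF d(2) L(1)] L2_inner_integrable[OF d'(2) L(1)] by auto
      show "AE x in \<Lambda>. wdiv \<Omega> q x \<bullet> \<theta> x = wdiv \<Omega> q' x \<bullet> \<theta> x"
        using eqd
      proof eventually_elim
        case (elim x)
        then show ?case using test_fun_outside[OF t, of x] by (cases "x \<in> U") auto
      qed
    qed
    have "l2_inner (surf \<Gamma>) g \<theta> = l2_inner (surf \<Gamma>) g' \<theta>"
      using n tr van e1 e2 unfolding has_ntrace_def by metis
    moreover have "\<theta> \<in> L2 (surf \<Gamma>)"
      using C1_grad_continuous(1)[OF C] \<Gamma>_props by (intro continuous_L2_surf)
    ultimately have "(LINT x|surf \<Gamma>. \<theta> x * (g x - g' x)) = 0"
      using L2_mult_integrable[of \<theta> "surf \<Gamma>" g] L2_mult_integrable[of \<theta> "surf \<Gamma>" g'] g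
      by (simp add: l2_inner_def right_diff_distrib mult.commute)
    then show ?thesis by (simp add: surf_def)
  qed
  have int: "integrable (restrict_space H \<Gamma>) (\<lambda>x. g x - g' x)"
    using finite_L2_integrable[OF finite_surf[OF \<Gamma>_props(1,2)] L2_diff[OF g]] by (simp add: surf_def)
  have "AE x in restrict_space H \<Gamma>. x \<in> W \<inter> U \<longrightarrow> g x - g' x = 0"
    by (rule fundamental_lemma[OF borel_regular_hausdorff Hs int open_Int[OF W(1) U] ortho])
  moreover have "AE x in restrict_space H \<Gamma>. x \<in> \<Gamma>" by (rule AE_I2) (auto simp: space_restrict_space)
  ultimately have "AE x in restrict_space H \<Gamma>. x \<in> U \<longrightarrow> g x = g' x"
    by eventually_elim (use W(2) in auto)
  then show ?thesis unfolding surf_def .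
qed

lemma has_ntrace_lin:
  assumes n: "has_ntrace \<Omega> \<Gamma> q g" "has_ntrace \<Omega> \<Gamma> q' g'"
  shows "has_ntrace \<Omega> \<Gamma> (\<lambda>x. a *\<^sub>R q x + b *\<^sub>R q' x) (\<lambda>x. a * g x + b * g' x)"
    and "AE x in \<Lambda>. wdiv \<Omega> (\<lambda>x. a *\<^sub>R q x + b *\<^sub>R q' x) x = a * wdiv \<Omega> q x + b * wdiv \<Omega> q' x"
proof -
  have Hd: "q \<in> Hdiv \<Omega>" "q' \<in> Hdiv \<Omega>" and g: "g \<in> L2 (surf \<Gamma>)" "g' \<in> L2 (surf \<Gamma>)"
    using n by (auto simp: has_ntrace_def)
  note d = Hdiv_wdiv[OF Hd(1)] and d' = Hdiv_wdiv[OF Hd(2)]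
  let ?q = "\<lambda>x. a *\<^sub>R q x + b *\<^sub>R q' x" and ?f = "\<lambda>x. a * wdiv \<Omega> q x + b * wdiv \<Omega> q' x"
  have L: "?q \<in> L2 \<Lambda>" "?f \<in> L2 \<Lambda>" using d d' by (auto intro: L2_add L2_scaleR L2_cmult)
  have wd: "is_wdiv \<Omega> ?q ?f" by (rule is_wdiv_lin[OF d(1) d'(1) d(2) d'(2) d(3) d'(3)])
  have Hq: "?q \<in> Hdiv \<Omega>" using L wd by (auto simp: Hdiv_def)
  note D = Hdiv_wdiv[OF Hq]
  have "AE x in \<Lambda>. x \<in> UNIV \<longrightarrow> wdiv \<Omega> ?q x = ?f x"
    by (rule wdiv_local[OF D(1) L(1) D(2) L(2) D(3) wd open_UNIV]) simp
  then show eq: "AE x in \<Lambda>. wdiv \<Omega> ?q x = ?f x" by simp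
  show "has_ntrace \<Omega> \<Gamma> ?q (\<lambda>x. a * g x + b * g' x)"
    unfolding has_ntrace_def
  proof (intro conjI allI impI Hq)
    show "(\<lambda>x. a * g x + b * g' x) \<in> L2 (surf \<Gamma>)" using g by (auto intro: L2_add L2_cmult)
    fix v w assume vw: "has_trace \<Omega> v w \<and> (AE x in surf (frontier \<Omega> - \<Gamma>). w x = 0)"
    then have v: "v \<in> H1 \<Omega>" and wL: "w \<in> L2 (surf (frontier \<Omega>))" by (auto simp: has_trace_def)
    note V = H1_wgrad[OF v]
    have w\<Gamma>: "w \<in> L2 (surf \<Gamma>)"
      using L2_surf_subset[OF wL _ parts_borel(4) \<Gamma>_props(2)] \<Gamma>_props(1) by (simp add: Diff_eq_empty_iff[THEN iffD2])
    have "l2_inner \<Lambda> ?q (wgrad \<Omega> v) = a * l2_inner \<Lambda> q (wgrad \<Omega> v) + b * l2_inner \<Lambda> q' (wgrad \<Omega> v)"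
      using L2_inner_integrable[OF d(1) V(2)] L2_inner_integrable[OF d'(1) V(2)]
      by (simp add: l2_inner_def inner_add_left)
    moreover have "l2_inner \<Lambda> (wdiv \<Omega> ?q) v = a * l2_inner \<Lambda> (wdiv \<Omega> q) v + b * l2_inner \<Lambda> (wdiv \<Omega> q') v"
    proof -
      have "l2_inner \<Lambda> (wdiv \<Omega> ?q) v = (LINT x|\<Lambda>. ?f x * v x)"
        unfolding l2_inner_def
      proof (rule integral_cong_AE)
        show "(\<lambda>x. wdiv \<Omega> ?q x \<bullet> v x) \<in> borel_measurable \<Lambda>" "(\<lambda>x. ?f x * v x) \<in> borel_measurable \<Lambda>"
          using L2_inner_integrable[OF D(2) V(1)] L2_mult_integrable[OF L(2) V(1)] by auto
        show "AE x in \<Lambda>. wdiv \<Omega> ?q x \<bullet> v x = ?f x * v x" using eq by eventually_elim simp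
      qed
      also have "\<dots> = (LINT x|\<Lambda>. a * (wdiv \<Omega> q x * v x) + b * (wdiv \<Omega> q' x * v x))"
        by (simp add: distrib_right mult.assoc)
      finally show ?thesis
        using L2_mult_integrable[OF d(2) V(1)] L2_mult_integrable[OF d'(2) V(1)] by (simp add: l2_inner_def)
    qed
    moreover have "l2_inner (surf \<Gamma>) (\<lambda>x. a * g x + b * g' x) w = a * l2_inner (surf \<Gamma>) g w + b * l2_inner (surf \<Gamma>) g' w"
    proof -
      have "l2_inner (surf \<Gamma>) (\<lambda>x. a * g x + b * g' x) w = (LINT x|surf \<Gamma>. a * (g x * w x) + b * (g' x * w x))"
        by (simp add: l2_inner_def distrib_right mult.assoc)
      then show ?thesis
        using L2_mult_integrable[OF g(1) w\<Gamma>] L2_mult_integrable[OF g(2) w\<Gamma>] by (simp add: l2_inner_def)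
    qed
    moreover have "l2_inner \<Lambda> q (wgrad \<Omega> v) + l2_inner \<Lambda> (wdiv \<Omega> q) v = l2_inner (surf \<Gamma>) g w"
      "l2_inner \<Lambda> q' (wgrad \<Omega> v) + l2_inner \<Lambda> (wdiv \<Omega> q') v = l2_inner (surf \<Gamma>) g' w"
      using n vw unfolding has_ntrace_def by blast+
    ultimately show "l2_inner \<Lambda> ?q (wgrad \<Omega> v) + l2_inner \<Lambda> (wdiv \<Omega> ?q) v = l2_inner (surf \<Gamma>) (\<lambda>x. a * g x + b * g' x) w"
      by (simp add: algebra_simps) (smt (verit) distrib_left)
  qed
qed

end

section \<open>Weighted estimates\<close>

lemma mact_nth: "mact A p $ r = (\<Sum>c\<in>UNIV. A $ r $ c *\<^sub>R p $ c)"
  by (simp add: mact_def)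

lemma mact_real: "mact A (x :: real ^ 'i) = A *v x"
  by (simp add: vec_eq_iff mact_nth matrix_vector_mult_def)

definition diag_sqrt :: "real ^ 'i ^ 'i \<Rightarrow> real ^ 'i ^ 'i" where
  "diag_sqrt A = (\<chi> r c. if r = c then sqrt (A $ r $ r) else 0)"

lemma mact_diag_nth:
  "mact (diag_sqrt A) p $ r = sqrt (A $ r $ r) *\<^sub>R p $ r"
  "mact (diag_inv_sqrt A) p $ r = (1 / sqrt (A $ r $ r)) *\<^sub>R p $ r"
  "mact (diag_part A) p $ r = (A $ r $ r) *\<^sub>R p $ r"
  by (simp_all add: mact_nth diag_sqrt_def diag_inv_sqrt_def diag_part_def if_distrib[of "\<lambda>z. z *\<^sub>R _"] cong: if_cong)

text \<open>The pairing is unchanged when one factor is scaled by the inverse square roots of the diagonal entries and the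
  other by the square roots.\<close>

lemma diag_dual:
  fixes u q :: "'b::euclidean_space ^ 'i"
  assumes pos: "\<And>r. 0 < T $ r $ r"
  shows "\<bar>u \<bullet> q\<bar> \<le> norm (mact (diag_inv_sqrt T) u) * norm (mact (diag_sqrt T) q)"
    and "(norm (mact (diag_sqrt T) q))\<^sup>2 = mact (diag_part T) q \<bullet> q"
proof -
  have "u \<bullet> q = mact (diag_inv_sqrt T) u \<bullet> mact (diag_sqrt T) q"
    unfolding inner_vec_def mact_diag_nth using pos by (intro sum.cong refl) (simp add: less_imp_neq[symmetric])
  then show "\<bar>u \<bullet> q\<bar> \<le> norm (mact (diag_inv_sqrt T) u) * norm (mact (diag_sqrt T) q)"
    by (simp add: Cauchy_Schwarz_ineq2)
  show "(norm (mact (diag_sqrt T) q))\<^sup>2 = mact (diag_part T) q \<bullet> q"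
    unfolding power2_norm_eq_inner inner_vec_def mact_diag_nth using pos
    by (intro sum.cong refl) (simp add: less_imp_le)
qed

text \<open>The properties of \<open>Te\<close> and \<open>To\<close> under which multiplication by the matrix, by the square root of its
  diagonal, and by the inverse of that root all preserve square integrability.\<close>

definition coercive_diag :: "'a measure \<Rightarrow> ('a \<Rightarrow> real ^ 'i ^ 'i) \<Rightarrow> bool" where
  "coercive_diag M T \<longleftrightarrow> (\<forall>r c. (\<lambda>x. T x $ r $ c) \<in> borel_measurable M) \<and>
     (\<exists>C. AE x in M. \<forall>r c. \<bar>T x $ r $ c\<bar> \<le> C) \<and> (\<exists>lo>0. AE x in M. \<forall>r. lo \<le> T x $ r $ r)"

lemma coercive_diag_pos:
  assumes "coercive_diag M T" shows "AE x in M. \<forall>r. 0 < T x $ r $ r"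
proof -
  obtain lo where "0 < lo" and "AE x in M. \<forall>r. lo \<le> T x $ r $ r" using assms by (auto simp: coercive_diag_def)
  note this(2)
  then show ?thesis by eventually_elim (use \<open>0 < lo\<close> in \<open>auto intro: less_le_trans\<close>)
qed

lemma L2_mact:
  fixes u :: "'a \<Rightarrow> 'b::euclidean_space ^ 'i"
  assumes T: "coercive_diag M T" and u: "u \<in> L2 M"
  shows "(\<lambda>x. mact (T x) (u x)) \<in> L2 M"
    and "(\<lambda>x. mact (diag_sqrt (T x)) (u x)) \<in> L2 M"
    and "(\<lambda>x. mact (diag_inv_sqrt (T x)) (u x)) \<in> L2 M"
proof -
  have m: "\<And>r c. (\<lambda>x. T x $ r $ c) \<in> borel_measurable M" using T by (simp add: coercive_diag_def)
  have ui: "(\<lambda>x. u x $ i) \<in> L2 M" for i using u by (simp add: L2_vec)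
  obtain C where C: "AE x in M. \<forall>r c. \<bar>T x $ r $ c\<bar> \<le> C" using T by (auto simp: coercive_diag_def)
  obtain lo where lo: "0 < lo" "AE x in M. \<forall>r. lo \<le> T x $ r $ r" using T by (auto simp: coercive_diag_def)
  show "(\<lambda>x. mact (T x) (u x)) \<in> L2 M"
    unfolding L2_vec mact_nth
  proof (intro allI L2_sum)
    fix r c
    have "AE x in M. \<bar>T x $ r $ c\<bar> \<le> C" using C by eventually_elim simp
    then show "(\<lambda>x. T x $ r $ c *\<^sub>R u x $ c) \<in> L2 M" by (rule L2_bounded_scaleR[OF ui m])
  qed
  have "(\<lambda>x. sqrt (T x $ r $ r)) \<in> borel_measurable M" for r using m by measurable
  moreover have "AE x in M. \<bar>sqrt (T x $ r $ r)\<bar> \<le> sqrt C" for r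
    using C
  proof eventually_elim
    case (elim x)
    have "\<bar>sqrt (T x $ r $ r)\<bar> = sqrt \<bar>T x $ r $ r\<bar>"
      by (cases "0 \<le> T x $ r $ r") (auto simp: real_sqrt_minus abs_if)
    then show ?case using elim by simp
  qed
  ultimately show "(\<lambda>x. mact (diag_sqrt (T x)) (u x)) \<in> L2 M"
    unfolding L2_vec mact_diag_nth by (intro allI L2_bounded_scaleR[OF ui])
  have "(\<lambda>x. 1 / sqrt (T x $ r $ r)) \<in> borel_measurable M" for r using m by measurable
  moreover have "AE x in M. \<bar>1 / sqrt (T x $ r $ r)\<bar> \<le> 1 / sqrt lo" for r
    using lo(2)
  proof eventually_elim
    case (elim x)
    then have "sqrt lo \<le> sqrt (T x $ r $ r)" by simp
    moreover have "0 < sqrt lo" using lo(1) by simp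
    ultimately show ?case by (simp add: frac_le)
  qed
  ultimately show "(\<lambda>x. mact (diag_inv_sqrt (T x)) (u x)) \<in> L2 M"
    unfolding L2_vec mact_diag_nth by (intro allI L2_bounded_scaleR[OF ui])
qed

lemma L2_const_mact:
  fixes u :: "'a \<Rightarrow> 'b::euclidean_space ^ 'i"
  assumes u: "u \<in> L2 M" shows "(\<lambda>x. mact A (u x)) \<in> L2 M"
  using u unfolding L2_vec mact_nth by (intro allI L2_sum L2_scaleR) simp

lemma L2_matrix_vector:
  fixes u :: "'a \<Rightarrow> real ^ 'i" and A :: "real ^ 'i ^ 'i"
  assumes u: "u \<in> L2 M" shows "(\<lambda>x. A *v u x) \<in> L2 M"
  using L2_const_mact[OF u, of A] by (simp only: mact_real)

lemma l2_inner_const_mact: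
  fixes u w :: "'a \<Rightarrow> 'b::euclidean_space ^ 'i"
  assumes u: "u \<in> L2 M" and w: "w \<in> L2 M"
  shows "l2_inner M (\<lambda>x. mact A (u x)) w = (\<Sum>r\<in>UNIV. \<Sum>c\<in>UNIV. A $ r $ c * l2_inner M (\<lambda>x. u x $ c) (\<lambda>x. w x $ r))"
proof -
  have i: "integrable M (\<lambda>x. u x $ c \<bullet> w x $ r)" for r c
    using u w by (intro L2_inner_integrable) (simp_all add: L2_vec)
  have "l2_inner M (\<lambda>x. mact A (u x)) w = (LINT x|M. (\<Sum>r\<in>UNIV. \<Sum>c\<in>UNIV. A $ r $ c * (u x $ c \<bullet> w x $ r)))"
    by (simp add: l2_inner_def inner_vec_def mact_nth inner_sum_left)
  then show ?thesis using i by (simp add: l2_inner_def)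
qed

lemma l2_norm_sq: "(l2_norm M f)\<^sup>2 = (LINT x|M. (norm (f x))\<^sup>2)" by (simp add: l2_norm_def)

lemma weighted_Cauchy_Schwarz:
  assumes "u \<in> L2 N" "w \<in> L2 N" "integrable N h" "AE x in N. \<bar>h x\<bar> \<le> norm (u x) * norm (w x)"
  shows "(LINT x|N. \<bar>h x\<bar>) \<le> l2_norm N u * l2_norm N w"
proof -
  have "integrable N (\<lambda>x. norm (u x) * norm (w x))"
    using L2_inner_integrable[OF L2_norm_L2[OF assms(1)] L2_norm_L2[OF assms(2)]] by simp
  then have "(LINT x|N. \<bar>h x\<bar>) \<le> (LINT x|N. norm (u x) * norm (w x))"
    using assms(3,4) by (intro integral_mono_AE) auto
  also have "\<dots> \<le> l2_norm N u * l2_norm N w" by (rule L2_Cauchy_Schwarz[OF assms(1,2)])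
  finally show ?thesis .
qed

text \<open>The Cauchy-Schwarz inequality of the product of three Euclidean spaces, of which the first is the real line.\<close>

lemma sum3_Cauchy_Schwarz:
  fixes a b :: real and f g :: "'k \<Rightarrow> real" and u v :: "'l \<Rightarrow> real"
  shows "a * b + (\<Sum>i\<in>I. f i * g i) + (\<Sum>j\<in>J. u j * v j)
    \<le> sqrt (a\<^sup>2 + (\<Sum>i\<in>I. (f i)\<^sup>2) + (\<Sum>j\<in>J. (u j)\<^sup>2)) * sqrt (b\<^sup>2 + (\<Sum>i\<in>I. (g i)\<^sup>2) + (\<Sum>j\<in>J. (v j)\<^sup>2))"
proof -
  let ?F = "L2_set f I" and ?G = "L2_set g I" and ?U = "L2_set u J" and ?V = "L2_set v J"
  have fg: "(\<Sum>i\<in>I. f i * g i) \<le> ?F * ?G"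
    by (rule order_trans[OF sum_mono L2_set_mult_ineq]) (simp add: abs_mult[symmetric])
  have uv: "(\<Sum>j\<in>J. u j * v j) \<le> ?U * ?V"
    by (rule order_trans[OF sum_mono L2_set_mult_ineq]) (simp add: abs_mult[symmetric])
  have F: "?F\<^sup>2 = (\<Sum>i\<in>I. (f i)\<^sup>2)" "?G\<^sup>2 = (\<Sum>i\<in>I. (g i)\<^sup>2)" "?U\<^sup>2 = (\<Sum>j\<in>J. (u j)\<^sup>2)" "?V\<^sup>2 = (\<Sum>j\<in>J. (v j)\<^sup>2)"
    by (simp_all add: L2_set_def sum_nonneg)
  let ?x = "\<lambda>k::nat. if k = 0 then a else if k = 1 then ?F else ?U"
  let ?y = "\<lambda>k::nat. if k = 0 then b else if k = 1 then ?G else ?V"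
  have "a * b + ?F * ?G + ?U * ?V = (\<Sum>k\<in>{0,1,2}. ?x k * ?y k)" by simp
  also have "\<dots> \<le> (\<Sum>k\<in>{0,1,2}. \<bar>?x k\<bar> * \<bar>?y k\<bar>)" by (intro sum_mono) (simp add: abs_mult[symmetric])
  also have "\<dots> \<le> L2_set ?x {0,1,2} * L2_set ?y {0,1,2}" by (rule L2_set_mult_ineq)
  also have "\<dots> = sqrt (a\<^sup>2 + ?F\<^sup>2 + ?U\<^sup>2) * sqrt (b\<^sup>2 + ?G\<^sup>2 + ?V\<^sup>2)" by (simp add: L2_set_def add.assoc)
  finally show ?thesis unfolding F using fg uv by linarith
qed

section \<open>Integrals over elements and facets\<close>

text \<open>The sets \<open>B i\<close> may overlap, which only increases the right-hand side.\<close>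

lemma integral_cover_bound:
  fixes h :: "'a \<Rightarrow> real"
  assumes M: "complete_measure M" and A: "A \<in> sets M" and I: "finite I"
    and B: "\<And>i. i \<in> I \<Longrightarrow> B i \<in> sets M" "\<And>i. i \<in> I \<Longrightarrow> B i - A \<in> null_sets M"
    and h: "integrable (restrict_space M A) h"
    and zero: "AE x in M. x \<in> A \<longrightarrow> x \<notin> (\<Union>i\<in>I. B i) \<longrightarrow> h x = 0"
  shows "\<bar>LINT x|restrict_space M A. h x\<bar> \<le> (\<Sum>i\<in>I. LINT x|restrict_space M (B i). \<bar>h x\<bar>)"
proof -
  have sp: "A \<inter> space M \<in> sets M" "\<And>i. i \<in> I \<Longrightarrow> B i \<inter> space M \<in> sets M" using A B by auto
  have hB: "integrable (restrict_space M (B i)) (\<lambda>x. \<bar>h x\<bar>)" if "i \<in> I" for i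
    using restrict_space_AE_subset(2)[OF M B(1)[OF that] A B(2)[OF that] h] by simp
  have iB: "integrable M (\<lambda>x. indicator (B i) x *\<^sub>R \<bar>h x\<bar>)" if "i \<in> I" for i
    using hB[OF that] unfolding integrable_restrict_space[OF sp(2)[OF that]] .
  have iA: "integrable M (\<lambda>x. indicator A x *\<^sub>R \<bar>h x\<bar>)"
    using integrable_abs[OF h] unfolding integrable_restrict_space[OF sp(1)] .
  have "\<bar>LINT x|restrict_space M A. h x\<bar> \<le> (LINT x|restrict_space M A. \<bar>h x\<bar>)"
    by (rule integral_abs_bound)
  also have "\<dots> = (LINT x|M. indicator A x *\<^sub>R \<bar>h x\<bar>)" by (rule integral_restrict_space[OF sp(1)])
  also have "\<dots> \<le> (LINT x|M. (\<Sum>i\<in>I. indicator (B i) x *\<^sub>R \<bar>h x\<bar>))"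
  proof (rule integral_mono_AE[OF iA])
    show "integrable M (\<lambda>x. (\<Sum>i\<in>I. indicator (B i) x *\<^sub>R \<bar>h x\<bar>))" using iB by (intro Bochner_Integration.integrable_sum)
    show "AE x in M. indicator A x *\<^sub>R \<bar>h x\<bar> \<le> (\<Sum>i\<in>I. indicator (B i) x *\<^sub>R \<bar>h x\<bar>)"
      using zero
    proof eventually_elim
      case (elim x)
      have nonneg: "0 \<le> (\<Sum>i\<in>I. indicator (B i) x *\<^sub>R \<bar>h x\<bar>)" by (intro sum_nonneg) simp
      show ?case
      proof (cases "x \<in> A \<and> h x \<noteq> 0")
        case True
        then obtain i where i: "i \<in> I" "x \<in> B i" using elim by blast
        have "indicator (B i) x *\<^sub>R \<bar>h x\<bar> \<le> (\<Sum>i\<in>I. indicator (B i) x *\<^sub>R \<bar>h x\<bar>)"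
          using I by (intro member_le_sum[OF i(1)]) auto
        then show ?thesis using True i by simp
      next
        case False
        then have "indicator A x *\<^sub>R \<bar>h x\<bar> = 0" by (auto simp: indicator_def)
        from this nonneg show ?thesis by (rule ord_eq_le_trans)
      qed
    qed
  qed
  also have "\<dots> = (\<Sum>i\<in>I. LINT x|M. indicator (B i) x *\<^sub>R \<bar>h x\<bar>)"
    using iB by (rule Bochner_Integration.integral_sum)
  also have "\<dots> = (\<Sum>i\<in>I. LINT x|restrict_space M (B i). \<bar>h x\<bar>)"
    by (intro sum.cong refl integral_restrict_space[symmetric] sp)
  finally show ?thesis .
qed

lemma integral_disjoint_bound:
  fixes f :: "'a \<Rightarrow> real"
  assumes M: "complete_measure M" and A: "A \<in> sets M" and I: "finite I"
    and B: "\<And>i. i \<in> I \<Longrightarrow> B i \<in> sets M" "\<And>i. i \<in> I \<Longrightarrow> B i - A \<in> null_sets M"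
    and disj: "\<And>i j. i \<in> I \<Longrightarrow> j \<in> I \<Longrightarrow> i \<noteq> j \<Longrightarrow> B i \<inter> B j \<in> null_sets M"
    and f: "integrable (restrict_space M A) f" "\<And>x. 0 \<le> f x"
  shows "(\<Sum>i\<in>I. LINT x|restrict_space M (B i). f x) \<le> (LINT x|restrict_space M A. f x)"
proof -
  have sp: "A \<inter> space M \<in> sets M" "\<And>i. i \<in> I \<Longrightarrow> B i \<inter> space M \<in> sets M" using A B by auto
  have iB: "integrable M (\<lambda>x. indicator (B i) x *\<^sub>R f x)" if "i \<in> I" for i
    using restrict_space_AE_subset(2)[OF M B(1)[OF that] A B(2)[OF that] f(1)]
    unfolding integrable_restrict_space[OF sp(2)[OF that]] .
  have iA: "integrable M (\<lambda>x. indicator A x *\<^sub>R f x)"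
    using f(1) unfolding integrable_restrict_space[OF sp(1)] .
  have "(\<Sum>i\<in>I. LINT x|restrict_space M (B i). f x) = (\<Sum>i\<in>I. LINT x|M. indicator (B i) x *\<^sub>R f x)"
    by (intro sum.cong refl integral_restrict_space sp)
  also have "\<dots> = (LINT x|M. (\<Sum>i\<in>I. indicator (B i) x *\<^sub>R f x))"
    using iB by (rule Bochner_Integration.integral_sum[symmetric])
  also have "\<dots> \<le> (LINT x|M. indicator A x *\<^sub>R f x)"
  proof (rule integral_mono_AE[OF _ iA])
    show "integrable M (\<lambda>x. (\<Sum>i\<in>I. indicator (B i) x *\<^sub>R f x))" using iB by (intro Bochner_Integration.integrable_sum)
    have "AE x in M. \<forall>i\<in>I. x \<notin> B i - A" using I B(2) by (intro AE_finite_allI AE_not_in)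
    moreover have "AE x in M. \<forall>i\<in>I. \<forall>j\<in>I - {i}. x \<notin> B i \<inter> B j"
      using I disj by (intro AE_finite_allI AE_not_in) auto
    ultimately show "AE x in M. (\<Sum>i\<in>I. indicator (B i) x *\<^sub>R f x) \<le> indicator A x *\<^sub>R f x"
    proof eventually_elim
      case (elim x)
      show ?case
      proof (cases "\<exists>i\<in>I. x \<in> B i")
        case True
        then obtain i where i: "i \<in> I" "x \<in> B i" by blast
        have "(\<Sum>j\<in>I. indicator (B j) x *\<^sub>R f x) = (\<Sum>j\<in>I. if j = i then f x else 0)"
        proof (intro sum.cong refl)
          fix j assume j: "j \<in> I"
          show "indicator (B j) x *\<^sub>R f x = (if j = i then f x else 0)"
          proof (cases "j = i")
            case False
            then have "x \<notin> B j" using elim(2) i j by blast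
            then show ?thesis using False by simp
          qed (simp add: i)
        qed
        also have "\<dots> = f x" using I i by simp
        finally have "(\<Sum>j\<in>I. indicator (B j) x *\<^sub>R f x) = f x" .
        moreover have "x \<in> A" using elim(1) i by blast
        ultimately show ?thesis by simp
      next
        case False
        then have "(\<Sum>j\<in>I. indicator (B j) x *\<^sub>R f x) = 0" by (intro sum.neutral) (auto simp: indicator_def)
        then show ?thesis using f(2) by (simp add: indicator_def)
      qed
    qed
  qed
  also have "\<dots> = (LINT x|restrict_space M A. f x)" by (rule integral_restrict_space[OF sp(1), symmetric])
  finally show ?thesis .
qed

lemma complete_lebesgue: "complete_measure lebesgue"
  by (rule completion.complete_measure_axioms)

context lipschitz_mesh
begin

lemma AE_\<Lambda>: "(AE x in \<Lambda>. Q x) \<longleftrightarrow> (AE x in lebesgue. x \<in> \<Omega> \<longrightarrow> Q x)"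
  by (rule AE_restrict_space_iff[OF \<Omega>_sets(2)])

lemma frontier_negligible: "negligible (frontier \<Omega>)"
proof -
  have "negligible F" if "F \<in> boundary_facets \<Omega> \<T>" for F
    using negligible_subset[OF element_props(9)[OF facet_element[OF that]]
        facet_props(7)[OF facet_element[OF that] boundary_facetE(2)[OF that]]] .
  then have "negligible (\<Union>(boundary_facets \<Omega> \<T>))"
    using finite_boundary_facets by (intro negligible_Union)
  then show ?thesis by (simp add: mesh_props(4))
qed

lemma element_lebesgue:
  assumes K: "K \<in> \<T>" shows "K \<in> sets lebesgue" "K - \<Omega> \<in> null_sets lebesgue"
proof -
  show "K \<in> sets lebesgue" using element_props(3)[OF mesh_element(1)[OF K]] by auto
  have "K - \<Omega> \<subseteq> frontier \<Omega>"
    using mesh_element(2)[OF K] domain_props(1) by (auto simp: frontier_def interior_open)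
  then show "K - \<Omega> \<in> null_sets lebesgue"
    using negligible_subset[OF frontier_negligible] by (simp add: negligible_iff_null_sets)
qed

lemma elements_overlap:
  assumes "K \<in> \<T>" "K' \<in> \<T>" "K \<noteq> K'" shows "K \<inter> K' \<in> null_sets lebesgue"
proof -
  have "interior K \<inter> interior K' = {}" using mesh_props(3) assms by (auto simp: pairwise_def)
  then have "K \<inter> K' \<subseteq> frontier K \<union> frontier K'"
    using closure_subset[of K] closure_subset[of K'] by (auto simp: frontier_def)
  moreover have "negligible (frontier K \<union> frontier K')"
    using assms(1,2) element_props(9)[OF mesh_element(1)] by (intro negligible_Un) auto
  ultimately show ?thesis using negligible_subset by (simp add: negligible_iff_null_sets) blast
qed

lemma L2_element: "K \<in> \<T> \<Longrightarrow> f \<in> L2 \<Lambda> \<Longrightarrow> f \<in> L2 (lebesgue_on K)"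
  by (rule L2_restrict_AE_subset[OF complete_lebesgue element_lebesgue(1) \<Omega>_sets(1) element_lebesgue(2)])

lemma AE_element:
  assumes K: "K \<in> \<T>" and Q: "AE x in \<Lambda>. Q x" shows "AE x in lebesgue_on K. Q x"
proof -
  have "AE x in lebesgue. x \<in> K \<longrightarrow> Q x"
    using Q[unfolded AE_\<Lambda>] AE_not_in[OF element_lebesgue(2)[OF K]] by eventually_elim auto
  then show ?thesis using element_lebesgue(1)[OF K] by (subst AE_restrict_space_iff) auto
qed

text \<open>The essential supremum is a real number because the coefficient is bounded and the element has positive
  measure; this keeps the conversion from extended reals from collapsing to 0.\<close>

lemma delta_max_pos:
  assumes T: "coercive_diag \<Lambda> T" and K: "K \<in> \<T>"
  shows "0 < delta_max T K"
proof -
  obtain C where C: "AE x in \<Lambda>. \<forall>r c. \<bar>T x $ r $ c\<bar> \<le> C" using T by (auto simp: coercive_diag_def)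
  obtain lo where lo: "0 < lo" "AE x in \<Lambda>. \<forall>r. lo \<le> T x $ r $ r" using T by (auto simp: coercive_diag_def)
  fix r
  let ?s = "esssup (lebesgue_on K) (\<lambda>x. ereal (T x $ r $ r))"
  have "(\<lambda>x. T x $ r $ r) \<in> borel_measurable \<Lambda>" using T by (simp add: coercive_diag_def)
  then have "(\<lambda>x. T x $ r $ r) \<in> borel_measurable (lebesgue_on K)"
    by (rule restrict_space_AE_subset(1)[OF complete_lebesgue element_lebesgue(1)[OF K] \<Omega>_sets(1) element_lebesgue(2)[OF K]])
  then have m: "(\<lambda>x. ereal (T x $ r $ r)) \<in> borel_measurable (lebesgue_on K)" by measurable
  have "?s \<le> ereal C"
  proof (rule esssup_I[OF m])
    show "AE x in lebesgue_on K. ereal (T x $ r $ r) \<le> ereal C"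
      using AE_element[OF K C]
    proof eventually_elim
      case (elim x)
      then show ?case using abs_le_D1 by auto
    qed
  qed
  moreover have "ereal lo \<le> ?s"
  proof -
    have "AE x in lebesgue_on K. ereal lo \<le> ?s"
      using AE_element[OF K lo(2)] esssup_AE[of "\<lambda>x. ereal (T x $ r $ r)" "lebesgue_on K"]
    proof eventually_elim
      case (elim x)
      then have "ereal lo \<le> ereal (T x $ r $ r)" by simp
      then show ?case using elim(2) by (rule order_trans)
    qed
    moreover have "\<not> (AE x in lebesgue_on K. False)"
    proof
      assume "AE x in lebesgue_on K. False"
      then have "AE x in lebesgue. x \<notin> K" using element_lebesgue(1)[OF K] by (subst (asm) AE_restrict_space_iff) auto
      then have "K \<in> null_sets lebesgue" using element_lebesgue(1)[OF K] by (simp add: AE_iff_null_sets)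
      then have "negligible (interior K)"
        using negligible_subset[OF _ interior_subset] by (simp add: negligible_iff_null_sets)
      then show False using open_not_negligible[OF open_interior] element_props(5)[OF mesh_element(1)[OF K]] by blast
    qed
    ultimately show ?thesis by (cases "ereal lo \<le> ?s") auto
  qed
  ultimately have "0 < real_of_ereal ?s" using lo(1) by (cases ?s) auto
  also have "\<dots> \<le> delta_max T K" unfolding delta_max_def by (intro Max_ge) auto
  finally show ?thesis .
qed

end

section \<open>Fluxes and potentials\<close>

lemma diff_subset_null: "A \<subseteq> B \<Longrightarrow> A - B \<in> null_sets M"
  by (simp add: Diff_eq_empty_iff[THEN iffD2])

context lipschitz_mesh
begin

lemma AE_surf_subset:
  assumes Q: "AE x in surf B. Q x" and AB: "A - B \<in> null_sets H" "A \<in> sets borel" "B \<in> sets borel"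
  shows "AE x in surf A. Q x"
proof -
  have "AE x in H. x \<in> B \<longrightarrow> Q x" using Q by (simp only: AE_surf[OF AB(3)])
  then have "AE x in H. x \<in> A \<longrightarrow> Q x" using AE_not_in[OF AB(1)] by eventually_elim blast
  then show ?thesis by (simp only: AE_surf[OF AB(2)])
qed

text \<open>All functions that qualify as normal trace agree almost everywhere, so the chosen one inherits the homogeneous
  Neumann condition.\<close>

lemma Q_ntrace:
  assumes "q \<in> Q_space \<Omega> \<Gamma>V \<Gamma>N"
  shows "has_ntrace \<Omega> \<Gamma> q (ntrace \<Omega> \<Gamma> q)" "AE x in surf \<Gamma>N. ntrace \<Omega> \<Gamma> q x = 0"
proof -
  obtain g where g: "has_ntrace \<Omega> \<Gamma> q g" "AE x in surf \<Gamma>N. g x = 0" using assms by (auto simp: Q_space_def)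
  show n: "has_ntrace \<Omega> \<Gamma> q (ntrace \<Omega> \<Gamma> q)" 
    unfolding ntrace_def using g(1) by (rule someI[where P="has_ntrace \<Omega> \<Gamma> q"])
  have "AE x in surf \<Gamma>. x \<in> UNIV \<longrightarrow> ntrace \<Omega> \<Gamma> q x = g x"
    by (rule has_ntrace_local[OF n g(1) open_UNIV]) simp
  then have "AE x in surf \<Gamma>N. x \<in> UNIV \<longrightarrow> ntrace \<Omega> \<Gamma> q x = g x"
    by (rule AE_surf_subset[OF _ diff_subset_null parts_borel(3) \<Gamma>_props(2)]) simp
  then show "AE x in surf \<Gamma>N. ntrace \<Omega> \<Gamma> q x = 0" using g(2) by eventually_elim simp
qed

lemma Q_lin:
  assumes q: "q \<in> Q_space \<Omega> \<Gamma>V \<Gamma>N" "q' \<in> Q_space \<Omega> \<Gamma>V \<Gamma>N"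
  shows "(\<lambda>x. a *\<^sub>R q x + b *\<^sub>R q' x) \<in> Q_space \<Omega> \<Gamma>V \<Gamma>N"
    and "AE x in surf \<Gamma>. ntrace \<Omega> \<Gamma> (\<lambda>x. a *\<^sub>R q x + b *\<^sub>R q' x) x = a * ntrace \<Omega> \<Gamma> q x + b * ntrace \<Omega> \<Gamma> q' x"
    and "AE x in \<Lambda>. wdiv \<Omega> (\<lambda>x. a *\<^sub>R q x + b *\<^sub>R q' x) x = a * wdiv \<Omega> q x + b * wdiv \<Omega> q' x"
proof -
  note n = Q_ntrace[OF q(1)] and n' = Q_ntrace[OF q(2)]
  note l = has_ntrace_lin[OF n(1) n'(1), of a b]
  have "AE x in surf \<Gamma>N. a * ntrace \<Omega> \<Gamma> q x + b * ntrace \<Omega> \<Gamma> q' x = 0"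
    using n(2) n'(2) by eventually_elim simp
  then show Q: "(\<lambda>x. a *\<^sub>R q x + b *\<^sub>R q' x) \<in> Q_space \<Omega> \<Gamma>V \<Gamma>N"
    using l(1) unfolding Q_space_def by blast
  have "AE x in surf \<Gamma>. x \<in> UNIV \<longrightarrow>
      ntrace \<Omega> \<Gamma> (\<lambda>x. a *\<^sub>R q x + b *\<^sub>R q' x) x = a * ntrace \<Omega> \<Gamma> q x + b * ntrace \<Omega> \<Gamma> q' x"
    by (rule has_ntrace_local[OF Q_ntrace(1)[OF Q] l(1) open_UNIV]) simp
  then show "AE x in surf \<Gamma>. ntrace \<Omega> \<Gamma> (\<lambda>x. a *\<^sub>R q x + b *\<^sub>R q' x) x = a * ntrace \<Omega> \<Gamma> q x + b * ntrace \<Omega> \<Gamma> q' x"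
    by simp
  show "AE x in \<Lambda>. wdiv \<Omega> (\<lambda>x. a *\<^sub>R q x + b *\<^sub>R q' x) x = a * wdiv \<Omega> q x + b * wdiv \<Omega> q' x" by (rule l(2))
qed

lemma Q_L2:
  assumes "q \<in> Q_space \<Omega> \<Gamma>V \<Gamma>N"
  shows "q \<in> L2 \<Lambda>" "wdiv \<Omega> q \<in> L2 \<Lambda>" "ntrace \<Omega> \<Gamma> q \<in> L2 (surf \<Gamma>)"
proof -
  have n: "q \<in> Hdiv \<Omega>" "ntrace \<Omega> \<Gamma> q \<in> L2 (surf \<Gamma>)"
    using Q_ntrace(1)[OF assms] by (simp_all add: has_ntrace_def)
  show "q \<in> L2 \<Lambda>" "wdiv \<Omega> q \<in> L2 \<Lambda>" "ntrace \<Omega> \<Gamma> q \<in> L2 (surf \<Gamma>)"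
    using Hdiv_wdiv(1,2)[OF n(1)] n(2) by simp_all
qed

lemma multi_Q_L2:
  assumes "q \<in> multi (Q_space \<Omega> \<Gamma>V \<Gamma>N)"
  shows "q \<in> L2 \<Lambda>" "mdiv \<Omega> q \<in> L2 \<Lambda>" "mntrace \<Omega> \<Gamma>V \<Gamma>N q \<in> L2 (surf \<Gamma>)"
proof -
  have c: "(\<lambda>x. q x $ i) \<in> Q_space \<Omega> \<Gamma>V \<Gamma>N" for i using assms by (simp add: multi_def)
  show "q \<in> L2 \<Lambda>" "mdiv \<Omega> q \<in> L2 \<Lambda>" "mntrace \<Omega> \<Gamma>V \<Gamma>N q \<in> L2 (surf \<Gamma>)"
    using Q_L2[OF c] by (simp_all add: L2_vec mdiv_def mntrace_def)
qed

lemma multi_Q_lin: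
  assumes q: "q \<in> multi (Q_space \<Omega> \<Gamma>V \<Gamma>N)" "q' \<in> multi (Q_space \<Omega> \<Gamma>V \<Gamma>N)"
  shows "(\<lambda>x. a *\<^sub>R q x + b *\<^sub>R q' x) \<in> multi (Q_space \<Omega> \<Gamma>V \<Gamma>N)"
    and "AE x in surf \<Gamma>. mntrace \<Omega> \<Gamma>V \<Gamma>N (\<lambda>x. a *\<^sub>R q x + b *\<^sub>R q' x) x
      = a *\<^sub>R mntrace \<Omega> \<Gamma>V \<Gamma>N q x + b *\<^sub>R mntrace \<Omega> \<Gamma>V \<Gamma>N q' x"
    and "AE x in \<Lambda>. mdiv \<Omega> (\<lambda>x. a *\<^sub>R q x + b *\<^sub>R q' x) x = a *\<^sub>R mdiv \<Omega> q x + b *\<^sub>R mdiv \<Omega> q' x"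
proof -
  have c: "(\<lambda>x. q x $ i) \<in> Q_space \<Omega> \<Gamma>V \<Gamma>N" "(\<lambda>x. q' x $ i) \<in> Q_space \<Omega> \<Gamma>V \<Gamma>N" for i
    using q by (auto simp: multi_def)
  have l: "(\<lambda>x. a *\<^sub>R q x $ i + b *\<^sub>R q' x $ i) \<in> Q_space \<Omega> \<Gamma>V \<Gamma>N"
    "AE x in surf \<Gamma>. ntrace \<Omega> \<Gamma> (\<lambda>x. a *\<^sub>R q x $ i + b *\<^sub>R q' x $ i) x
      = a * ntrace \<Omega> \<Gamma> (\<lambda>x. q x $ i) x + b * ntrace \<Omega> \<Gamma> (\<lambda>x. q' x $ i) x"
    "AE x in \<Lambda>. wdiv \<Omega> (\<lambda>x. a *\<^sub>R q x $ i + b *\<^sub>R q' x $ i) x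
      = a * wdiv \<Omega> (\<lambda>x. q x $ i) x + b * wdiv \<Omega> (\<lambda>x. q' x $ i) x" for i
    by (rule Q_lin[OF c(1)[of i] c(2)[of i]])+
  show "(\<lambda>x. a *\<^sub>R q x + b *\<^sub>R q' x) \<in> multi (Q_space \<Omega> \<Gamma>V \<Gamma>N)" using l(1) by (simp add: multi_def)
  have "AE x in surf \<Gamma>. \<forall>i\<in>UNIV. ntrace \<Omega> \<Gamma> (\<lambda>x. a *\<^sub>R q x $ i + b *\<^sub>R q' x $ i) x
      = a * ntrace \<Omega> \<Gamma> (\<lambda>x. q x $ i) x + b * ntrace \<Omega> \<Gamma> (\<lambda>x. q' x $ i) x"
    by (intro AE_finite_allI l(2)) simp_all
  then show "AE x in surf \<Gamma>. mntrace \<Omega> \<Gamma>V \<Gamma>N (\<lambda>x. a *\<^sub>R q x + b *\<^sub>R q' x) x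
      = a *\<^sub>R mntrace \<Omega> \<Gamma>V \<Gamma>N q x + b *\<^sub>R mntrace \<Omega> \<Gamma>V \<Gamma>N q' x"
    by eventually_elim (simp add: vec_eq_iff mntrace_def)
  have "AE x in \<Lambda>. \<forall>i\<in>UNIV. wdiv \<Omega> (\<lambda>x. a *\<^sub>R q x $ i + b *\<^sub>R q' x $ i) x
      = a * wdiv \<Omega> (\<lambda>x. q x $ i) x + b * wdiv \<Omega> (\<lambda>x. q' x $ i) x"
    by (intro AE_finite_allI l(3)) simp_all
  then show "AE x in \<Lambda>. mdiv \<Omega> (\<lambda>x. a *\<^sub>R q x + b *\<^sub>R q' x) x = a *\<^sub>R mdiv \<Omega> q x + b *\<^sub>R mdiv \<Omega> q' x"
    by eventually_elim (simp add: vec_eq_iff mdiv_def)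
qed

text \<open>The trace vanishes on \<open>\<Gamma>D\<close>, and the rest of \<open>\<partial>\<Omega> - (\<Gamma>V \<union> \<Gamma>N)\<close> is null.\<close>

lemma V_trace:
  assumes "\<psi> \<in> V_space \<Omega> \<Gamma>D"
  shows "has_trace \<Omega> \<psi> (trace_of \<Omega> \<psi>)" "AE x in surf (frontier \<Omega> - \<Gamma>). trace_of \<Omega> \<psi> x = 0"
    "\<psi> \<in> L2 \<Lambda>" "wgrad \<Omega> \<psi> \<in> L2 \<Lambda>" "trace_of \<Omega> \<psi> \<in> L2 (surf (frontier \<Omega>))"
proof -
  show t: "has_trace \<Omega> \<psi> (trace_of \<Omega> \<psi>)" using assms by (simp add: V_space_def)
  then show "\<psi> \<in> L2 \<Lambda>" "wgrad \<Omega> \<psi> \<in> L2 \<Lambda>" "trace_of \<Omega> \<psi> \<in> L2 (surf (frontier \<Omega>))"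
    using H1_wgrad(1,2) by (simp_all add: has_trace_def)
  have b: "frontier \<Omega> - \<Gamma> \<in> sets borel" by (rule sets.Diff[OF parts_borel(4) \<Gamma>_props(2)])
  have "frontier \<Omega> - \<Gamma> - \<Gamma>D = frontier \<Omega> - (\<Gamma>D \<union> \<Gamma>V \<union> \<Gamma>N)" by blast
  then have n: "frontier \<Omega> - \<Gamma> - \<Gamma>D \<in> null_sets H" using boundary_gap_null by simp
  then show "AE x in surf (frontier \<Omega> - \<Gamma>). trace_of \<Omega> \<psi> x = 0"
    using assms by (intro AE_surf_subset[OF _ n b parts_borel(1)]) (simp add: V_space_def)
qed

lemma multi_V_L2:
  assumes "\<phi> \<in> multi (V_space \<Omega> \<Gamma>D)"
  shows "\<phi> \<in> L2 \<Lambda>" "mgrad \<Omega> \<phi> \<in> L2 \<Lambda>" "mtrace \<Omega> \<phi> \<in> L2 (surf (frontier \<Omega>))" "mtrace \<Omega> \<phi> \<in> L2 (surf \<Gamma>)"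
proof -
  have c: "(\<lambda>x. \<phi> x $ i) \<in> V_space \<Omega> \<Gamma>D" for i using assms by (simp add: multi_def)
  show "\<phi> \<in> L2 \<Lambda>" "mgrad \<Omega> \<phi> \<in> L2 \<Lambda>" "mtrace \<Omega> \<phi> \<in> L2 (surf (frontier \<Omega>))"
    using V_trace(3-5)[OF c] by (simp_all add: L2_vec mgrad_def mtrace_def)
  then have "mtrace \<Omega> \<phi> \<in> L2 (surf (frontier \<Omega>))" by simp
  then show "mtrace \<Omega> \<phi> \<in> L2 (surf \<Gamma>)"
    by (rule L2_surf_subset[OF _ diff_subset_null[OF \<Gamma>_props(1)] parts_borel(4) \<Gamma>_props(2)])
qed

lemma transpose_adjoint: "x \<bullet> (transpose A *v y) = (A *v x) \<bullet> (y :: real ^ 'i)" for A :: "real ^ 'i ^ 'i"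
  using dot_lmul_matrix[of y A x] by (simp add: inner_commute)

text \<open>Componentwise this is the definition of the normal trace, tested with a component of \<open>\<phi>\<close>.\<close>

lemma green:
  fixes \<phi> :: "'a \<Rightarrow> real ^ 'i" and A :: "real ^ 'i ^ 'i"
  assumes \<phi>: "\<phi> \<in> multi (V_space \<Omega> \<Gamma>D)" and q: "q \<in> multi (Q_space \<Omega> \<Gamma>V \<Gamma>N)"
  shows "l2_inner \<Lambda> (\<lambda>x. mact A (mgrad \<Omega> \<phi> x)) q + l2_inner \<Lambda> \<phi> (\<lambda>x. transpose A *v mdiv \<Omega> q x)
    = l2_inner (surf \<Gamma>) (\<lambda>x. A *v mtrace \<Omega> \<phi> x) (mntrace \<Omega> \<Gamma>V \<Gamma>N q)"
proof -
  note Q = multi_Q_L2[OF q] and V = multi_V_L2[OF \<phi>]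
  have comp: "l2_inner \<Lambda> (\<lambda>x. mgrad \<Omega> \<phi> x $ c) (\<lambda>x. q x $ r) + l2_inner \<Lambda> (\<lambda>x. \<phi> x $ c) (\<lambda>x. mdiv \<Omega> q x $ r)
      = l2_inner (surf \<Gamma>) (\<lambda>x. mtrace \<Omega> \<phi> x $ c) (\<lambda>x. mntrace \<Omega> \<Gamma>V \<Gamma>N q x $ r)" for r c
  proof -
    have qr: "(\<lambda>x. q x $ r) \<in> Q_space \<Omega> \<Gamma>V \<Gamma>N" and \<phi>c: "(\<lambda>x. \<phi> x $ c) \<in> V_space \<Omega> \<Gamma>D"
      using q \<phi> by (simp_all add: multi_def)
    have "l2_inner \<Lambda> (\<lambda>x. q x $ r) (wgrad \<Omega> (\<lambda>x. \<phi> x $ c)) + l2_inner \<Lambda> (wdiv \<Omega> (\<lambda>x. q x $ r)) (\<lambda>x. \<phi> x $ c)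
      = l2_inner (surf \<Gamma>) (ntrace \<Omega> \<Gamma> (\<lambda>x. q x $ r)) (trace_of \<Omega> (\<lambda>x. \<phi> x $ c))"
      using Q_ntrace(1)[OF qr] V_trace(1,2)[OF \<phi>c] unfolding has_ntrace_def by blast
    then show ?thesis by (simp add: mgrad_def mdiv_def mtrace_def mntrace_def l2_inner_def inner_commute mult.commute)
  qed
  have "l2_inner \<Lambda> \<phi> (\<lambda>x. transpose A *v mdiv \<Omega> q x) = l2_inner \<Lambda> (\<lambda>x. mact A (\<phi> x)) (mdiv \<Omega> q)"
    unfolding l2_inner_def by (simp only: transpose_adjoint mact_real)
  moreover have "l2_inner (surf \<Gamma>) (\<lambda>x. A *v mtrace \<Omega> \<phi> x) (mntrace \<Omega> \<Gamma>V \<Gamma>N q)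
      = l2_inner (surf \<Gamma>) (\<lambda>x. mact A (mtrace \<Omega> \<phi> x)) (mntrace \<Omega> \<Gamma>V \<Gamma>N q)"
    by (simp only: mact_real)
  ultimately show ?thesis
    unfolding l2_inner_const_mact[OF V(2) Q(1)] l2_inner_const_mact[OF V(4) Q(3)] l2_inner_const_mact[OF V(1) Q(2)]
    by (simp only: sum.distrib[symmetric] distrib_left[symmetric] comp)
qed

text \<open>No flux passes through \<open>\<Gamma>N\<close>.\<close>

lemma ntrace_inner_V:
  assumes u: "u \<in> L2 (surf \<Gamma>)" and q: "q \<in> multi (Q_space \<Omega> \<Gamma>V \<Gamma>N)"
  shows "l2_inner (surf \<Gamma>) u (mntrace \<Omega> \<Gamma>V \<Gamma>N q) = l2_inner (surf \<Gamma>V) u (mntrace \<Omega> \<Gamma>V \<Gamma>N q)"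
proof -
  let ?g = "mntrace \<Omega> \<Gamma>V \<Gamma>N q"
  have int: "integrable (surf \<Gamma>) (\<lambda>x. u x \<bullet> ?g x)" by (rule L2_inner_integrable[OF u multi_Q_L2(3)[OF q]])
  have s: "\<Gamma> \<inter> space H \<in> sets H" "\<Gamma>V \<inter> space H \<in> sets H" "\<Gamma> \<in> sets H" "\<Gamma>V \<in> sets H"
    using borel_in_sets_hausdorff[OF \<Gamma>_props(2)] borel_in_sets_hausdorff[OF parts_borel(2)] by simp_all
  have i1: "integrable H (\<lambda>x. indicator \<Gamma> x *\<^sub>R (u x \<bullet> ?g x))"
    using int by (simp add: surf_def integrable_restrict_space[OF s(1)])
  have "integrable (surf \<Gamma>V) (\<lambda>x. u x \<bullet> ?g x)"
    using int unfolding surf_def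
    by (rule restrict_space_AE_subset(2)[OF complete_hausdorff s(4,3) diff_subset_null, rotated]) simp
  then have i2: "integrable H (\<lambda>x. indicator \<Gamma>V x *\<^sub>R (u x \<bullet> ?g x))"
    by (simp add: surf_def integrable_restrict_space[OF s(2)])
  have "AE x in surf \<Gamma>N. \<forall>i\<in>UNIV. ntrace \<Omega> \<Gamma> (\<lambda>x. q x $ i) x = 0"
    using q by (intro AE_finite_allI Q_ntrace(2)) (simp_all add: multi_def)
  then have "AE x in surf \<Gamma>N. ?g x = 0" by eventually_elim (simp add: mntrace_def vec_eq_iff)
  then have "AE x in H. x \<in> \<Gamma>N \<longrightarrow> ?g x = 0" by (simp add: AE_surf[OF parts_borel(3)])
  then have "AE x in H. indicator \<Gamma> x *\<^sub>R (u x \<bullet> ?g x) = indicator \<Gamma>V x *\<^sub>R (u x \<bullet> ?g x)"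
    by eventually_elim (auto simp: indicator_def)
  then have "(LINT x|H. indicator \<Gamma> x *\<^sub>R (u x \<bullet> ?g x)) = (LINT x|H. indicator \<Gamma>V x *\<^sub>R (u x \<bullet> ?g x))"
    by (intro integral_cong_AE borel_measurable_integrable i1 i2)
  then show ?thesis
    by (simp only: l2_inner_def surf_def integral_restrict_space[OF s(1)] integral_restrict_space[OF s(2)])
qed

lemma facets_in_subset: "facets_in \<Omega> \<T> \<Gamma>V \<subseteq> boundary_facets \<Omega> \<T>" "local_facets \<Omega> \<T> \<Gamma>V K \<subseteq> facets_in \<Omega> \<T> \<Gamma>V"
  by (auto simp: facets_in_def local_facets_def)

text \<open>A boundary facet through a point of \<open>\<Gamma>V\<close> cannot belong to another part, since \<open>\<Gamma>V\<close> is relatively open and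
  disjoint from the other two parts.\<close>

lemma \<Gamma>V_covered: "\<Gamma>V \<subseteq> \<Union>(facets_in \<Omega> \<T> \<Gamma>V)"
proof
  fix x assume x: "x \<in> \<Gamma>V"
  then obtain F where F: "F \<in> boundary_facets \<Omega> \<T>" "x \<in> F" using parts(1) mesh_props(4) by blast
  have "F \<subseteq> closure \<Gamma>D \<or> F \<subseteq> closure \<Gamma>V \<or> F \<subseteq> closure \<Gamma>N"
    using mesh F(1) unfolding mesh_def by blast
  then have "F \<subseteq> closure \<Gamma>V" using x F(2) parts(3,4) by blast
  then show "x \<in> \<Union>(facets_in \<Omega> \<T> \<Gamma>V)" using F by (auto simp: facets_in_def)
qed

text \<open>A facet that is not local belongs to an element outside the patch of \<open>K\<close>. Since \<open>q\<close> vanishes on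
  that element, so does its normal trace on the facet.\<close>

lemma ntrace_nonlocal_facet:
  assumes q: "q \<in> multi (Q_space \<Omega> \<Gamma>V \<Gamma>N)" and supp: "AE x in \<Lambda>. x \<notin> \<Union>(nbrs \<T> K) \<longrightarrow> q x = 0"
    and F: "F \<in> facets_in \<Omega> \<T> \<Gamma>V" "F \<notin> local_facets \<Omega> \<T> \<Gamma>V K"
  shows "AE x in H. x \<in> \<Gamma>V \<longrightarrow> x \<in> F \<longrightarrow> mntrace \<Omega> \<Gamma>V \<Gamma>N q x = 0"
proof -
  define L where "L = elem_of_facet \<T> F"
  have Fb: "F \<in> boundary_facets \<Omega> \<T>" using F(1) facets_in_subset by blast
  have L: "L \<in> \<T>" "F facet_of L" "F \<subseteq> frontier \<Omega>" unfolding L_def using boundary_facetE[OF Fb] by auto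
  have "F \<subseteq> frontier L" by (rule facet_props(7)[OF mesh_element(1)[OF L(1)] L(2)])
  then have Ln: "L \<notin> nbrs \<T> K" using F by (auto simp: local_facets_def)
  define U where "U = - \<Union>(\<T> - {L})"
  have U: "open U" "rel_interior F \<subseteq> U" "\<Omega> \<inter> U \<subseteq> L"
    unfolding U_def by (rule boundary_facet_neighbourhood[OF L(3,2,1)])+
  have disj: "U \<inter> \<Union>(nbrs \<T> K) = {}" using Ln unfolding U_def nbrs_def by blast
  have z: "AE x in \<Lambda>. x \<in> U \<longrightarrow> q x = 0" using supp by eventually_elim (use disj in blast)
  have "AE x in surf \<Gamma>. x \<in> U \<longrightarrow> ntrace \<Omega> \<Gamma> (\<lambda>x. q x $ i) x = 0" for i
  proof -
    have qi: "(\<lambda>x. q x $ i) \<in> Q_space \<Omega> \<Gamma>V \<Gamma>N" using q by (simp add: multi_def)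
    note n = Q_ntrace(1)[OF qi]
    \<comment> \<open>The comparison field is zero, written as 0 q + 0 q to obtain its normal trace by linearity.\<close>
    have "AE x in surf \<Gamma>. x \<in> U \<longrightarrow> ntrace \<Omega> \<Gamma> (\<lambda>x. q x $ i) x = 0 * ntrace \<Omega> \<Gamma> (\<lambda>x. q x $ i) x + 0 * ntrace \<Omega> \<Gamma> (\<lambda>x. q x $ i) x"
    proof (rule has_ntrace_local[OF n has_ntrace_lin(1)[OF n n, of 0 0] U(1)])
      show "AE x in \<Lambda>. x \<in> U \<longrightarrow> q x $ i = 0 *\<^sub>R q x $ i + 0 *\<^sub>R q x $ i" using z by eventually_elim simp
    qed
    then show ?thesis by simp
  qed
  then have "AE x in surf \<Gamma>. \<forall>i\<in>UNIV. x \<in> U \<longrightarrow> ntrace \<Omega> \<Gamma> (\<lambda>x. q x $ i) x = 0"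
    by (intro AE_finite_allI) auto
  then have "AE x in surf \<Gamma>. x \<in> U \<longrightarrow> mntrace \<Omega> \<Gamma>V \<Gamma>N q x = 0"
    by eventually_elim (simp add: mntrace_def vec_eq_iff)
  then have "AE x in H. x \<in> \<Gamma> \<longrightarrow> x \<in> U \<longrightarrow> mntrace \<Omega> \<Gamma>V \<Gamma>N q x = 0" by (simp add: AE_surf[OF \<Gamma>_props(2)])
  then show ?thesis
    using AE_not_in[OF facet_measure(3)[OF Fb]] by eventually_elim (use U(2) in blast)
qed

end

section \<open>The residual identity\<close>

lemma l2_inner_diff_left:
  "u \<in> L2 M \<Longrightarrow> v \<in> L2 M \<Longrightarrow> w \<in> L2 M \<Longrightarrow> l2_inner M (\<lambda>x. u x - v x) w = l2_inner M u w - l2_inner M v w"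
  by (simp add: l2_inner_def inner_diff_left L2_inner_integrable)

lemma l2_inner_add_left:
  "u \<in> L2 M \<Longrightarrow> v \<in> L2 M \<Longrightarrow> w \<in> L2 M \<Longrightarrow> l2_inner M (\<lambda>x. u x + v x) w = l2_inner M u w + l2_inner M v w"
  by (simp add: l2_inner_def inner_add_left L2_inner_integrable)

lemma l2_inner_commute: "l2_inner M u w = l2_inner M w u"
  by (simp add: l2_inner_def inner_commute)

lemma l2_inner_diff_right:
  "u \<in> L2 M \<Longrightarrow> v \<in> L2 M \<Longrightarrow> w \<in> L2 M \<Longrightarrow> l2_inner M w (\<lambda>x. u x - v x) = l2_inner M w u - l2_inner M w v"
  by (simp add: l2_inner_commute[of M w] l2_inner_diff_left)

lemma l2_inner_minus_right: "l2_inner M u (\<lambda>x. - w x) = - l2_inner M u w"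
  by (simp add: l2_inner_def)

lemma l2_inner_cong_AE:
  assumes "u \<in> L2 M" "w \<in> L2 M" "u' \<in> L2 M" "w' \<in> L2 M" "AE x in M. u x = u' x" "AE x in M. w x = w' x"
  shows "l2_inner M u w = l2_inner M u' w'"
  unfolding l2_inner_def
proof (rule integral_cong_AE)
  show "(\<lambda>x. u x \<bullet> w x) \<in> borel_measurable M" "(\<lambda>x. u' x \<bullet> w' x) \<in> borel_measurable M"
    by (intro borel_measurable_integrable L2_inner_integrable assms)+
  show "AE x in M. u x \<bullet> w x = u' x \<bullet> w' x" using assms(5,6) by eventually_elim simp
qed

lemma mact_diff: "mact A (p - q) = mact A p - mact A q"
  by (simp add: vec_eq_iff mact_nth scaleR_right_diff_distrib sum_subtractf)

context lipschitz_mesh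
begin

abbreviation X :: "('a, 'i::finite) mfields set" where "X \<equiv> X_space \<Omega> \<Gamma>V \<Gamma>N"

lemma X_iff: "(q, \<psi>) \<in> X \<longleftrightarrow> q \<in> multi (Q_space \<Omega> \<Gamma>V \<Gamma>N) \<and> \<psi> \<in> L2 \<Lambda>"
  by (simp add: X_space_def multi_L2)

lemma L2_\<Gamma>V: "u \<in> L2 (surf \<Gamma>) \<Longrightarrow> u \<in> L2 (surf \<Gamma>V)"
  by (rule L2_surf_subset[OF _ diff_subset_null[OF Un_upper1] \<Gamma>_props(2) parts_borel(2)])

lemma AE_\<Gamma>V: "AE x in surf \<Gamma>. P x \<Longrightarrow> AE x in surf \<Gamma>V. P x"
  by (rule AE_surf_subset[OF _ diff_subset_null[OF Un_upper1] parts_borel(2) \<Gamma>_props(2)])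

lemma c_form_diff:
  fixes p p' q :: "'a \<Rightarrow> 'a ^ ('n::{finite,linorder} \<times> 'g::finite)"
  assumes T: "coercive_diag \<Lambda> To" "coercive_diag \<Lambda> Te"
    and z: "(p, \<phi>) \<in> X" "(p', \<phi>') \<in> X" and q: "(q, \<psi>) \<in> X"
  shows "c_form \<Omega> \<Gamma>V \<Gamma>N To Te (\<lambda>x. p x - p' x, \<lambda>x. \<phi> x - \<phi>' x) (q, \<psi>)
    = c_form \<Omega> \<Gamma>V \<Gamma>N To Te (p, \<phi>) (q, \<psi>) - c_form \<Omega> \<Gamma>V \<Gamma>N To Te (p', \<phi>') (q, \<psi>)"
proof -
  let ?n = "mntrace \<Omega> \<Gamma>V \<Gamma>N :: ('a \<Rightarrow> 'a ^ ('n \<times> 'g)) \<Rightarrow> 'a \<Rightarrow> real ^ ('n \<times> 'g)"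
  have P: "p \<in> multi (Q_space \<Omega> \<Gamma>V \<Gamma>N)" "p' \<in> multi (Q_space \<Omega> \<Gamma>V \<Gamma>N)" "q \<in> multi (Q_space \<Omega> \<Gamma>V \<Gamma>N)"
    and S: "\<phi> \<in> L2 \<Lambda>" "\<phi>' \<in> L2 \<Lambda>" "\<psi> \<in> L2 \<Lambda>" using z q by (simp_all add: X_iff)
  note m = multi_Q_L2[OF P(1)] and m' = multi_Q_L2[OF P(2)] and mq = multi_Q_L2[OF P(3)]
  note lin = multi_Q_lin[OF P(1,2), of 1 "-1", simplified]
  note d = multi_Q_L2[OF lin(1)]
  have t1: "l2_inner \<Lambda> (\<lambda>x. mact (To x) (p x - p' x)) q
      = l2_inner \<Lambda> (\<lambda>x. mact (To x) (p x)) q - l2_inner \<Lambda> (\<lambda>x. mact (To x) (p' x)) q"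
    unfolding mact_diff by (intro l2_inner_diff_left L2_mact(1)[OF T(1)] m m' mq)
  have t2: "l2_inner \<Lambda> (\<lambda>x. \<phi> x - \<phi>' x) (\<lambda>x. transpose H_mat *v mdiv \<Omega> q x)
      = l2_inner \<Lambda> \<phi> (\<lambda>x. transpose H_mat *v mdiv \<Omega> q x) - l2_inner \<Lambda> \<phi>' (\<lambda>x. transpose H_mat *v mdiv \<Omega> q x)"
    by (intro l2_inner_diff_left S L2_matrix_vector mq)
  have t3: "l2_inner \<Lambda> \<psi> (\<lambda>x. transpose H_mat *v mdiv \<Omega> (\<lambda>x. p x - p' x) x)
      = l2_inner \<Lambda> \<psi> (\<lambda>x. transpose H_mat *v mdiv \<Omega> p x) - l2_inner \<Lambda> \<psi> (\<lambda>x. transpose H_mat *v mdiv \<Omega> p' x)"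
  proof -
    have "l2_inner \<Lambda> \<psi> (\<lambda>x. transpose H_mat *v mdiv \<Omega> (\<lambda>x. p x - p' x) x)
      = l2_inner \<Lambda> \<psi> (\<lambda>x. transpose H_mat *v mdiv \<Omega> p x - transpose H_mat *v mdiv \<Omega> p' x)"
    proof (rule l2_inner_cong_AE[OF S(3) _ S(3)])
      show "(\<lambda>x. transpose H_mat *v mdiv \<Omega> (\<lambda>x. p x - p' x) x) \<in> L2 \<Lambda>" by (rule L2_matrix_vector[OF d(2)])
      show "(\<lambda>x. transpose H_mat *v mdiv \<Omega> p x - transpose H_mat *v mdiv \<Omega> p' x) \<in> L2 \<Lambda>"
        by (intro L2_diff L2_matrix_vector m m')
      show "AE x in \<Lambda>. transpose H_mat *v mdiv \<Omega> (\<lambda>x. p x - p' x) x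
          = transpose H_mat *v mdiv \<Omega> p x - transpose H_mat *v mdiv \<Omega> p' x"
        using lin(3) by eventually_elim (simp only: matrix_vector_mult_diff_distrib)
    qed simp
    also have "\<dots> = l2_inner \<Lambda> \<psi> (\<lambda>x. transpose H_mat *v mdiv \<Omega> p x) - l2_inner \<Lambda> \<psi> (\<lambda>x. transpose H_mat *v mdiv \<Omega> p' x)"
      by (intro l2_inner_diff_right L2_matrix_vector m m' S)
    finally show ?thesis .
  qed
  have t4: "l2_inner \<Lambda> (\<lambda>x. Te x *v (\<phi> x - \<phi>' x)) \<psi>
      = l2_inner \<Lambda> (\<lambda>x. Te x *v \<phi> x) \<psi> - l2_inner \<Lambda> (\<lambda>x. Te x *v \<phi>' x) \<psi>"
    unfolding mact_real[symmetric] mact_diff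
    by (intro l2_inner_diff_left L2_mact(1)[OF T(2)] S)
  have t5: "l2_inner (surf \<Gamma>V) (\<lambda>x. Gamma_tilde *v ?n (\<lambda>x. p x - p' x) x) (?n q)
      = l2_inner (surf \<Gamma>V) (\<lambda>x. Gamma_tilde *v ?n p x) (?n q) - l2_inner (surf \<Gamma>V) (\<lambda>x. Gamma_tilde *v ?n p' x) (?n q)"
  proof -
    have "l2_inner (surf \<Gamma>V) (\<lambda>x. Gamma_tilde *v ?n (\<lambda>x. p x - p' x) x) (?n q)
      = l2_inner (surf \<Gamma>V) (\<lambda>x. Gamma_tilde *v ?n p x - Gamma_tilde *v ?n p' x) (?n q)"
    proof (rule l2_inner_cong_AE[OF _ L2_\<Gamma>V[OF mq(3)] _ L2_\<Gamma>V[OF mq(3)]])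
      show "(\<lambda>x. Gamma_tilde *v ?n (\<lambda>x. p x - p' x) x) \<in> L2 (surf \<Gamma>V)"
        by (intro L2_matrix_vector L2_\<Gamma>V d)
      show "(\<lambda>x. Gamma_tilde *v ?n p x - Gamma_tilde *v ?n p' x) \<in> L2 (surf \<Gamma>V)"
        by (intro L2_diff L2_matrix_vector L2_\<Gamma>V m m')
      show "AE x in surf \<Gamma>V. Gamma_tilde *v ?n (\<lambda>x. p x - p' x) x = Gamma_tilde *v ?n p x - Gamma_tilde *v ?n p' x"
        using AE_\<Gamma>V[OF lin(2)] by eventually_elim (simp only: matrix_vector_mult_diff_distrib)
    qed simp
    also have "\<dots> = l2_inner (surf \<Gamma>V) (\<lambda>x. Gamma_tilde *v ?n p x) (?n q) - l2_inner (surf \<Gamma>V) (\<lambda>x. Gamma_tilde *v ?n p' x) (?n q)"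
      by (intro l2_inner_diff_left L2_matrix_vector L2_\<Gamma>V m m' mq)
    finally show ?thesis .
  qed
  show ?thesis unfolding c_form_def prod.case t1 t2 t3 t4 t5 by simp
qed

text \<open>The sign change of \<open>q\<close> in \<open>d_form\<close> is what makes the terms with \<open>mdiv q\<close> and \<open>mgrad \<phi>t\<close> fit together in
  Green's formula.\<close>

lemma residual_identity:
  fixes p ph q :: "'a \<Rightarrow> 'a ^ ('n::{finite,linorder} \<times> 'g::finite)"
  assumes T: "coercive_diag \<Lambda> To" "coercive_diag \<Lambda> Te" and Sf: "Sf \<in> L2 \<Lambda>"
    and zeta: "(p, \<phi>) \<in> X"
      "\<And>q \<psi>. (q, \<psi>) \<in> X \<Longrightarrow> c_form \<Omega> \<Gamma>V \<Gamma>N To Te (p, \<phi>) (q, \<psi>) = l2_inner \<Lambda> Sf \<psi>"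
    and ph: "ph \<in> multi (Q_space \<Omega> \<Gamma>V \<Gamma>N)" and \<phi>t: "\<phi>t \<in> multi (V_space \<Omega> \<Gamma>D)"
    and q: "(q, \<psi>) \<in> X"
  shows "d_form \<Omega> \<Gamma>V \<Gamma>N To Te (\<lambda>x. p x - ph x, \<lambda>x. \<phi> x - \<phi>t x) (q, \<psi>)
    = l2_inner \<Lambda> (\<lambda>x. Sf x - transpose H_mat *v mdiv \<Omega> ph x - Te x *v \<phi>t x) \<psi>
    - l2_inner \<Lambda> (\<lambda>x. mact (To x) (ph x) + mact H_mat (mgrad \<Omega> \<phi>t x)) q
    + l2_inner (surf \<Gamma>V) (\<lambda>x. H_mat *v mtrace \<Omega> \<phi>t x - Gamma_tilde *v mntrace \<Omega> \<Gamma>V \<Gamma>N ph x) (mntrace \<Omega> \<Gamma>V \<Gamma>N q)"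
proof -
  let ?n = "mntrace \<Omega> \<Gamma>V \<Gamma>N :: ('a \<Rightarrow> 'a ^ ('n \<times> 'g)) \<Rightarrow> 'a \<Rightarrow> real ^ ('n \<times> 'g)"
  let ?nq = "\<lambda>x. - q x"
  have Q: "q \<in> multi (Q_space \<Omega> \<Gamma>V \<Gamma>N)" and \<psi>: "\<psi> \<in> L2 \<Lambda>" using q by (simp_all add: X_iff)
  note V = multi_V_L2[OF \<phi>t]
  note lin = multi_Q_lin[OF Q Q, of "-1" 0, simplified]
  note mq = multi_Q_L2[OF Q] and mn = multi_Q_L2[OF lin(1)] and mh = multi_Q_L2[OF ph]
  have nX: "(?nq, \<psi>) \<in> X" using lin(1) \<psi> by (simp add: X_iff)
  have hX: "(ph, \<phi>t) \<in> X" using ph V(1) by (simp add: X_iff)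
  have "d_form \<Omega> \<Gamma>V \<Gamma>N To Te (\<lambda>x. p x - ph x, \<lambda>x. \<phi> x - \<phi>t x) (q, \<psi>)
      = l2_inner \<Lambda> Sf \<psi> - c_form \<Omega> \<Gamma>V \<Gamma>N To Te (ph, \<phi>t) (?nq, \<psi>)"
    unfolding d_form_def prod.case c_form_diff[OF T zeta(1) hX nX] zeta(2)[OF nX] ..
  moreover have "l2_inner \<Lambda> \<phi>t (\<lambda>x. transpose H_mat *v mdiv \<Omega> ?nq x)
      = - l2_inner \<Lambda> \<phi>t (\<lambda>x. transpose H_mat *v mdiv \<Omega> q x)"
  proof -
    have "l2_inner \<Lambda> \<phi>t (\<lambda>x. transpose H_mat *v mdiv \<Omega> ?nq x) = l2_inner \<Lambda> \<phi>t (\<lambda>x. - (transpose H_mat *v mdiv \<Omega> q x))"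
    proof (rule l2_inner_cong_AE[OF V(1) _ V(1)])
      show "(\<lambda>x. transpose H_mat *v mdiv \<Omega> ?nq x) \<in> L2 \<Lambda>" by (rule L2_matrix_vector[OF mn(2)])
      show "(\<lambda>x. - (transpose H_mat *v mdiv \<Omega> q x)) \<in> L2 \<Lambda>" by (intro L2_minus L2_matrix_vector mq)
      show "AE x in \<Lambda>. transpose H_mat *v mdiv \<Omega> ?nq x = - (transpose H_mat *v mdiv \<Omega> q x)"
        using lin(3) by eventually_elim (simp only: linear_neg[OF matrix_vector_mul_linear])
    qed simp
    then show ?thesis by (simp only: l2_inner_minus_right)
  qed
  moreover have "l2_inner (surf \<Gamma>V) (\<lambda>x. Gamma_tilde *v ?n ph x) (?n ?nq)
      = - l2_inner (surf \<Gamma>V) (\<lambda>x. Gamma_tilde *v ?n ph x) (?n q)"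
  proof -
    have G: "(\<lambda>x. Gamma_tilde *v ?n ph x) \<in> L2 (surf \<Gamma>V)" by (intro L2_matrix_vector L2_\<Gamma>V mh)
    have "l2_inner (surf \<Gamma>V) (\<lambda>x. Gamma_tilde *v ?n ph x) (?n ?nq) = l2_inner (surf \<Gamma>V) (\<lambda>x. Gamma_tilde *v ?n ph x) (\<lambda>x. - ?n q x)"
      by (rule l2_inner_cong_AE[OF G L2_\<Gamma>V[OF mn(3)] G L2_minus[OF L2_\<Gamma>V[OF mq(3)]] _ AE_\<Gamma>V[OF lin(2)]]) simp
    then show ?thesis by (simp only: l2_inner_minus_right)
  qed
  moreover have "l2_inner \<Lambda> (\<lambda>x. mact H_mat (mgrad \<Omega> \<phi>t x)) q + l2_inner \<Lambda> \<phi>t (\<lambda>x. transpose H_mat *v mdiv \<Omega> q x)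
      = l2_inner (surf \<Gamma>V) (\<lambda>x. H_mat *v mtrace \<Omega> \<phi>t x) (?n q)"
    unfolding green[OF \<phi>t Q] by (rule ntrace_inner_V[OF L2_matrix_vector[OF V(4)] Q])
  moreover have "l2_inner \<Lambda> (\<lambda>x. Sf x - transpose H_mat *v mdiv \<Omega> ph x - Te x *v \<phi>t x) \<psi>
      = l2_inner \<Lambda> Sf \<psi> - l2_inner \<Lambda> \<psi> (\<lambda>x. transpose H_mat *v mdiv \<Omega> ph x) - l2_inner \<Lambda> (\<lambda>x. Te x *v \<phi>t x) \<psi>"
  proof -
    have H: "(\<lambda>x. transpose H_mat *v mdiv \<Omega> ph x) \<in> L2 \<Lambda>" by (rule L2_matrix_vector[OF mh(2)])
    have E: "(\<lambda>x. Te x *v \<phi>t x) \<in> L2 \<Lambda>" using L2_mact(1)[OF T(2) V(1)] by (simp only: mact_real)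
    show ?thesis
      unfolding l2_inner_diff_left[OF L2_diff[OF Sf H] E \<psi>] l2_inner_diff_left[OF Sf H \<psi>] l2_inner_commute[of \<Lambda> \<psi>] ..
  qed
  moreover have "l2_inner \<Lambda> (\<lambda>x. mact (To x) (ph x) + mact H_mat (mgrad \<Omega> \<phi>t x)) q
      = l2_inner \<Lambda> (\<lambda>x. mact (To x) (ph x)) q + l2_inner \<Lambda> (\<lambda>x. mact H_mat (mgrad \<Omega> \<phi>t x)) q"
    by (intro l2_inner_add_left L2_mact(1)[OF T(1)] L2_const_mact V mh mq)
  moreover have "l2_inner (surf \<Gamma>V) (\<lambda>x. H_mat *v mtrace \<Omega> \<phi>t x - Gamma_tilde *v ?n ph x) (?n q)
      = l2_inner (surf \<Gamma>V) (\<lambda>x. H_mat *v mtrace \<Omega> \<phi>t x) (?n q) - l2_inner (surf \<Gamma>V) (\<lambda>x. Gamma_tilde *v ?n ph x) (?n q)"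
    by (intro l2_inner_diff_left L2_matrix_vector L2_\<Gamma>V V mh mq)
  ultimately show ?thesis
    unfolding c_form_def prod.case by (simp only: l2_inner_minus_right)
qed

section \<open>The local estimate\<close>

text \<open>Since \<open>w\<close> vanishes off the elements in \<open>N\<close>, only these contribute. They overlap in null sets, hence the sum of the
  squared weighted norms of \<open>w\<close> is at most the term for \<open>T\<close> in the \<open>S\<close>-norm.\<close>

lemma element_residual_bound:
  fixes u w :: "'a \<Rightarrow> 'b::euclidean_space ^ 'i"
  assumes T: "coercive_diag \<Lambda> T" and u: "u \<in> L2 \<Lambda>" and w: "w \<in> L2 \<Lambda>" and N: "N \<subseteq> \<T>"
    and supp: "AE x in \<Lambda>. x \<notin> \<Union>N \<longrightarrow> w x = 0"
  shows "\<bar>l2_inner \<Lambda> u w\<bar> \<le> (\<Sum>K\<in>N. l2_norm (lebesgue_on K) (\<lambda>x. mact (diag_inv_sqrt (T x)) (u x)) *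
      l2_norm (lebesgue_on K) (\<lambda>x. mact (diag_sqrt (T x)) (w x)))"
    and "(\<Sum>K\<in>N. (l2_norm (lebesgue_on K) (\<lambda>x. mact (diag_sqrt (T x)) (w x)))\<^sup>2)
      \<le> l2_inner \<Lambda> (\<lambda>x. mact (diag_part (T x)) (w x)) w"
proof -
  have fin: "finite N" using N mesh_props(1) by (rule finite_subset)
  have NT: "K \<in> \<T>" if "K \<in> N" for K using N that by blast
  note el = element_lebesgue(1)[OF NT] element_lebesgue(2)[OF NT]
  have int: "integrable \<Lambda> (\<lambda>x. u x \<bullet> w x)" by (rule L2_inner_integrable[OF u w])
  have "AE x in lebesgue. x \<in> \<Omega> \<longrightarrow> x \<notin> \<Union>N \<longrightarrow> w x = 0" using supp by (simp only: AE_\<Lambda>)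
  then have zero: "AE x in lebesgue. x \<in> \<Omega> \<longrightarrow> x \<notin> (\<Union>K\<in>N. K) \<longrightarrow> u x \<bullet> w x = 0"
    by eventually_elim simp
  have "\<bar>l2_inner \<Lambda> u w\<bar> \<le> (\<Sum>K\<in>N. LINT x|lebesgue_on K. \<bar>u x \<bullet> w x\<bar>)"
    unfolding l2_inner_def by (rule integral_cover_bound[OF complete_lebesgue \<Omega>_sets(1) fin el int zero])
  also have "\<dots> \<le> (\<Sum>K\<in>N. l2_norm (lebesgue_on K) (\<lambda>x. mact (diag_inv_sqrt (T x)) (u x)) *
      l2_norm (lebesgue_on K) (\<lambda>x. mact (diag_sqrt (T x)) (w x)))"
  proof (rule sum_mono)
    fix K assume K: "K \<in> N"
    show "(LINT x|lebesgue_on K. \<bar>u x \<bullet> w x\<bar>) \<le> l2_norm (lebesgue_on K) (\<lambda>x. mact (diag_inv_sqrt (T x)) (u x)) *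
      l2_norm (lebesgue_on K) (\<lambda>x. mact (diag_sqrt (T x)) (w x))"
    proof (rule weighted_Cauchy_Schwarz)
      show "(\<lambda>x. mact (diag_inv_sqrt (T x)) (u x)) \<in> L2 (lebesgue_on K)"
        by (rule L2_element[OF NT[OF K] L2_mact(3)[OF T u]])
      show "(\<lambda>x. mact (diag_sqrt (T x)) (w x)) \<in> L2 (lebesgue_on K)"
        by (rule L2_element[OF NT[OF K] L2_mact(2)[OF T w]])
      show "integrable (lebesgue_on K) (\<lambda>x. u x \<bullet> w x)"
        by (rule restrict_space_AE_subset(2)[OF complete_lebesgue el(1)[OF K] \<Omega>_sets(1) el(2)[OF K] int])
      show "AE x in lebesgue_on K. \<bar>u x \<bullet> w x\<bar> \<le> norm (mact (diag_inv_sqrt (T x)) (u x)) * norm (mact (diag_sqrt (T x)) (w x))"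
        using AE_element[OF NT[OF K] coercive_diag_pos[OF T]] by eventually_elim (rule diag_dual(1), simp)
    qed
  qed
  finally show "\<bar>l2_inner \<Lambda> u w\<bar> \<le> (\<Sum>K\<in>N. l2_norm (lebesgue_on K) (\<lambda>x. mact (diag_inv_sqrt (T x)) (u x)) *
      l2_norm (lebesgue_on K) (\<lambda>x. mact (diag_sqrt (T x)) (w x)))" .
  let ?f = "\<lambda>x. (norm (mact (diag_sqrt (T x)) (w x)))\<^sup>2"
  have f: "integrable \<Lambda> ?f" by (rule L2_integrable[OF L2_mact(2)[OF T w]])
  have overlap: "K \<inter> K' \<in> null_sets lebesgue" if "K \<in> N" "K' \<in> N" "K \<noteq> K'" for K K'
    by (rule elements_overlap[OF NT[OF that(1)] NT[OF that(2)] that(3)])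
  have "(\<Sum>K\<in>N. (l2_norm (lebesgue_on K) (\<lambda>x. mact (diag_sqrt (T x)) (w x)))\<^sup>2) = (\<Sum>K\<in>N. LINT x|lebesgue_on K. ?f x)"
    by (simp only: l2_norm_sq)
  also have "\<dots> \<le> (LINT x|\<Lambda>. ?f x)"
    by (rule integral_disjoint_bound[OF complete_lebesgue \<Omega>_sets(1) fin el overlap f]) simp_all
  also have "\<dots> = l2_inner \<Lambda> (\<lambda>x. mact (diag_part (T x)) (w x)) w"
    unfolding l2_inner_def
  proof (rule integral_cong_AE)
    show "?f \<in> borel_measurable \<Lambda>" using f by (rule borel_measurable_integrable)
    show "AE x in \<Lambda>. ?f x = mact (diag_part (T x)) (w x) \<bullet> w x"
      using coercive_diag_pos[OF T] by eventually_elim (rule diag_dual(2), simp)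
    have m: "(\<lambda>x. T x $ i $ i) \<in> borel_measurable \<Lambda>" for i
      using T by (simp only: coercive_diag_def)
    have "(\<lambda>x. w x $ i) \<in> borel_measurable \<Lambda>" for i
      using w unfolding L2_vec by (blast intro: L2_measurable)
    then show "(\<lambda>x. mact (diag_part (T x)) (w x) \<bullet> w x) \<in> borel_measurable \<Lambda>"
      unfolding inner_vec_def mact_diag_nth
      by (intro borel_measurable_sum borel_measurable_inner borel_measurable_scaleR m)
  qed
  finally show "(\<Sum>K\<in>N. (l2_norm (lebesgue_on K) (\<lambda>x. mact (diag_sqrt (T x)) (w x)))\<^sup>2)
      \<le> l2_inner \<Lambda> (\<lambda>x. mact (diag_part (T x)) (w x)) w" .
qed

lemma local_facet_null: "F \<in> facets_in \<Omega> \<T> \<Gamma>V \<Longrightarrow> F - \<Gamma>V \<in> null_sets H"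
proof (rule null_sets_subset[OF part_boundary_null[of \<Gamma>V]])
  assume F: "F \<in> facets_in \<Omega> \<T> \<Gamma>V"
  then have "F \<in> boundary_facets \<Omega> \<T>" using facets_in_subset(1) by blast
  then show "F - \<Gamma>V \<in> sets H"
    by (intro borel_in_sets_hausdorff sets.Diff facet_measure(1) parts_borel)
  show "F - \<Gamma>V \<subseteq> closure \<Gamma>V - \<Gamma>V" using F by (auto simp: facets_in_def)
qed simp

text \<open>Every point of \<open>\<Gamma>V\<close> is on one of its facets, and on those that are not local the normal trace vanishes. On the
  others the residual is weighted with the inverse square root of \<open>A\<close>, the normal trace with the square root.\<close>

lemma facet_residual_bound:
  fixes q :: "'a \<Rightarrow> 'a ^ 'i" and t :: "'a \<Rightarrow> real ^ 'i"
  assumes A: "spd A" and t: "t \<in> L2 (surf \<Gamma>)" and q: "q \<in> multi (Q_space \<Omega> \<Gamma>V \<Gamma>N)"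
    and supp: "AE x in \<Lambda>. x \<notin> \<Union>(nbrs \<T> K) \<longrightarrow> q x = 0"
  shows "\<bar>l2_inner (surf \<Gamma>V) t (mntrace \<Omega> \<Gamma>V \<Gamma>N q)\<bar> \<le> (\<Sum>F\<in>local_facets \<Omega> \<T> \<Gamma>V K.
      l2_norm (surf F) (\<lambda>x. matrix_inv (spd_sqrt A) *v t x) * l2_norm (surf F) (\<lambda>x. spd_sqrt A *v mntrace \<Omega> \<Gamma>V \<Gamma>N q x))"
proof -
  let ?I = "local_facets \<Omega> \<T> \<Gamma>V K" and ?g = "mntrace \<Omega> \<Gamma>V \<Gamma>N q" and ?B = "spd_sqrt A"
  have finI: "finite (facets_in \<Omega> \<T> \<Gamma>V)" "finite ?I"
    using finite_boundary_facets facets_in_subset by (meson finite_subset)+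
  have s: "\<Gamma>V \<in> sets H" by (rule borel_in_sets_hausdorff[OF parts_borel(2)])
  have Ib: "F \<in> boundary_facets \<Omega> \<T>" "F \<in> facets_in \<Omega> \<T> \<Gamma>V" if "F \<in> ?I" for F
    using that facets_in_subset by blast+
  have F: "F \<in> sets H" "F - \<Gamma>V \<in> null_sets H" if "F \<in> ?I" for F
    using borel_in_sets_hausdorff[OF facet_measure(1)[OF Ib(1)[OF that]]] local_facet_null[OF Ib(2)[OF that]] by simp_all
  note g = multi_Q_L2(3)[OF q]
  have int: "integrable (restrict_space H \<Gamma>V) (\<lambda>x. t x \<bullet> ?g x)"
    using L2_inner_integrable[OF L2_\<Gamma>V[OF t] L2_\<Gamma>V[OF g]] by (simp only: surf_def)
  have "AE x in H. \<forall>F\<in>facets_in \<Omega> \<T> \<Gamma>V - ?I. x \<in> \<Gamma>V \<longrightarrow> x \<in> F \<longrightarrow> ?g x = 0"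
    using finI(1) ntrace_nonlocal_facet[OF q supp] by (intro AE_finite_allI) simp_all
  then have zero: "AE x in H. x \<in> \<Gamma>V \<longrightarrow> x \<notin> (\<Union>F\<in>?I. F) \<longrightarrow> t x \<bullet> ?g x = 0"
  proof eventually_elim
    case (elim x)
    show ?case
    proof (intro impI)
      assume x: "x \<in> \<Gamma>V" "x \<notin> (\<Union>F\<in>?I. F)"
      then obtain F where "F \<in> facets_in \<Omega> \<T> \<Gamma>V" "x \<in> F" using \<Gamma>V_covered by blast
      then have "?g x = 0" using x elim by blast
      then show "t x \<bullet> ?g x = 0" by simp
    qed
  qed
  have dual: "\<bar>a \<bullet> b\<bar> \<le> norm (matrix_inv ?B *v a) * norm (?B *v b)" for a b :: "real ^ 'i"
  proof -
    have "(matrix_inv ?B *v a) \<bullet> (?B *v b) = (?B *v (matrix_inv ?B *v a)) \<bullet> b"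
      by (rule spd_inner[OF spd_sqrt(1)[OF A], symmetric])
    also have "?B *v (matrix_inv ?B *v a) = a"
      using matrix_inv_right[OF spd_invertible[OF spd_sqrt(1)[OF A]]] by (simp add: matrix_vector_mul_assoc)
    finally show ?thesis by (metis Cauchy_Schwarz_ineq2)
  qed
  have "\<bar>l2_inner (surf \<Gamma>V) t ?g\<bar> \<le> (\<Sum>F\<in>?I. LINT x|restrict_space H F. \<bar>t x \<bullet> ?g x\<bar>)"
    unfolding l2_inner_def surf_def by (rule integral_cover_bound[OF complete_hausdorff s finI(2) F int zero])
  also have "\<dots> \<le> (\<Sum>F\<in>?I. l2_norm (surf F) (\<lambda>x. matrix_inv ?B *v t x) * l2_norm (surf F) (\<lambda>x. ?B *v ?g x))"
  proof (rule sum_mono)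
    fix F assume FI: "F \<in> ?I"
    show "(LINT x|restrict_space H F. \<bar>t x \<bullet> ?g x\<bar>) \<le> l2_norm (surf F) (\<lambda>x. matrix_inv ?B *v t x) * l2_norm (surf F) (\<lambda>x. ?B *v ?g x)"
      unfolding surf_def
    proof (rule weighted_Cauchy_Schwarz)
      have sub: "u \<in> L2 (restrict_space H F)" if "u \<in> L2 (surf \<Gamma>)" for u :: "'a \<Rightarrow> real ^ 'i"
        by (rule L2_restrict_AE_subset[OF complete_hausdorff F(1)[OF FI] s F(2)[OF FI] L2_\<Gamma>V[OF that, unfolded surf_def]])
      show "(\<lambda>x. matrix_inv ?B *v t x) \<in> L2 (restrict_space H F)" by (intro sub L2_matrix_vector t)
      show "(\<lambda>x. ?B *v ?g x) \<in> L2 (restrict_space H F)" by (intro sub L2_matrix_vector g)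
      show "integrable (restrict_space H F) (\<lambda>x. t x \<bullet> ?g x)"
        by (rule restrict_space_AE_subset(2)[OF complete_hausdorff F(1)[OF FI] s F(2)[OF FI] int])
      show "AE x in restrict_space H F. \<bar>t x \<bullet> ?g x\<bar> \<le> norm (matrix_inv ?B *v t x) * norm (?B *v ?g x)"
        by (intro AE_I2 dual)
    qed
  qed
  finally show ?thesis .
qed

text \<open>The \<open>S\<close>-norm of the test pair dominates the three families of weighted norms that multiply the estimators; its
  divergence terms are nonnegative. The factor \<open>(\<delta> * h) powr (- 1/2)\<close> of \<open>eta_bc\<close> is compensated by \<open>sqrt (\<delta> * h)\<close>, which
  the \<open>S\<close>-norm supplies on the side of the normal trace.\<close>

lemma local_residual_estimate:
  fixes p ph q :: "'a \<Rightarrow> 'a ^ ('n::{finite,linorder} \<times> 'g::finite)"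
  assumes T: "coercive_diag \<Lambda> To" "coercive_diag \<Lambda> Te" and Sf: "Sf \<in> L2 \<Lambda>"
    and zeta: "(p, \<phi>) \<in> X"
      "\<And>q \<psi>. (q, \<psi>) \<in> X \<Longrightarrow> c_form \<Omega> \<Gamma>V \<Gamma>N To Te (p, \<phi>) (q, \<psi>) = l2_inner \<Lambda> Sf \<psi>"
    and ph: "ph \<in> multi (Q_space \<Omega> \<Gamma>V \<Gamma>N)" and \<phi>t: "\<phi>t \<in> multi (V_space \<Omega> \<Gamma>D)"
    and K: "K \<in> \<T>" and q: "(q, \<psi>) \<in> X_local \<Omega> \<Gamma>V \<Gamma>N \<T> K" and S: "S_norm \<Omega> \<Gamma>V \<Gamma>N \<T> To Te (q, \<psi>) \<le> 1"
  shows "d_form \<Omega> \<Gamma>V \<Gamma>N To Te (\<lambda>x. p x - ph x, \<lambda>x. \<phi> x - \<phi>t x) (q, \<psi>)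
    \<le> sqrt ((eta_r \<Omega> Te Sf ph \<phi>t K)\<^sup>2 + (\<Sum>K'\<in>nbrs \<T> K. (eta_f \<Omega> To ph \<phi>t K')\<^sup>2)
        + (\<Sum>F\<in>local_facets \<Omega> \<T> \<Gamma>V K. (eta_bc \<Omega> \<Gamma>V \<Gamma>N \<T> To ph \<phi>t F)\<^sup>2))"
proof -
  let ?g = "mntrace \<Omega> \<Gamma>V \<Gamma>N q" and ?G = "Gamma_tilde :: real ^ ('n \<times> 'g) ^ ('n \<times> 'g)"
  have qX: "(q, \<psi>) \<in> X" and s\<psi>: "AE x in \<Lambda>. x \<notin> K \<longrightarrow> \<psi> x = 0"
    and sq: "AE x in \<Lambda>. x \<notin> \<Union>(nbrs \<T> K) \<longrightarrow> q x = 0"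
    using q by (simp_all add: X_local_def)
  have Q: "q \<in> multi (Q_space \<Omega> \<Gamma>V \<Gamma>N)" and \<psi>: "\<psi> \<in> L2 \<Lambda>" using qX by (simp_all add: X_iff)
  note V = multi_V_L2[OF \<phi>t] and mh = multi_Q_L2[OF ph] and mq = multi_Q_L2[OF Q]
  define r where "r = (\<lambda>x. Sf x - transpose H_mat *v mdiv \<Omega> ph x - Te x *v \<phi>t x)"
  define s where "s = (\<lambda>x. mact (To x) (ph x) + mact H_mat (mgrad \<Omega> \<phi>t x))"
  define t where "t = (\<lambda>x. H_mat *v mtrace \<Omega> \<phi>t x - Gamma_tilde *v mntrace \<Omega> \<Gamma>V \<Gamma>N ph x)"
  have "(\<lambda>x. Te x *v \<phi>t x) \<in> L2 \<Lambda>" using L2_mact(1)[OF T(2) V(1)] by (simp only: mact_real)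
  then have r: "r \<in> L2 \<Lambda>" unfolding r_def by (intro L2_diff Sf L2_matrix_vector mh)
  have s: "s \<in> L2 \<Lambda>" unfolding s_def by (intro L2_add L2_mact(1)[OF T(1)] L2_const_mact mh V)
  have t: "t \<in> L2 (surf \<Gamma>)" unfolding t_def by (intro L2_diff L2_matrix_vector mh V)
  have N: "nbrs \<T> K \<subseteq> \<T>" by (auto simp: nbrs_def)
  let ?z = "l2_norm (lebesgue_on K) (\<lambda>x. mact (diag_sqrt (Te x)) (\<psi> x))"
  let ?x = "\<lambda>K'. l2_norm (lebesgue_on K') (\<lambda>x. mact (diag_sqrt (To x)) (q x))"
  let ?w = "\<lambda>F. delta_max To (elem_of_facet \<T> F) * altitude (elem_of_facet \<T> F) F"
  let ?y = "\<lambda>F. l2_norm (surf F) (\<lambda>x. spd_sqrt ?G *v ?g x)"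
  let ?er = "eta_r \<Omega> Te Sf ph \<phi>t K" and ?ef = "eta_f \<Omega> To ph \<phi>t" and ?eb = "eta_bc \<Omega> \<Gamma>V \<Gamma>N \<T> To ph \<phi>t"
  have supp: "AE x in \<Lambda>. x \<notin> \<Union>{K} \<longrightarrow> \<psi> x = 0" using s\<psi> by simp
  have N1: "{K} \<subseteq> \<T>" using K by simp
  have b1: "l2_inner \<Lambda> r \<psi> \<le> ?er * ?z" and c1: "?z\<^sup>2 \<le> l2_inner \<Lambda> (\<lambda>x. diag_part (Te x) *v \<psi> x) \<psi>"
  proof -
    note b = element_residual_bound[OF T(2) r \<psi> N1 supp]
    have "?er = l2_norm (lebesgue_on K) (\<lambda>x. mact (diag_inv_sqrt (Te x)) (r x))"
      by (simp only: eta_r_def r_def mact_real)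
    then have "\<bar>l2_inner \<Lambda> r \<psi>\<bar> \<le> ?er * ?z" using b(1) by simp
    then show "l2_inner \<Lambda> r \<psi> \<le> ?er * ?z" by linarith
    show "?z\<^sup>2 \<le> l2_inner \<Lambda> (\<lambda>x. diag_part (Te x) *v \<psi> x) \<psi>" using b(2) by (simp add: mact_real)
  qed
  have b2: "- l2_inner \<Lambda> s q \<le> (\<Sum>K'\<in>nbrs \<T> K. ?ef K' * ?x K')"
    and c2: "(\<Sum>K'\<in>nbrs \<T> K. (?x K')\<^sup>2) \<le> l2_inner \<Lambda> (\<lambda>x. mact (diag_part (To x)) (q x)) q"
  proof -
    note b = element_residual_bound[OF T(1) s mq(1) N sq]
    have "?ef K' = l2_norm (lebesgue_on K') (\<lambda>x. mact (diag_inv_sqrt (To x)) (s x))" for K'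
      by (simp only: eta_f_def s_def)
    then have "\<bar>l2_inner \<Lambda> s q\<bar> \<le> (\<Sum>K'\<in>nbrs \<T> K. ?ef K' * ?x K')" using b(1) by simp
    then show "- l2_inner \<Lambda> s q \<le> (\<Sum>K'\<in>nbrs \<T> K. ?ef K' * ?x K')" by linarith
    show "(\<Sum>K'\<in>nbrs \<T> K. (?x K')\<^sup>2) \<le> l2_inner \<Lambda> (\<lambda>x. mact (diag_part (To x)) (q x)) q" by (rule b(2))
  qed
  have w: "0 < ?w F" if "F \<in> facets_in \<Omega> \<T> \<Gamma>V" for F
  proof -
    have "F \<in> boundary_facets \<Omega> \<T>" using that facets_in_subset(1) by blast
    then show ?thesis
      by (intro mult_pos_pos delta_max_pos[OF T(1)] boundary_facetE(1) altitude_pos)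
  qed
  have b3: "l2_inner (surf \<Gamma>V) t ?g \<le> (\<Sum>F\<in>local_facets \<Omega> \<T> \<Gamma>V K. ?eb F * (sqrt (?w F) * ?y F))"
  proof -
    have "\<bar>l2_inner (surf \<Gamma>V) t ?g\<bar> \<le> (\<Sum>F\<in>local_facets \<Omega> \<T> \<Gamma>V K. l2_norm (surf F) (\<lambda>x. matrix_inv (spd_sqrt ?G) *v t x) * ?y F)"
      by (rule facet_residual_bound[OF Gamma_tilde_spd t Q sq])
    also have "\<dots> = (\<Sum>F\<in>local_facets \<Omega> \<T> \<Gamma>V K. ?eb F * (sqrt (?w F) * ?y F))"
    proof (rule sum.cong[OF refl])
      fix F assume "F \<in> local_facets \<Omega> \<T> \<Gamma>V K"
      then have "0 < ?w F" using w facets_in_subset(2) by blast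
      moreover have "c powr (- (1/2)) * sqrt c = 1" if "0 < c" for c :: real
        using that by (simp add: powr_minus powr_half_sqrt)
      ultimately have "?w F powr (- (1/2)) * sqrt (?w F) = 1" by blast
      moreover have "?eb F = ?w F powr (- (1/2)) * l2_norm (surf F) (\<lambda>x. matrix_inv (spd_sqrt ?G) *v t x)"
        by (simp only: eta_bc_def t_def)
      moreover have "(c * n) * (d * y) = n * y" if "c * d = 1" for c d n y :: real
      proof -
        have "(c * n) * (d * y) = (c * d) * (n * y)" by (simp only: mult_ac)
        then show ?thesis using that by simp
      qed
      ultimately show "l2_norm (surf F) (\<lambda>x. matrix_inv (spd_sqrt ?G) *v t x) * ?y F = ?eb F * (sqrt (?w F) * ?y F)"
        by simp
    qed
    finally show ?thesis by linarith
  qed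
  have fin: "finite (facets_in \<Omega> \<T> \<Gamma>V)" using finite_boundary_facets facets_in_subset(1) by (rule finite_subset[rotated])
  have c3: "(\<Sum>F\<in>local_facets \<Omega> \<T> \<Gamma>V K. (sqrt (?w F) * ?y F)\<^sup>2) \<le> (\<Sum>F\<in>facets_in \<Omega> \<T> \<Gamma>V. ?w F * (?y F)\<^sup>2)"
  proof -
    have "(\<Sum>F\<in>local_facets \<Omega> \<T> \<Gamma>V K. (sqrt (?w F) * ?y F)\<^sup>2) = (\<Sum>F\<in>local_facets \<Omega> \<T> \<Gamma>V K. ?w F * (?y F)\<^sup>2)"
    proof (rule sum.cong[OF refl])
      fix F assume "F \<in> local_facets \<Omega> \<T> \<Gamma>V K"
      then have "0 \<le> ?w F" using w facets_in_subset(2) by (blast intro: less_imp_le)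
      then show "(sqrt (?w F) * ?y F)\<^sup>2 = ?w F * (?y F)\<^sup>2" by (simp only: power_mult_distrib real_sqrt_pow2)
    qed
    also have "\<dots> \<le> (\<Sum>F\<in>facets_in \<Omega> \<T> \<Gamma>V. ?w F * (?y F)\<^sup>2)"
      by (rule sum_mono2[OF fin facets_in_subset(2)]) (intro mult_nonneg_nonneg zero_le_power2 less_imp_le[OF w], simp)
    finally show ?thesis .
  qed
  have c4: "0 \<le> (\<Sum>K\<in>\<T>. delta_max To K * (diameter K)\<^sup>2 * (l2_norm (lebesgue_on K) (mdiv \<Omega> q))\<^sup>2)"
    by (intro sum_nonneg mult_nonneg_nonneg zero_le_power2 less_imp_le[OF delta_max_pos[OF T(1)]])
  have "?z\<^sup>2 + (\<Sum>K'\<in>nbrs \<T> K. (?x K')\<^sup>2) + (\<Sum>F\<in>local_facets \<Omega> \<T> \<Gamma>V K. (sqrt (?w F) * ?y F)\<^sup>2) \<le> 1"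
  proof -
    have "l2_inner \<Lambda> (\<lambda>x. mact (diag_part (To x)) (q x)) q + l2_inner \<Lambda> (\<lambda>x. diag_part (Te x) *v \<psi> x) \<psi>
       + (\<Sum>K\<in>\<T>. delta_max To K * (diameter K)\<^sup>2 * (l2_norm (lebesgue_on K) (mdiv \<Omega> q))\<^sup>2)
       + (\<Sum>F\<in>facets_in \<Omega> \<T> \<Gamma>V. ?w F * (?y F)\<^sup>2) \<le> 1"
      using S unfolding S_norm_def prod.case by (simp only: real_sqrt_le_1_iff)
    then show ?thesis using c1 c2 c3 c4 by linarith
  qed
  then have le1: "sqrt (?z\<^sup>2 + (\<Sum>K'\<in>nbrs \<T> K. (?x K')\<^sup>2) + (\<Sum>F\<in>local_facets \<Omega> \<T> \<Gamma>V K. (sqrt (?w F) * ?y F)\<^sup>2)) \<le> 1"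
    by (simp only: real_sqrt_le_1_iff)
  have "d_form \<Omega> \<Gamma>V \<Gamma>N To Te (\<lambda>x. p x - ph x, \<lambda>x. \<phi> x - \<phi>t x) (q, \<psi>)
      = l2_inner \<Lambda> r \<psi> - l2_inner \<Lambda> s q + l2_inner (surf \<Gamma>V) t ?g"
    unfolding r_def s_def t_def by (rule residual_identity[OF T Sf zeta ph \<phi>t qX])
  also have "\<dots> \<le> ?er * ?z + (\<Sum>K'\<in>nbrs \<T> K. ?ef K' * ?x K') + (\<Sum>F\<in>local_facets \<Omega> \<T> \<Gamma>V K. ?eb F * (sqrt (?w F) * ?y F))"
    using b1 b2 b3 by linarith
  also have "\<dots> \<le> sqrt (?er\<^sup>2 + (\<Sum>K'\<in>nbrs \<T> K. (?ef K')\<^sup>2) + (\<Sum>F\<in>local_facets \<Omega> \<T> \<Gamma>V K. (?eb F)\<^sup>2)) *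
      sqrt (?z\<^sup>2 + (\<Sum>K'\<in>nbrs \<T> K. (?x K')\<^sup>2) + (\<Sum>F\<in>local_facets \<Omega> \<T> \<Gamma>V K. (sqrt (?w F) * ?y F)\<^sup>2))"
    by (rule sum3_Cauchy_Schwarz)
  also have "\<dots> \<le> sqrt (?er\<^sup>2 + (\<Sum>K'\<in>nbrs \<T> K. (?ef K')\<^sup>2) + (\<Sum>F\<in>local_facets \<Omega> \<T> \<Gamma>V K. (?eb F)\<^sup>2)) * 1"
    by (intro mult_left_mono le1 real_sqrt_ge_zero add_nonneg_nonneg sum_nonneg zero_le_power2)
  finally show ?thesis by simp
qed

end

section \<open>The estimate for the multigroup coefficients\<close>

lemma coercive_diag_T_mat:
  fixes mom :: "'n::finite \<Rightarrow> nat" and \<Sigma>t :: "'g::finite \<Rightarrow> 'a \<Rightarrow> real"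
  assumes r: "\<And>i g. removal \<Sigma>t \<Sigma>s (mom i) g \<in> Linf M" and s: "\<And>i g g'. \<Sigma>s (mom i) g' g \<in> Linf M"
    and lo: "0 < lo" "\<And>i g. AE x in M. lo \<le> tcoef (mom i) * removal \<Sigma>t \<Sigma>s (mom i) g x"
  shows "coercive_diag M (T_mat mom \<Sigma>t \<Sigma>s)"
proof -
  let ?T = "T_mat mom \<Sigma>t \<Sigma>s"
  have Linf_scale: "(\<lambda>x. c * f x) \<in> Linf M" if f: "f \<in> Linf M" for c :: real and f :: "'a \<Rightarrow> real"
  proof -
    obtain C where "AE x in M. norm (f x) \<le> C" using f by (auto simp: Linf_def)
    then have "AE x in M. norm (c * f x) \<le> \<bar>c\<bar> * C"
      by eventually_elim (simp add: abs_mult mult_left_mono)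
    then show ?thesis using f by (auto simp: Linf_def)
  qed
  have entry: "(\<lambda>x. ?T x $ i $ j) \<in> Linf M" for i j
  proof -
    consider "fst i \<noteq> fst j" | "fst i = fst j" "snd i = snd j" | "fst i = fst j" "snd i \<noteq> snd j" by blast
    then show ?thesis
    proof cases
      case 1
      then show ?thesis by (auto simp: T_mat_def Linf_def)
    next
      case 2
      then show ?thesis using Linf_scale[OF r, of "tcoef (mom (fst j))"] by (simp add: T_mat_def)
    next
      case 3
      then show ?thesis using Linf_scale[OF s, of "- tcoef (mom (fst j))"] by (simp add: T_mat_def)
    qed
  qed
  have "\<forall>ij. \<exists>C. AE x in M. \<bar>?T x $ fst ij $ snd ij\<bar> \<le> C"
    using entry by (auto simp: Linf_def)
  then obtain C where C: "\<And>ij. AE x in M. \<bar>?T x $ fst ij $ snd ij\<bar> \<le> C ij" by metis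
  have "AE x in M. \<forall>ij\<in>UNIV. \<bar>?T x $ fst ij $ snd ij\<bar> \<le> C ij"
    using C by (intro AE_finite_allI) simp_all
  then have "AE x in M. \<forall>i j. \<bar>?T x $ i $ j\<bar> \<le> Max (range C)"
  proof eventually_elim
    case (elim x)
    have "\<bar>?T x $ i $ j\<bar> \<le> Max (range C)" for i j
    proof (rule order_trans)
      show "\<bar>?T x $ i $ j\<bar> \<le> C (i, j)" using elim[THEN bspec, of "(i, j)"] by simp
      show "C (i, j) \<le> Max (range C)" by (rule Max_ge) simp_all
    qed
    then show ?case by blast
  qed
  moreover have "AE x in M. \<forall>i. lo \<le> ?T x $ i $ i"
  proof -
    have "AE x in M. \<forall>i\<in>UNIV. lo \<le> ?T x $ i $ i"
      using lo(2) by (intro AE_finite_allI) (simp_all add: T_mat_def)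
    then show ?thesis by simp
  qed
  moreover have "(\<lambda>x. ?T x $ i $ j) \<in> borel_measurable M" for i j
    using entry[of i j] by (simp add: Linf_def)
  ultimately show ?thesis unfolding coercive_diag_def using lo(1) by blast
qed

lemma idx_less: "idx (i :: 'n::{finite,linorder}) < CARD('n)"
  unfolding idx_def by (intro psubset_card_mono) auto

theorem theoremA1:
  fixes \<Omega> \<Gamma>D \<Gamma>V \<Gamma>N :: "'a::euclidean_space set"
    and P \<T> :: "'a set set"
    and G N :: nat
    and \<Sigma>t :: "'g::finite \<Rightarrow> 'a \<Rightarrow> real"
    and \<Sigma>s :: "nat \<Rightarrow> 'g \<Rightarrow> 'g \<Rightarrow> 'a \<Rightarrow> real"
    and To Te :: "'a \<Rightarrow> real ^ ('n::{finite,linorder} \<times> 'g) ^ ('n \<times> 'g)"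
    and Qh :: "('a \<Rightarrow> 'a) set"
    and Lh :: "('a \<Rightarrow> real) set"
    and Sf \<phi> \<phi>h \<phi>t :: "'a \<Rightarrow> real ^ ('n \<times> 'g)"
    and p ph :: "'a \<Rightarrow> 'a ^ ('n \<times> 'g)"
    and \<epsilon> To_inv_lo To_inv_hi Te_lo Te_hi :: real
    and K :: "'a set"
  assumes dim: "DIM('a) \<in> {2, 3}"
    and groups: "CARD('g) = G" "2 \<le> G"
    and moments: "odd N" "CARD('n) = (N + 1) div 2" "2 \<le> (N + 1) div 2"
    and domain: "regular_domain \<Omega>"
    and parts: "domain_partition \<Omega> P"
    and boundary: "boundary_partition \<Omega> \<Gamma>D \<Gamma>V \<Gamma>N"
    and mesh: "mesh \<Omega> \<Gamma>D \<Gamma>V \<Gamma>N \<T>"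
    and coeff_r: "\<And>m g. m \<le> N \<Longrightarrow> removal \<Sigma>t \<Sigma>s m g \<in> PW1inf \<Omega> P"
    and coeff_s: "\<And>m g g'. m \<le> N \<Longrightarrow> \<Sigma>s m g' g \<in> Linf (lebesgue_on \<Omega>)"
    and bounds_e: "\<exists>lo hi. 0 < lo \<and> lo \<le> hi \<and> (\<forall>g m. m \<le> N \<and> even m \<longrightarrow>
        (AE x in lebesgue_on \<Omega>. lo \<le> tcoef m * removal \<Sigma>t \<Sigma>s m g x \<and> tcoef m * removal \<Sigma>t \<Sigma>s m g x \<le> hi))"
    and bounds_o: "\<exists>lo hi. 0 < lo \<and> lo \<le> hi \<and> (\<forall>g m. m \<le> N \<and> odd m \<longrightarrow>
        (AE x in lebesgue_on \<Omega>. lo \<le> tcoef m * removal \<Sigma>t \<Sigma>s m g x \<and> tcoef m * removal \<Sigma>t \<Sigma>s m g x \<le> hi))"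
    and eps: "0 < \<epsilon>" "\<epsilon> < 1 / (real G - 1)"
    and scatter: "\<And>m g g'. m \<le> N \<Longrightarrow> g' \<noteq> g \<Longrightarrow>
        AE x in lebesgue_on \<Omega>. \<bar>\<Sigma>s m g g' x\<bar> \<le> \<epsilon> * removal \<Sigma>t \<Sigma>s m g x"
    and To: "To = To_mat \<Sigma>t \<Sigma>s" and Te: "Te = Te_mat \<Sigma>t \<Sigma>s"
    and consts_pos: "0 < To_inv_lo" "0 < To_inv_hi" "0 < Te_lo" "0 < Te_hi"
    and To_bounds: "AE x in lebesgue_on \<Omega>. \<forall>X.
        To_inv_lo * (norm X)\<^sup>2 \<le> X \<bullet> (matrix_inv (To x) *v X) \<and>
        norm (matrix_inv (To x) *v X) \<le> To_inv_hi * norm X"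
    and Te_bounds: "AE x in lebesgue_on \<Omega>. \<forall>X.
        Te_lo * (norm X)\<^sup>2 \<le> X \<bullet> (Te x *v X) \<and> norm (Te x *v X) \<le> Te_hi * norm X"
    and source: "Sf \<in> multi (L2 (lebesgue_on \<Omega>))"
    and discrete: "discrete_spaces \<Omega> \<T> Qh Lh"
    and zeta: "(p, \<phi>) \<in> X_space \<Omega> \<Gamma>V \<Gamma>N"
      "\<And>q \<psi>. (q, \<psi>) \<in> X_space \<Omega> \<Gamma>V \<Gamma>N \<Longrightarrow>
        c_form \<Omega> \<Gamma>V \<Gamma>N To Te (p, \<phi>) (q, \<psi>) = l2_inner (lebesgue_on \<Omega>) Sf \<psi>"
    and zeta_h: "ph \<in> multi (Qh \<inter> Q_space \<Omega> \<Gamma>V \<Gamma>N)" "\<phi>h \<in> multi Lh"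
      "\<And>qh \<psi>h. qh \<in> multi (Qh \<inter> Q_space \<Omega> \<Gamma>V \<Gamma>N) \<Longrightarrow> \<psi>h \<in> multi Lh \<Longrightarrow>
        c_form \<Omega> \<Gamma>V \<Gamma>N To Te (ph, \<phi>h) (qh, \<psi>h) = l2_inner (lebesgue_on \<Omega>) Sf \<psi>h"
    and reconstruction: "\<phi>t \<in> multi (V_space \<Omega> \<Gamma>D)"
    and K: "K \<in> \<T>"
  shows "plus_norm \<Omega> \<Gamma>V \<Gamma>N \<T> To Te K (\<lambda>x. p x - ph x, \<lambda>x. \<phi> x - \<phi>t x)
    \<le> ereal (sqrt (
        (eta_r \<Omega> Te Sf ph \<phi>t K)\<^sup>2
        + (\<Sum>K'\<in>nbrs \<T> K. (eta_f \<Omega> To ph \<phi>t K')\<^sup>2)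
        + (\<Sum>F\<in>local_facets \<Omega> \<T> \<Gamma>V K. (eta_bc \<Omega> \<Gamma>V \<Gamma>N \<T> To ph \<phi>t F)\<^sup>2)))"
proof -
  interpret lipschitz_mesh \<Omega> \<Gamma>D \<Gamma>V \<Gamma>N \<T>
    using dim domain boundary mesh by unfold_locales auto
  have r: "removal \<Sigma>t \<Sigma>s m g \<in> Linf (lebesgue_on \<Omega>)" if "m \<le> N" for m g
    using coeff_r[OF that] by (simp add: PW1inf_def)
  have mom: "2 * idx i \<le> N" "2 * idx i + 1 \<le> N" for i :: 'n
    using idx_less[of i] moments(1,2) by presburger+
  have Te_c: "coercive_diag (lebesgue_on \<Omega>) Te"
  proof -
    obtain lo where lo: "0 < lo"
      "\<And>g m. m \<le> N \<Longrightarrow> even m \<Longrightarrow> AE x in lebesgue_on \<Omega>. lo \<le> tcoef m * removal \<Sigma>t \<Sigma>s m g x"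
      using bounds_e by (fastforce elim: AE_mp)
    show ?thesis unfolding Te Te_mat_def
      by (rule coercive_diag_T_mat[OF r[OF mom(1)] coeff_s[OF mom(1)] lo(1) lo(2)[OF mom(1)]]) simp
  qed
  have To_c: "coercive_diag (lebesgue_on \<Omega>) To"
  proof -
    obtain lo where lo: "0 < lo"
      "\<And>g m. m \<le> N \<Longrightarrow> odd m \<Longrightarrow> AE x in lebesgue_on \<Omega>. lo \<le> tcoef m * removal \<Sigma>t \<Sigma>s m g x"
      using bounds_o by (fastforce elim: AE_mp)
    show ?thesis unfolding To To_mat_def
      by (rule coercive_diag_T_mat[OF r[OF mom(2)] coeff_s[OF mom(2)] lo(1) lo(2)[OF mom(2)]]) simp
  qed
  have Sf2: "Sf \<in> L2 (lebesgue_on \<Omega>)" using source by (simp add: multi_L2)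
  have ph: "ph \<in> multi (Q_space \<Omega> \<Gamma>V \<Gamma>N)" using zeta_h(1) by (simp add: multi_def)
  show ?thesis unfolding plus_norm_def
  proof (rule SUP_least)
    fix \<xi> assume "\<xi> \<in> {\<xi> \<in> X_local \<Omega> \<Gamma>V \<Gamma>N \<T> K. S_norm \<Omega> \<Gamma>V \<Gamma>N \<T> To Te \<xi> \<le> 1}"
    moreover obtain q \<psi> where "\<xi> = (q, \<psi>)" by (rule prod.exhaust)
    ultimately show "ereal (d_form \<Omega> \<Gamma>V \<Gamma>N To Te (\<lambda>x. p x - ph x, \<lambda>x. \<phi> x - \<phi>t x) \<xi>)
      \<le> ereal (sqrt ((eta_r \<Omega> Te Sf ph \<phi>t K)\<^sup>2 + (\<Sum>K'\<in>nbrs \<T> K. (eta_f \<Omega> To ph \<phi>t K')\<^sup>2)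
          + (\<Sum>F\<in>local_facets \<Omega> \<T> \<Gamma>V K. (eta_bc \<Omega> \<Gamma>V \<Gamma>N \<T> To ph \<phi>t F)\<^sup>2)))"
      using local_residual_estimate[OF To_c Te_c Sf2 zeta ph reconstruction K] by simp
  qed
qed
end
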